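(* Let $\mathbf{F}:\,]0,\infty[\,\to\mathcal{S}$ be a singular LICM matrix-valued function. Then the unique solution $\mathbf{X}$ of the convolution equation $$\mathbf{F}\ast\mathbf{X}=\mathbf{I}\qquad(t>0),$$ where $\mathbf{I}$ denotes the constant function equal to the $N\times N$ identity matrix, is a singular LICM function $\mathbf{G}$.
   Context: $N\ge1$ is fixed and $\mathcal{S}$ is the space of real symmetric $N\times N$ matrices. A function $\mathbf{F}:\,]0,\infty[\,\to\mathcal{S}$ is completely monotone (CM) if it is infinitely differentiable and $(-1)^n \frac{\mathrm{d}^n}{\mathrm{d}t^n}\left(\mathbf{v}^{\mathsf T}\mathbf{F}(t)\mathbf{v}\right)\ge 0$ for all $t>0$, all integers $n\ge 0$ and all $\mathbf{v}\in\mathbb{R}^N$. It is locally integrable completely monotone (LICM) if it is CM and integrable over $]0,1]$. An LICM function $\mathbf{F}$ is called singular if $\mathbf{F}(t)$ is invertible for small $t>0$ and $\lim_{t\to0}\mathbf{F}(t)^{-1}=0$. The convolution is $(\mathbf{F}\ast\mathbf{G})(t)=\int_0^t\mathbf{F}(t-s)\,\mathbf{G}(s)\,\mathrm{d}s$, extended to matrix-valued Borel measures on $[0,\infty[$, a function $\mathbf{G}$ being identified with the measure $\mathbf{G}\,\mathrm{d}t$; the unit point mass $\upsilon$ at $0$ is the unit of the convolution. Solutions are sought in the class of matrix-valued measures $\upsilon\,\mathbf{C}+\mathbf{G}\,\mathrm{d}t$ with $\mathbf{C}$ a constant real $N\times N$ matrix and $\mathbf{G}$ a locally integrable real matrix-valued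 function on $[0,\infty[$ whose Laplace transform exists for every $p>0$, and the equation is understood as an equality of such measures. *)

theory Defs
  imports "HOL-Analysis.Analysis"
begin

definition infinitely_differentiable :: "(real \<Rightarrow> real^'n^'n) \<Rightarrow> bool" where
  "infinitely_differentiable F \<longleftrightarrow>
     (\<forall>k. \<forall>t>0. ((\<lambda>f s. vector_derivative f (at s)) ^^ k) F differentiable at t)"

text \<open>Functions on $]0,\infty[$ are total functions whose values at arguments $t \le 0$ are irrelevant.\<close>

definition completely_monotone :: "(real \<Rightarrow> real^'n^'n) \<Rightarrow> bool" where
  "completely_monotone F \<longleftrightarrow>
     (\<forall>t>0. transpose (F t) = F t) \<and>
     infinitely_differentiable F \<and>
     (\<forall>v. \<forall>n. \<forall>t>0. (-1) ^ n * (deriv ^^ n) (\<lambda>s. v \<bullet> (F s *v v)) t \<ge> 0)"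

definition LICM :: "(real \<Rightarrow> real^'n^'n) \<Rightarrow> bool" where
  "LICM F \<longleftrightarrow> completely_monotone F \<and> set_integrable lborel {0<..1} F"

definition singular_LICM :: "(real \<Rightarrow> real^'n^'n) \<Rightarrow> bool" where
  "singular_LICM F \<longleftrightarrow> LICM F \<and>
     (\<forall>\<^sub>F t in at_right 0. invertible (F t)) \<and>
     ((\<lambda>t. matrix_inv (F t)) \<longlongrightarrow> 0) (at_right 0)"

definition locally_integrable :: "(real \<Rightarrow> real^'n^'n) \<Rightarrow> bool" where
  "locally_integrable G \<longleftrightarrow> (\<forall>a. set_integrable lborel {0..a} G)"

definition laplace_transformable :: "(real \<Rightarrow> real^'n^'n) \<Rightarrow> bool" where
  "laplace_transformable G \<longleftrightarrow>
     (\<forall>p>0. set_integrable lborel {0..} (\<lambda>t. exp (- p * t) *\<^sub>R G t))"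

text \<open>
  A matrix-valued (Radon) measure on $[0,\infty[$ is a set function on the bounded Borel
  subsets of $[0,\infty[$; a locally integrable density need not give finite values on unbounded
  sets. All other sets are sent to 0, so that equality of set functions is equality of measures.
\<close>

definition bounded_borel :: "real set set" where
  "bounded_borel = {B. B \<in> sets borel \<and> bounded B \<and> B \<subseteq> {0..}}"

text \<open>The measure $\upsilon\,C + G\,\mathrm{d}t$, where $\upsilon$ is the unit point mass at 0:\<close>

definition atom_density :: "real^'n^'n \<Rightarrow> (real \<Rightarrow> real^'n^'n) \<Rightarrow> real set \<Rightarrow> real^'n^'n" where
  "atom_density C G B =
     (if B \<in> bounded_borel then indicator B 0 *\<^sub>R C + (LINT t:B|lborel. G t) else 0)"

abbreviation density_measure :: "(real \<Rightarrow> real^'n^'n) \<Rightarrow> real set \<Rightarrow> real^'n^'n" where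
  "density_measure G \<equiv> atom_density 0 G"

definition solution_class :: "(real set \<Rightarrow> real^'n^'n) set" where
  "solution_class = {atom_density C G | C G. locally_integrable G \<and> laplace_transformable G}"

text \<open>
  The convolution of the measure $F\,\mathrm{d}t$ with a measure $X$, from
  $(\mu \ast X)(B) = \int_{[0,\infty[} \mu(\mathrm{d}s)\, X(\{t \ge 0 : s + t \in B\})$.
\<close>

definition conv_measure ::
    "(real \<Rightarrow> real^'n^'n) \<Rightarrow> (real set \<Rightarrow> real^'n^'n) \<Rightarrow> real set \<Rightarrow> real^'n^'n"
    (infixr \<open>\<star>\<close> 70) where
  "(F \<star> X) B =
     (if B \<in> bounded_borel then LINT s:{0..}|lborel. F s ** X {t. 0 \<le> t \<and> s + t \<in> B} else 0)"

definition conv_fun ::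
    "(real \<Rightarrow> real^'n^'n) \<Rightarrow> (real \<Rightarrow> real^'n^'n) \<Rightarrow> real \<Rightarrow> real^'n^'n" where
  "conv_fun F G t = (LINT s:{0..t}|lborel. F (t - s) ** G s)"

definition convolution_solution ::
    "(real \<Rightarrow> real^'n^'n) \<Rightarrow> (real set \<Rightarrow> real^'n^'n) \<Rightarrow> bool" where
  "convolution_solution F X \<longleftrightarrow> X \<in> solution_class \<and> F \<star> X = density_measure (\<lambda>_. mat 1)"

text \<open>
  The measure convolution extends the convolution of functions and has $\upsilon$ as its unit:
  $F \ast (\upsilon\,C + G\,\mathrm{d}t) = (F\,C + F \ast G)\,\mathrm{d}t$.
\<close>

lemma bounded_bilinear_matrix_mult:
  "bounded_bilinear ((**) :: real^'n^'n \<Rightarrow> real^'n^'n \<Rightarrow> real^'n^'n)"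
proof -
  have "bilinear ((**) :: real^'n^'n \<Rightarrow> real^'n^'n \<Rightarrow> real^'n^'n)"
    unfolding bilinear_def
    by (auto intro!: linearI simp: matrix_matrix_mult_def vec_eq_iff sum.distrib sum_distrib_left algebra_simps)
  then show ?thesis
    by (simp add: bilinear_conv_bounded_bilinear)
qed

lemma conv_measure_atom_density:
  fixes F G :: "real \<Rightarrow> real^'n^'n"
  assumes F: "locally_integrable F" and G: "locally_integrable G"
  shows "F \<star> atom_density C G = density_measure (\<lambda>t. F t ** C + conv_fun F G t)"
proof
  fix B :: "real set"
  interpret mm: bounded_bilinear "(**) :: real^'n^'n \<Rightarrow> real^'n^'n \<Rightarrow> real^'n^'n"
    by (rule bounded_bilinear_matrix_mult)
  show "(F \<star> atom_density C G) B = density_measure (\<lambda>t. F t ** C + conv_fun F G t) B"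
  proof (cases "B \<in> bounded_borel")
    case False
    then show ?thesis by (simp add: conv_measure_def atom_density_def)
  next
    case B: True
    then have Bb[measurable]: "B \<in> sets borel" and B0: "B \<subseteq> {0..}" and "bounded B"
      by (auto simp: bounded_borel_def)
    then obtain b where b: "\<And>x. x \<in> B \<Longrightarrow> \<bar>x\<bar> \<le> b"
      by (auto simp: bounded_iff)
    define f where "f s = indicator {0..b} s *\<^sub>R F s" for s
    define g where "g t = indicator {0..b} t *\<^sub>R G t" for t
    have fi: "integrable lborel f" and gi: "integrable lborel g"
      using F G by (auto simp: locally_integrable_def set_integrable_def f_def[abs_def] g_def[abs_def])
    then have [measurable]: "f \<in> borel_measurable borel" "g \<in> borel_measurable borel"
      by auto
    define k where "k s u = indicator B u *\<^sub>R (f s ** g (u - s))" for s u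
    have mm_meas: "(\<lambda>x. p x ** q x) \<in> borel_measurable M"
      if [measurable]: "p \<in> borel_measurable M" "q \<in> borel_measurable M"
      for p q :: "'z \<Rightarrow> real^'n^'n" and M
      by (rule borel_measurable_continuous_Pair[OF that])
        (intro continuous_on_compose2[OF mm.continuous_on] continuous_intros mm.continuous_on)
    obtain K where "K > 0" and K: "\<And>(A::real^'n^'n) (D::real^'n^'n). norm (A ** D) \<le> norm A * norm D * K"
      using mm.pos_bounded by auto
    have gs: "integrable lborel (\<lambda>u. g (u - s))" for s
      using lborel_integrable_real_affine[OF gi, of 1 "-s"] by simp
    have ku: "integrable lborel (\<lambda>u. k s u)" for s
    proof -
      have "integrable lborel (\<lambda>u. f s ** g (u - s))"
        using gs by (rule mm.bounded_linear_right[THEN integrable_bounded_linear])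
      then have "set_integrable lborel B (\<lambda>u. f s ** g (u - s))"
        unfolding set_integrable_def by (intro integrable_mult_indicator) auto
      then show ?thesis by (simp add: k_def set_integrable_def)
    qed
    have kmeas: "(\<lambda>(s, u). k s u) \<in> borel_measurable (lborel \<Otimes>\<^sub>M lborel)"
      unfolding k_def split_beta by (intro borel_measurable_scaleR mm_meas) measurable
    have ki: "integrable (lborel \<Otimes>\<^sub>M lborel) (\<lambda>(s, u). k s u)"
    proof (rule lborel_pair.Fubini_integrable[OF kmeas])
      let ?I = "\<integral>u. norm (g u) \<partial>lborel"
      have bd: "(\<integral>u. norm (k s u) \<partial>lborel) \<le> norm (f s) * K * ?I" for s
      proof -
        have "(\<integral>u. norm (k s u) \<partial>lborel) \<le> (\<integral>u. norm (f s) * K * norm (g (u - s)) \<partial>lborel)"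
        proof (rule integral_mono)
          show "norm (k s u) \<le> norm (f s) * K * norm (g (u - s))" for u
            using K[of "f s" "g (u - s)"] \<open>K > 0\<close> by (auto simp: k_def indicator_def mult_ac)
        qed (use ku[of s] gs[of s] in auto)
        also have "\<dots> = norm (f s) * K * ?I"
          using lborel_integral_real_affine[of 1 "\<lambda>u. norm (g u)" "-s"] by simp
        finally show ?thesis .
      qed
      have [measurable]: "(\<lambda>s. \<integral>u. norm (k s u) \<partial>lborel) \<in> borel_measurable lborel"
        using kmeas by (intro lborel.borel_measurable_lebesgue_integral) (simp add: split_beta)
      show "integrable lborel (\<lambda>s. \<integral>u. norm (case (s, u) of (s, u) \<Rightarrow> k s u) \<partial>lborel)"
      proof (rule Bochner_Integration.integrable_bound[of lborel "\<lambda>s. norm (f s) * K * ?I"])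
        show "AE s in lborel. norm (\<integral>u. norm (case (s, u) of (s, u) \<Rightarrow> k s u) \<partial>lborel)
            \<le> norm (norm (f s) * K * ?I)"
          using order_trans[OF bd abs_ge_self] by (intro AE_I2) simp
      qed (use fi in simp_all)
    qed (use ku in auto)
    have fC: "integrable lborel (\<lambda>s. indicator B s *\<^sub>R (f s ** C))"
      using mm.bounded_linear_left[THEN integrable_bounded_linear, OF fi]
      by (intro integrable_mult_indicator) auto
    have X: "indicator {0..} s *\<^sub>R (F s ** atom_density C G {t. 0 \<le> t \<and> s + t \<in> B})
        = indicator B s *\<^sub>R (f s ** C) + (\<integral>u. k s u \<partial>lborel)" for s
    proof (cases "0 \<le> s \<and> s \<le> b")
      case True
      let ?S = "{t. 0 \<le> t \<and> s + t \<in> B}"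
      have "?S = {0..} \<inter> (\<lambda>t. s + t) -` B" by auto
      also have "\<dots> \<in> sets borel" by measurable
      finally have "?S \<in> sets borel" .
      moreover have "bounded ?S"
        using True b by (intro boundedI[of _ b]) force
      ultimately have S: "?S \<in> bounded_borel"
        by (auto simp: bounded_borel_def)
      have "(LINT t:?S|lborel. G t) = (\<integral>t. indicator B (s + t) *\<^sub>R g t \<partial>lborel)"
        unfolding set_lebesgue_integral_def
      proof (rule Bochner_Integration.integral_cong[OF refl])
        fix t show "indicator ?S t *\<^sub>R G t = indicator B (s + t) *\<^sub>R g t"
          using True b[of "s + t"] by (auto simp: g_def indicator_def)
      qed
      also have "\<dots> = (\<integral>u. indicator B u *\<^sub>R g (u - s) \<partial>lborel)"
        using lborel_integral_real_affine[of 1 "\<lambda>t. indicator B (s + t) *\<^sub>R g t" "-s"] by simp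
      finally have G': "(LINT t:?S|lborel. G t) = (\<integral>u. indicator B u *\<^sub>R g (u - s) \<partial>lborel)" .
      have "integrable lborel (\<lambda>u. indicator B u *\<^sub>R g (u - s))"
        using gs by (intro integrable_mult_indicator) auto
      then have "f s ** (\<integral>u. indicator B u *\<^sub>R g (u - s) \<partial>lborel) = (\<integral>u. k s u \<partial>lborel)"
        by (simp add: k_def integral_bounded_linear[OF mm.bounded_linear_right, symmetric]
            mm.scaleR_right)
      then show ?thesis
        using True S by (simp add: atom_density_def G' f_def mm.add_right indicator_def)
    next
      case False
      then have "f s = 0" by (simp add: f_def)
      moreover have "atom_density C G {t. 0 \<le> t \<and> s + t \<in> B} = 0" if "s > b"
      proof -
        have "{t. 0 \<le> t \<and> s + t \<in> B} = {}" using that b by force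
        then show ?thesis by (simp only:) (simp add: atom_density_def set_lebesgue_integral_def)
      qed
      ultimately show ?thesis
        using False by (auto simp: k_def mm.zero_left mm.zero_right indicator_def)
    qed
    have "(F \<star> atom_density C G) B
        = (\<integral>s. indicator B s *\<^sub>R (f s ** C) + (\<integral>u. k s u \<partial>lborel) \<partial>lborel)"
      using B by (simp add: conv_measure_def set_lebesgue_integral_def X)
    also have "\<dots> = (\<integral>s. indicator B s *\<^sub>R (f s ** C) \<partial>lborel)
        + (\<integral>s. (\<integral>u. k s u \<partial>lborel) \<partial>lborel)"
      using fC lborel_pair.integrable_fst'[OF ki] by (intro Bochner_Integration.integral_add) auto
    also have "(\<integral>s. (\<integral>u. k s u \<partial>lborel) \<partial>lborel) = (\<integral>u. (\<integral>s. k s u \<partial>lborel) \<partial>lborel)"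
      by (rule lborel_pair.Fubini_integral[symmetric, OF ki])
    also have "(\<integral>s. indicator B s *\<^sub>R (f s ** C) \<partial>lborel) + \<dots>
        = (\<integral>u. indicator B u *\<^sub>R (f u ** C) + (\<integral>s. k s u \<partial>lborel) \<partial>lborel)"
      using fC lborel_pair.integrable_snd[OF ki]
      by (intro Bochner_Integration.integral_add[symmetric]) auto
    also have "\<dots> = (LINT u:B|lborel. F u ** C + conv_fun F G u)"
      unfolding set_lebesgue_integral_def
    proof (rule Bochner_Integration.integral_cong[OF refl])
      fix u
      show "indicator B u *\<^sub>R (f u ** C) + (\<integral>s. k s u \<partial>lborel)
          = indicator B u *\<^sub>R (F u ** C + conv_fun F G u)"
      proof (cases "u \<in> B")
        case True
        then have u: "0 \<le> u" "u \<le> b" using B0 b[of u] by auto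
        have "(\<integral>s. k s u \<partial>lborel) = (\<integral>s. k (u - s) u \<partial>lborel)"
          using lborel_integral_real_affine[of "-1" "\<lambda>s. k s u" u] by simp
        also have "\<dots> = conv_fun F G u"
          unfolding conv_fun_def set_lebesgue_integral_def
        proof (rule Bochner_Integration.integral_cong[OF refl])
          fix s
          show "k (u - s) u = indicator {0..u} s *\<^sub>R (F (u - s) ** G s)"
            using True u by (auto simp: k_def f_def g_def indicator_def mm.zero_left mm.zero_right)
        qed
        finally show ?thesis using True u by (simp add: f_def)
      qed (simp add: k_def)
    qed
    finally show ?thesis
      using B by (simp only:) (simp add: atom_density_def)
  qed
qed

end

theory Submission
  imports Defs "HOL-Complex_Analysis.Great_Picard"
begin

text \<open>
  The equation is discretized. On a grid of mesh \<open>h\<close> the integrals \<open>a\<^sub>k\<close> of \<open>F\<close> over the cells form a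
  completely monotone sequence, and the recursively defined sequence \<open>g\<close> with \<open>\<Sum>j\<le>k. a\<^sub>k\<^sub>-\<^sub>j g\<^sub>j = I\<close>
  gives a step function that solves \<open>F \<^emph> G = I\<close> exactly at the grid points. Summation identities in the spirit
  of an energy balance express \<open>g\<^sub>m\<^sub>+\<^sub>n\<^sub>+\<^sub>1\<close> and \<open>g\<^sub>m\<^sub>+\<^sub>n - g\<^sub>m\<^sub>+\<^sub>n\<^sub>+\<^sub>1\<close> as positive semidefinite Hankel-type
  kernels built from \<open>a\<close>, hence \<open>g\<close> is completely monotone as well. Taking traces in the discrete equation bounds
  \<open>\<integral>\<^sub>0\<^sup>t tr G\<close> by \<open>N\<close> times the largest eigenvalue of the inverse of \<open>F(t)\<close>; as \<open>F\<close> is singular, no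
  mass can concentrate at 0 when the mesh is refined, and a convergent subsequence yields a completely
  monotone solution. Its singularity follows from the Laplace transformed equation, and uniqueness from
  convolving the difference of two solutions with this one.
\<close>

section \<open>Positive semidefinite matrices\<close>

text \<open>Two obstacles shape the proof. The first is an atom at 0: for the constant kernel
  \<open>I\<close> the discrete solution is \<open>I / h\<close> followed by zeros, and its limit is
  the unit point mass. The term \<open>g 0\<close> may thus be huge, so full complete monotonicity
  is claimed from index 1 on only, and estimates near 0 go through the trace bound. The second is
  that matrices do not commute and products of symmetric ones need not be symmetric. Positivity is
  therefore tested on quadratic forms and traces of products, symmetry of \<open>g\<close> is
  derived from the identities instead of being built in, and the equation with the factors exchanged
  is obtained by transposition. Differences of \<open>g\<close> are not treated order by order: a
  positive kernel of Hankel type gives all even orders at even indices at once, since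
  \<open>x^(2p) (1-x)^(2q)\<close> is a square, and the remaining parities come from related
  sequences. Representing measures never appear, only their finite Bernstein approximations.\<close>

interpretation mm: bounded_bilinear "(**) :: real^'n^'n \<Rightarrow> real^'n^'n \<Rightarrow> real^'n^'n"
  by (rule bounded_bilinear_matrix_mult)

lemma bounded_bilinear_matrix_vector_mult:
  "bounded_bilinear ((*v) :: real^'n^'m \<Rightarrow> real^'n \<Rightarrow> real^'m)"
proof -
  have "bilinear ((*v) :: real^'n^'m \<Rightarrow> real^'n \<Rightarrow> real^'m)"
    unfolding bilinear_def
    by (auto intro!: linearI simp: matrix_vector_mult_def vec_eq_iff sum.distrib sum_distrib_left algebra_simps)
  then show ?thesis
    by (simp add: bilinear_conv_bounded_bilinear)
qed

interpretation mv: bounded_bilinear "(*v) :: real^'n^'m \<Rightarrow> real^'n \<Rightarrow> real^'m"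
  by (rule bounded_bilinear_matrix_vector_mult)

lemma bounded_linear_transpose: "bounded_linear (transpose :: real^'n^'m \<Rightarrow> real^'m^'n)"
  by (intro linear_conv_bounded_linear[THEN iffD1] linearI) (auto simp: transpose_def vec_eq_iff)

lemmas transpose_add = linear_add[OF bounded_linear.linear[OF bounded_linear_transpose]]
  and transpose_diff = linear_diff[OF bounded_linear.linear[OF bounded_linear_transpose]]
  and transpose_scaleR = linear_scale[OF bounded_linear.linear[OF bounded_linear_transpose]]
  and transpose_sum = linear_sum[OF bounded_linear.linear[OF bounded_linear_transpose]]
  and transpose_zero = linear_0[OF bounded_linear.linear[OF bounded_linear_transpose]]

lemma bounded_linear_trace: "bounded_linear (trace :: real^'n^'n \<Rightarrow> real)"
  by (intro linear_conv_bounded_linear[THEN iffD1] linearI)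
    (auto simp: trace_def sum.distrib sum_distrib_left)

lemmas trace_diff = linear_diff[OF bounded_linear.linear[OF bounded_linear_trace]]
  and trace_scaleR = linear_scale[OF bounded_linear.linear[OF bounded_linear_trace]]
  and trace_sum = linear_sum[OF bounded_linear.linear[OF bounded_linear_trace]]
  and trace_zero = linear_0[OF bounded_linear.linear[OF bounded_linear_trace]]

lemma bounded_linear_form: "bounded_linear (\<lambda>A :: real^'n^'m. u \<bullet> (A *v v))"
  using bounded_linear_compose[OF bounded_linear_inner_right mv.bounded_linear_left] .

lemmas form_add = linear_add[OF bounded_linear.linear[OF bounded_linear_form]]
  and form_diff = linear_diff[OF bounded_linear.linear[OF bounded_linear_form]]
  and form_minus = linear_neg[OF bounded_linear.linear[OF bounded_linear_form]]
  and form_scaleR = linear_scale[OF bounded_linear.linear[OF bounded_linear_form]]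
  and form_sum = linear_sum[OF bounded_linear.linear[OF bounded_linear_form]]
  and form_zero = linear_0[OF bounded_linear.linear[OF bounded_linear_form]]

lemma inner_axis_mult_axis: "axis i 1 \<bullet> ((A :: real^'n^'m) *v axis j 1) = A $ i $ j"
  by (simp add: matrix_vector_mul_component inner_axis' inner_axis matrix_mult_dot)

lemma inner_transpose_mult: "u \<bullet> (transpose (A :: real^'n^'m) *v v) = (A *v u) \<bullet> v"
  by (metis dot_lmul_matrix inner_commute transpose_matrix_vector)

lemma inner_symmetric_mult:
  "transpose (A :: real^'n^'n) = A \<Longrightarrow> u \<bullet> (A *v v) = v \<bullet> (A *v u)"
  by (metis inner_commute inner_transpose_mult)

text \<open>Symmetry is demanded explicitly: over the reals the quadratic form only sees the
  symmetric part of a matrix.\<close>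

definition psd :: "real^'n^'n \<Rightarrow> bool" where
  "psd A \<longleftrightarrow> transpose A = A \<and> (\<forall>v. 0 \<le> v \<bullet> (A *v v))"

lemma psd_symmetric: "psd A \<Longrightarrow> transpose A = A"
  by (simp add: psd_def)

lemma psd_nonneg: "psd A \<Longrightarrow> 0 \<le> v \<bullet> (A *v v)"
  by (simp add: psd_def)

lemma psd_0: "psd 0"
  by (simp add: psd_def transpose_zero)

lemma psd_add: "psd A \<Longrightarrow> psd B \<Longrightarrow> psd (A + B)"
  by (simp add: psd_def transpose_add form_add)

lemma psd_scaleR: "0 \<le> c \<Longrightarrow> psd A \<Longrightarrow> psd (c *\<^sub>R A)"
  by (simp add: psd_def transpose_scaleR form_scaleR)

text \<open>The form at \<open>u + v\<close> and at \<open>u - v\<close>. Unlike Cauchy-Schwarz,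
  this bound is linear in \<open>A\<close>, so it can be summed over weights.\<close>

lemma psd_abs_le:
  assumes "psd A"
  shows "2 * \<bar>u \<bullet> (A *v v)\<bar> \<le> u \<bullet> (A *v u) + v \<bullet> (A *v v)"
proof -
  have "0 \<le> (u + v) \<bullet> (A *v (u + v))" "0 \<le> (u - v) \<bullet> (A *v (u - v))"
    using psd_nonneg[OF assms] by blast+
  then show ?thesis
    using inner_symmetric_mult[OF psd_symmetric[OF assms], of u v]
    by (simp add: mv.add_right mv.diff_right inner_simps)
qed

lemma psd_cauchy_schwarz:
  assumes "psd A"
  shows "(u \<bullet> (A *v v))\<^sup>2 \<le> (u \<bullet> (A *v u)) * (v \<bullet> (A *v v))"
proof -
  let ?a = "u \<bullet> (A *v u)" and ?b = "u \<bullet> (A *v v)" and ?c = "v \<bullet> (A *v v)"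
  have q: "0 \<le> ?a * s\<^sup>2 + 2 * ?b * s * t + ?c * t\<^sup>2" for s t
  proof -
    have "0 \<le> (s *\<^sub>R u + t *\<^sub>R v) \<bullet> (A *v (s *\<^sub>R u + t *\<^sub>R v))"
      by (rule psd_nonneg[OF assms])
    then show ?thesis
      using inner_symmetric_mult[OF psd_symmetric[OF assms], of u v]
      by (simp add: mv.add_right mv.scaleR_right inner_simps power2_eq_square algebra_simps)
  qed
  have ac: "0 \<le> ?a" "0 \<le> ?c" using psd_nonneg[OF assms] by blast+
  show ?thesis
  proof (cases "?c = 0")
    case True
    have "?b = 0"
    proof (rule ccontr)
      assume "?b \<noteq> 0"
      \<comment> \<open>With \<open>?c = 0\<close> the form is affine in \<open>t\<close>; this
        choice of \<open>t\<close> gives it the value -1.\<close>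
      then show False
        using q[of 1 "- (?a + 1) / (2 * ?b)"] True ac by (simp add: field_simps)
    qed
    then show ?thesis using True by simp
  next
    case False
    then have c: "?c > 0" using ac by simp
    \<comment> \<open>The choice \<open>s = ?c\<close>, \<open>t = - ?b\<close> produces the wanted
      difference, multiplied by \<open>?c\<close>.\<close>
    have "0 \<le> ?a * ?c\<^sup>2 + 2 * ?b * ?c * (- ?b) + ?c * (- ?b)\<^sup>2" by (rule q)
    also have "\<dots> = ?c * (?a * ?c - ?b\<^sup>2)" by (simp add: power2_eq_square algebra_simps)
    finally show ?thesis using c by (simp add: zero_le_mult_iff)
  qed
qed

lemma psd_diagonal_nonneg: "psd A \<Longrightarrow> 0 \<le> A $ i $ i"
  using psd_nonneg[of A "axis i 1"] by (simp add: inner_axis_mult_axis)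

lemma psd_diagonal_le_trace: "psd A \<Longrightarrow> A $ i $ i \<le> trace A"
  unfolding trace_def by (rule member_le_sum) (auto simp: psd_diagonal_nonneg)

lemma psd_trace_nonneg: "psd A \<Longrightarrow> 0 \<le> trace A"
  unfolding trace_def by (intro sum_nonneg) (auto simp: psd_diagonal_nonneg)

lemma norm_matrix_le_entries:
  fixes A :: "real^'n^'n"
  assumes e: "\<And>i j. norm (A $ i $ j) \<le> c"
  shows "norm A \<le> real CARD('n) ^ 2 * c"
proof -
  have "norm (A $ i) \<le> real CARD('n) * c" for i
    by (rule order_trans[OF L2_set_le_sum[of UNIV "\<lambda>j. norm (A $ i $ j)", folded norm_vec_def]])
      (use sum_mono[of UNIV "\<lambda>j. norm (A $ i $ j)" "\<lambda>_. c"] e in auto)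
  then have "(\<Sum>i\<in>UNIV. norm (A $ i)) \<le> (\<Sum>i\<in>(UNIV :: 'n set). real CARD('n) * c)"
    by (intro sum_mono)
  moreover have "norm A \<le> (\<Sum>i\<in>UNIV. norm (A $ i))"
    unfolding norm_vec_def by (rule L2_set_le_sum) simp
  ultimately show ?thesis
    by (simp add: power2_eq_square algebra_simps)
qed

text \<open>All entries are dominated by diagonal ones, so the single scalar \<open>trace A\<close>
  controls the matrix. The dimension factor is crude, but only finiteness matters later.\<close>

lemma psd_norm_le_trace:
  fixes A :: "real^'n^'n"
  assumes "psd A"
  shows "norm A \<le> real CARD('n) ^ 2 * trace A"
proof (rule norm_matrix_le_entries)
  show "norm (A $ i $ j) \<le> trace A" for i j
    using psd_abs_le[OF assms, of "axis i 1" "axis j 1"]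
      psd_diagonal_le_trace[OF assms, of i] psd_diagonal_le_trace[OF assms, of j]
    by (simp add: inner_axis_mult_axis)
qed

text \<open>By symmetric Gaussian elimination: splitting off a rank-one matrix clears one row and column of the
  second factor and leaves a positive semidefinite rest.\<close>

lemma trace_mult_nonneg:
  fixes A B :: "real^'n^'n"
  assumes A: "psd A" and B: "psd B"
  shows "0 \<le> trace (A ** B)"
proof -
  have "0 \<le> trace (A ** B)"
    if "finite S" "psd B" "\<And>i j. i \<notin> S \<or> j \<notin> S \<Longrightarrow> B $ i $ j = 0" for S and B :: "real^'n^'n"
    using that
  proof (induction S arbitrary: B rule: finite_induct)
    case empty
    then have "B = 0" by (simp add: vec_eq_iff)
    then show ?case by (simp add: mm.zero_right trace_zero)
  next
    case (insert k S)
    let ?e = "axis k 1 :: real^'n"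
    let ?b = "B *v ?e"
    have bk: "?b $ i = B $ i $ k" for i
      using inner_axis_mult_axis[of i B k] by (simp add: inner_axis')
    have sym: "B $ i $ j = B $ j $ i" for i j
      using inner_symmetric_mult[OF psd_symmetric[OF insert.prems(1)], of "axis i 1" "axis j 1"]
      by (simp add: inner_axis_mult_axis)
    show ?case
    proof (cases "B $ k $ k = 0")
      case True
      have "B $ i $ k = 0" for i
        using psd_cauchy_schwarz[OF insert.prems(1), of "axis i 1" ?e] True
        by (simp add: inner_axis_mult_axis)
      then have "B $ i $ j = 0" if "i \<notin> S \<or> j \<notin> S" for i j
        using that insert.prems(2)[of i j] sym by (cases "i = k"; cases "j = k") auto
      then show ?thesis using insert.IH insert.prems(1) by blast
    next
      case False
      define d where "d = B $ k $ k"
      have d: "d > 0" using False psd_diagonal_nonneg[OF insert.prems(1), of k] by (simp add: d_def)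
      define R :: "real^'n^'n" where "R = (\<chi> i j. ?b $ i * ?b $ j / d)"
      have Rv: "R *v v = ((?b \<bullet> v) / d) *\<^sub>R ?b" for v
        by (simp add: R_def vec_eq_iff matrix_vector_mult_def inner_vec_def sum_divide_distrib
            sum_distrib_left sum_distrib_right mult_ac)
      have "transpose R = R" by (simp add: R_def transpose_def vec_eq_iff mult.commute)
      moreover have "0 \<le> v \<bullet> ((B - R) *v v)" for v
      proof -
        have "(v \<bullet> ?b)\<^sup>2 \<le> (v \<bullet> (B *v v)) * d"
          using psd_cauchy_schwarz[OF insert.prems(1), of v ?e] by (simp add: d_def inner_axis_mult_axis)
        then show ?thesis
          using d by (simp add: form_diff Rv inner_commute power2_eq_square field_simps)
      qed
      ultimately have "psd (B - R)"
        using psd_symmetric[OF insert.prems(1)] by (simp add: psd_def transpose_diff)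
      moreover have "(B - R) $ i $ j = 0" if "i \<notin> S \<or> j \<notin> S" for i j
      proof (cases "i = k \<or> j = k")
        case True
        then show ?thesis using d sym[of k j] by (auto simp: R_def bk d_def[symmetric])
      next
        case False
        then show ?thesis
          using that insert.prems(2)[of i j] insert.prems(2)[of i k] insert.prems(2)[of j k]
          by (auto simp: R_def bk)
      qed
      ultimately have "0 \<le> trace (A ** (B - R))" using insert.IH by blast
      moreover have "trace (A ** R) = (b \<bullet> (A *v b)) / d" if "R = (\<chi> i j. b $ i * b $ j / d)" for b
        by (simp add: trace_def that matrix_matrix_mult_def inner_vec_def matrix_vector_mult_def
            sum_distrib_left sum_divide_distrib mult_ac)
      then have "0 \<le> trace (A ** R)" using psd_nonneg[OF A] d R_def by simp
      ultimately show ?thesis by (simp add: mm.diff_right trace_diff)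
    qed
  qed
  then show ?thesis using B by (metis UNIV_I finite)
qed

section \<open>Coercivity of a matrix and the size of its inverse\<close>

lemma matrix_inv_right:
  fixes A :: "real^'n^'n"
  assumes "invertible A"
  shows "A ** matrix_inv A = mat 1"
  using someI_ex[OF assms[unfolded invertible_def]] by (auto simp: matrix_inv_def)

lemma coercive_imp_invertible:
  fixes A :: "real^'n^'n"
  assumes "0 < c" and A: "\<And>v. c * (v \<bullet> v) \<le> v \<bullet> (A *v v)"
  shows "invertible A"
proof -
  have "v = 0" if "A *v v = 0" for v
  proof (rule ccontr)
    assume "v \<noteq> 0"
    then have "0 < c * (v \<bullet> v)" using \<open>0 < c\<close> by simp
    then show False using A[of v] that by simp
  qed
  then show ?thesis
    by (metis invertible_left_inverse matrix_left_invertible_ker)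
qed

lemma norm_matrix_le_operator:
  fixes A :: "real^'n^'n"
  assumes "\<And>v. norm (A *v v) \<le> c * norm v"
  shows "norm A \<le> real CARD('n) ^ 2 * c"
proof (rule norm_matrix_le_entries)
  fix i j
  have "norm (A $ i $ j) \<le> norm (A *v axis j 1)"
    using inner_axis_mult_axis[of i A j] component_le_norm_cart[of "A *v axis j 1" i] by (simp add: inner_axis')
  also have "\<dots> \<le> c" using assms[of "axis j 1"] by simp
  finally show "norm (A $ i $ j) \<le> c" .
qed

lemma coercive_imp_norm_inv_le:
  fixes A :: "real^'n^'n"
  assumes "0 < c" and A: "\<And>v. c * (v \<bullet> v) \<le> v \<bullet> (A *v v)"
  shows "norm (matrix_inv A) \<le> real CARD('n) ^ 2 * (1 / c)"
proof (rule norm_matrix_le_operator)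
  fix w
  define v where "v = matrix_inv A *v w"
  have Av: "A *v v = w"
    using matrix_inv_right[OF coercive_imp_invertible[OF assms]]
    by (simp add: v_def matrix_vector_mul_assoc)
  have "c * (v \<bullet> v) \<le> norm v * norm w"
    using A[of v] norm_cauchy_schwarz[of v w] by (simp add: Av)
  then have "norm v * (c * norm v) \<le> norm v * norm w"
    by (simp add: power2_norm_eq_inner[symmetric] power2_eq_square mult_ac)
  then have "c * norm v \<le> norm w"
    using \<open>0 < c\<close> by (cases "v = 0") auto
  then show "norm (matrix_inv A *v w) \<le> 1 / c * norm w"
    using \<open>0 < c\<close> by (simp add: v_def field_simps)
qed

text \<open>Let \<open>w\<close> be the inverse of \<open>A\<close> applied to \<open>v\<close>. As
  \<open>A *v w = v\<close>, Cauchy-Schwarz for the form of \<open>A\<close> bounds the square of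
  \<open>v . v\<close> by \<open>v . A v\<close> times \<open>w . v\<close>, and the bound on the
  inverse controls the latter.\<close>

lemma norm_inv_le_imp_coercive:
  fixes A :: "real^'n^'n"
  assumes A: "psd A" "invertible A" and c: "0 < c"
    and le: "\<And>v. norm (matrix_inv A *v v) \<le> 1 / c * norm v"
  shows "c * (v \<bullet> v) \<le> v \<bullet> (A *v v)"
proof (cases "v = 0")
  case False
  define w where "w = matrix_inv A *v v"
  have Aw: "A *v w = v"
    using matrix_inv_right[OF A(2)] by (simp add: w_def matrix_vector_mul_assoc)
  have "(v \<bullet> v)\<^sup>2 \<le> (v \<bullet> (A *v v)) * (w \<bullet> v)"
    using psd_cauchy_schwarz[OF A(1), of v w] by (simp add: Aw)
  also have "w \<bullet> v \<le> (1 / c) * (v \<bullet> v)"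
  proof -
    have "w \<bullet> v \<le> norm w * norm v" by (rule norm_cauchy_schwarz)
    also have "\<dots> \<le> (1 / c * norm v) * norm v"
      using le[of v] by (intro mult_right_mono) (auto simp: w_def)
    finally show ?thesis by (simp add: power2_norm_eq_inner[symmetric] power2_eq_square)
  qed
  finally have "(v \<bullet> v) * (v \<bullet> v) \<le> (v \<bullet> (A *v v)) * (1 / c) * (v \<bullet> v)"
    using psd_nonneg[OF A(1), of v] by (simp add: power2_eq_square mult_left_mono mult.assoc)
  then have "v \<bullet> v \<le> (v \<bullet> (A *v v)) * (1 / c)"
    by (rule mult_right_le_imp_le) (use False in simp)
  then show ?thesis using c by (simp add: field_simps)
qed simp

section \<open>Completely monotone sequences of matrices and their reciprocals\<close>

text \<open>This is \<open>(-1)^n\<close> times the n-th forward difference; with this sign complete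
  monotonicity is positivity of every term. On the power sequence \<open>x^k\<close> it gives
  \<open>x^k (1-x)^n\<close>.\<close>

fun bdiff :: "nat \<Rightarrow> (nat \<Rightarrow> 'a::real_vector) \<Rightarrow> nat \<Rightarrow> 'a" where
  "bdiff 0 A k = A k"
| "bdiff (Suc n) A k = bdiff n A k - bdiff n A (Suc k)"

lemma bdiff_bdiff: "bdiff n (bdiff m A) k = bdiff (n + m) A k"
  by (induction n arbitrary: k) auto

lemma bdiff_shift: "bdiff n (\<lambda>k. A (k + j)) k = bdiff n A (k + j)"
  by (induction n arbitrary: k) auto

lemma sum_choose_Suc:
  fixes f :: "nat \<Rightarrow> 'a::real_vector"
  shows "(\<Sum>i\<le>n. real (n choose i) *\<^sub>R (f i + f (Suc i))) = (\<Sum>i\<le>Suc n. real (Suc n choose i) *\<^sub>R f i)"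
proof -
  have "(\<Sum>i\<le>Suc n. real (Suc n choose i) *\<^sub>R f i)
      = f 0 + (\<Sum>i\<le>n. real (n choose Suc i) *\<^sub>R f (Suc i)) + (\<Sum>i\<le>n. real (n choose i) *\<^sub>R f (Suc i))"
    by (simp only: sum.atMost_Suc_shift) (simp add: algebra_simps sum.distrib)
  also have "f 0 + (\<Sum>i\<le>n. real (n choose Suc i) *\<^sub>R f (Suc i)) = (\<Sum>i\<le>Suc n. real (n choose i) *\<^sub>R f i)"
    by (simp only: sum.atMost_Suc_shift) simp
  also have "\<dots> = (\<Sum>i\<le>n. real (n choose i) *\<^sub>R f i)" by (simp add: binomial_eq_0)
  finally show ?thesis by (simp add: algebra_simps sum.distrib)
qed

lemma bdiff_eq_sum: "bdiff n A k = (\<Sum>i\<le>n. ((-1) ^ i * real (n choose i)) *\<^sub>R A (k + i))"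
proof (induction n arbitrary: k)
  case (Suc n)
  have "bdiff (Suc n) A k = (\<Sum>i\<le>n. real (n choose i) *\<^sub>R ((-1) ^ i *\<^sub>R A (k + i) + (-1) ^ Suc i *\<^sub>R A (k + Suc i)))"
    by (simp add: Suc algebra_simps sum_subtractf)
  also have "\<dots> = (\<Sum>i\<le>Suc n. ((-1) ^ i * real (Suc n choose i)) *\<^sub>R A (k + i))"
    by (subst sum_choose_Suc) (simp add: mult_ac)
  finally show ?case .
qed simp

text \<open>With the shift \<open>S\<close>, this is the binomial theorem for
  \<open>1 = ((1 - S) + S)^n\<close>, where \<open>bdiff\<close> of order \<open>j\<close> is
  \<open>(1 - S)^j\<close>.\<close>

lemma bernstein_expansion:
  "A k = (\<Sum>i\<le>n. real (n choose i) *\<^sub>R bdiff (n - i) A (k + i))"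
proof (induction n arbitrary: k)
  case (Suc n)
  have "A k = (\<Sum>i\<le>n. real (n choose i) *\<^sub>R (bdiff (Suc n - i) A (k + i) + bdiff (Suc n - Suc i) A (k + Suc i)))"
    by (subst Suc, rule sum.cong) (auto simp: Suc_diff_le)
  also have "\<dots> = (\<Sum>i\<le>Suc n. real (Suc n choose i) *\<^sub>R bdiff (Suc n - i) A (k + i))"
    by (rule sum_choose_Suc)
  finally show ?case .
qed simp

text \<open>Taking \<open>n = N - k\<close> in \<open>bernstein_expansion\<close> and normalizing
  the binomials makes the matrix weights the same for every \<open>k\<close>. Only the scalar
  coefficients depend on \<open>k\<close>, and these approximate \<open>(l / N)^k\<close>:
  Hausdorff's approximation of a moment sequence by atoms at \<open>l / N\<close>.\<close>

lemma bernstein_expansion_degree: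
  assumes "k \<le> N"
  shows "A k = (\<Sum>l\<le>N. (real (l choose k) / real (N choose k)) *\<^sub>R (real (N choose l) *\<^sub>R bdiff (N - l) A l))"
proof -
  have "A k = (\<Sum>i\<le>N - k. real (N - k choose i) *\<^sub>R bdiff (N - k - i) A (k + i))"
    by (rule bernstein_expansion)
  also have "\<dots> = (\<Sum>l\<in>{k..N}. real (N - k choose (l - k)) *\<^sub>R bdiff (N - l) A l)"
    by (rule sum.reindex_bij_witness[of _ "\<lambda>l. l - k" "\<lambda>i. k + i"]) (use assms in auto)
  also have "\<dots> = (\<Sum>l\<in>{k..N}. (real (l choose k) / real (N choose k)) *\<^sub>R (real (N choose l) *\<^sub>R bdiff (N - l) A l))"
  proof (rule sum.cong[OF refl])
    fix l assume l: "l \<in> {k..N}"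
    then have "(N choose l) * (l choose k) = (N choose k) * (N - k choose (l - k))"
      by (intro choose_mult) auto
    then have "real (N choose l) * real (l choose k) = real (N choose k) * real (N - k choose (l - k))"
      by (metis of_nat_mult)
    moreover have "real (N choose k) \<noteq> 0" using assms by simp
    ultimately have "real (N - k choose (l - k)) = real (l choose k) / real (N choose k) * real (N choose l)"
      by (simp add: field_simps)
    then show "real (N - k choose (l - k)) *\<^sub>R bdiff (N - l) A l =
        (real (l choose k) / real (N choose k)) *\<^sub>R (real (N choose l) *\<^sub>R bdiff (N - l) A l)"
      by simp
  qed
  also have "\<dots> = (\<Sum>l\<le>N. (real (l choose k) / real (N choose k)) *\<^sub>R (real (N choose l) *\<^sub>R bdiff (N - l) A l))"
    by (rule sum.mono_neutral_left) (auto simp: binomial_eq_0)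
  finally show ?thesis .
qed

text \<open>The ratio is a product of \<open>k\<close> factors \<open>(l - i) / (N - i)\<close>,
  each within \<open>K / (N - K)\<close> of \<open>l / N\<close>; all factors lie in [0,1], so the
  errors add up at most linearly.\<close>

lemma choose_ratio_approx:
  assumes "l \<le> N" "k \<le> K" "K < N"
  shows "\<bar>real (l choose k) / real (N choose k) - (real l / real N) ^ k\<bar> \<le> real K ^ 2 / (real N - real K)"
proof (cases "k \<le> l")
  case True
  have "real (l choose k) / real (N choose k) = (\<Prod>i=0..<k. real (l - i) / real (N - i))"
    using True assms
    by (simp add: binomial_altdef_of_nat[of k l, where 'a=real] binomial_altdef_of_nat[of k N, where 'a=real]
        prod_dividef[symmetric])
  moreover have "(real l / real N) ^ k = (\<Prod>i=0..<k. real l / real N)" by simp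
  moreover have "norm ((\<Prod>i=0..<k. real (l - i) / real (N - i)) - (\<Prod>i=0..<k. real l / real N))
      \<le> (\<Sum>i=0..<k. norm (real (l - i) / real (N - i) - real l / real N))"
    using True assms by (intro norm_prod_diff) (auto simp: divide_le_eq_1 diff_le_mono)
  moreover have "\<dots> \<le> (\<Sum>i=0..<k. real K / (real N - real K))"
  proof (rule sum_mono)
    fix i assume i: "i \<in> {0..<k}"
    have n: "0 < real N" "0 < real N - real i" "0 < real N - real K" "0 \<le> real l" "real i \<le> real K"
      using i assms by auto
    have "real (l - i) / real (N - i) - real l / real N = - (real i * (real N - real l) / (real N * (real N - real i)))"
      using i True assms n by (simp add: of_nat_diff field_simps)
    then have "norm (real (l - i) / real (N - i) - real l / real N) = real i * ((real N - real l) / real N) / (real N - real i)"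
      using n assms by (simp add: abs_mult)
    also have "\<dots> \<le> real K * 1 / (real N - real K)"
      using n assms by (intro frac_le mult_mono) (auto simp: field_simps)
    finally show "norm (real (l - i) / real (N - i) - real l / real N) \<le> real K / (real N - real K)" by simp
  qed
  moreover have "\<dots> \<le> real K * (real K / (real N - real K))"
    using assms by (simp add: divide_right_mono mult_right_mono)
  ultimately show ?thesis by (simp add: power2_eq_square)
next
  case False
  \<comment> \<open>Here \<open>l < k\<close>, so the ratio is 0 and \<open>k\<close> is at least 1;
    it is enough that \<open>l / N\<close> is small.\<close>
  have "(real l / real N) ^ k \<le> (real l / real N) ^ 1"
    using False assms by (intro power_decreasing) auto
  also have "\<dots> \<le> real K ^ 2 / (real N - real K)"
  proof -
    have "real l \<le> real K" "real K \<le> real K ^ 2"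
      using False assms by (auto intro: self_le_power)
    then show ?thesis using assms by (simp, intro frac_le) auto
  qed
  finally show ?thesis using False by (simp add: binomial_eq_0)
qed

section \<open>Complete monotonicity and Hankel positivity of sequences\<close>

definition cmseq :: "(nat \<Rightarrow> real^'n^'n) \<Rightarrow> bool" where
  "cmseq A \<longleftrightarrow> (\<forall>n k. psd (bdiff n A k))"

text \<open>Positivity of the block Hankel form, the condition of the Hamburger moment problem on
  the whole line. It follows from \<open>cmseq\<close> and, unlike it, survives the congruences used
  below.\<close>

definition hankel_psd :: "(nat \<Rightarrow> real^'n^'n) \<Rightarrow> bool" where
  "hankel_psd A \<longleftrightarrow> (\<forall>S v. finite S \<longrightarrow> 0 \<le> (\<Sum>i\<in>S. \<Sum>j\<in>S. v i \<bullet> (A (i + j) *v v j)))"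

lemma cmseq_psd: "cmseq A \<Longrightarrow> psd (A k)"
  using bdiff.simps(1)[of A k] unfolding cmseq_def by metis

lemma cmseq_Suc: "cmseq A \<Longrightarrow> cmseq (\<lambda>k. A (Suc k))"
  using bdiff_shift[of _ A 1] unfolding cmseq_def by simp

lemma cmseq_diff: "cmseq A \<Longrightarrow> cmseq (\<lambda>k. A k - A (Suc k))"
proof -
  have "(\<lambda>k. A k - A (Suc k)) = bdiff 1 A" by auto
  then show "cmseq A \<Longrightarrow> cmseq (\<lambda>k. A k - A (Suc k))"
    unfolding cmseq_def by (metis bdiff_bdiff)
qed

text \<open>A completely monotone sequence is a limit of sequences \<open>k \<mapsto> \<Sum>l\<le>N. (l / N) ^ k *\<^sub>R W l\<close> with
  positive semidefinite weights, as for Hausdorff moment sequences.\<close>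

lemma cmseq_imp_hankel_psd:
  fixes A :: "nat \<Rightarrow> real^'n^'n"
  assumes "cmseq A"
  shows "hankel_psd A"
  unfolding hankel_psd_def
proof (intro allI impI)
  fix S :: "nat set" and v :: "nat \<Rightarrow> real^'n"
  assume fin: "finite S"
  then obtain m where m: "\<And>i. i \<in> S \<Longrightarrow> i \<le> m" by (meson finite_nat_set_iff_bounded_le)
  define Q where "Q = (\<Sum>i\<in>S. \<Sum>j\<in>S. v i \<bullet> (A (i + j) *v v j))"
  \<comment> \<open>For every \<open>N\<close> the weights \<open>W l\<close> sum to
    \<open>A 0\<close>, so \<open>C\<close> bounds the sum of all \<open>|v i . W l v j|\<close>
    independently of \<open>N\<close>. Replacing the coefficients by exact powers then costs at most
    \<open>e N * C\<close>.\<close>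
  define C where "C = (\<Sum>i\<in>S. \<Sum>j\<in>S. v i \<bullet> (A 0 *v v i) + v j \<bullet> (A 0 *v v j))"
  define e where "e N = real (2 * m) ^ 2 / (real N - real (2 * m))" for N :: nat
  have bound: "- (e N * C) \<le> Q" if N: "2 * m < N" for N
  proof -
    define W where "W l = real (N choose l) *\<^sub>R bdiff (N - l) A l" for l
    define r where "r l k = real (l choose k) / real (N choose k)" for l k
    define x where "x l = real l / real N" for l
    have W: "psd (W l)" for l
      using assms unfolding W_def cmseq_def by (auto intro!: psd_scaleR)
    have A: "A k = (\<Sum>l\<le>N. r l k *\<^sub>R W l)" if "k \<le> N" for k
      unfolding r_def W_def by (rule bernstein_expansion_degree[OF that])
    have Q: "Q = (\<Sum>l\<le>N. \<Sum>i\<in>S. \<Sum>j\<in>S. r l (i + j) * (v i \<bullet> (W l *v v j)))"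
    proof -
      have "Q = (\<Sum>i\<in>S. \<Sum>j\<in>S. \<Sum>l\<le>N. r l (i + j) * (v i \<bullet> (W l *v v j)))"
        unfolding Q_def
      proof (intro sum.cong refl)
        fix i j assume "i \<in> S" "j \<in> S"
        then have "i + j \<le> N" using m[of i] m[of j] N by simp
        then show "v i \<bullet> (A (i + j) *v v j) = (\<Sum>l\<le>N. r l (i + j) * (v i \<bullet> (W l *v v j)))"
          by (subst A) (simp_all add: form_sum form_scaleR)
      qed
      also have "\<dots> = (\<Sum>i\<in>S. \<Sum>l\<le>N. \<Sum>j\<in>S. r l (i + j) * (v i \<bullet> (W l *v v j)))"
        by (intro sum.cong refl sum.swap)
      also have "\<dots> = (\<Sum>l\<le>N. \<Sum>i\<in>S. \<Sum>j\<in>S. r l (i + j) * (v i \<bullet> (W l *v v j)))"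
        by (rule sum.swap)
      finally show ?thesis .
    qed
    have C: "C = (\<Sum>l\<le>N. \<Sum>i\<in>S. \<Sum>j\<in>S. v i \<bullet> (W l *v v i) + v j \<bullet> (W l *v v j))"
    proof -
      have A0: "A 0 = (\<Sum>l\<le>N. W l)" using A[of 0] by (simp add: r_def)
      have "C = (\<Sum>i\<in>S. \<Sum>j\<in>S. \<Sum>l\<le>N. v i \<bullet> (W l *v v i) + v j \<bullet> (W l *v v j))"
        by (simp add: C_def A0 form_sum sum.distrib)
      also have "\<dots> = (\<Sum>i\<in>S. \<Sum>l\<le>N. \<Sum>j\<in>S. v i \<bullet> (W l *v v i) + v j \<bullet> (W l *v v j))"
        by (intro sum.cong refl sum.swap)
      also have "\<dots> = (\<Sum>l\<le>N. \<Sum>i\<in>S. \<Sum>j\<in>S. v i \<bullet> (W l *v v i) + v j \<bullet> (W l *v v j))"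
        by (rule sum.swap)
      finally show ?thesis .
    qed
    have e0: "0 \<le> e N" using N by (simp add: e_def)
    have "- (e N * C) = (\<Sum>l\<le>N. \<Sum>i\<in>S. \<Sum>j\<in>S. - (e N * (v i \<bullet> (W l *v v i) + v j \<bullet> (W l *v v j))))"
      by (simp add: C sum_distrib_left sum_negf)
    also have "\<dots> \<le> (\<Sum>l\<le>N. \<Sum>i\<in>S. \<Sum>j\<in>S. (r l (i + j) - x l ^ (i + j)) * (v i \<bullet> (W l *v v j)))"
    proof (intro sum_mono)
      fix l i j assume "l \<in> {..N}" "i \<in> S" "j \<in> S"
      then have "\<bar>r l (i + j) - x l ^ (i + j)\<bar> \<le> e N"
        unfolding r_def x_def e_def using m[of i] m[of j] N by (intro choose_ratio_approx) auto
      moreover have "\<bar>v i \<bullet> (W l *v v j)\<bar> \<le> v i \<bullet> (W l *v v i) + v j \<bullet> (W l *v v j)"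
        using psd_abs_le[OF W, of "v i" l "v j"] by linarith
      ultimately have "\<bar>r l (i + j) - x l ^ (i + j)\<bar> * \<bar>v i \<bullet> (W l *v v j)\<bar>
          \<le> e N * (v i \<bullet> (W l *v v i) + v j \<bullet> (W l *v v j))"
        using e0 by (intro mult_mono) auto
      then show "- (e N * (v i \<bullet> (W l *v v i) + v j \<bullet> (W l *v v j)))
          \<le> (r l (i + j) - x l ^ (i + j)) * (v i \<bullet> (W l *v v j))"
        by (simp add: abs_mult[symmetric])
    qed
    also have "\<dots> = Q - (\<Sum>l\<le>N. \<Sum>i\<in>S. \<Sum>j\<in>S. x l ^ (i + j) * (v i \<bullet> (W l *v v j)))"
      by (simp add: Q left_diff_distrib sum_subtractf)
    also have "\<dots> \<le> Q"
    proof -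
      \<comment> \<open>With exact powers the double sum is a single quadratic form of
        \<open>W l\<close>.\<close>
      have "(\<Sum>i\<in>S. \<Sum>j\<in>S. x l ^ (i + j) * (v i \<bullet> (W l *v v j)))
          = (\<Sum>i\<in>S. x l ^ i *\<^sub>R v i) \<bullet> (W l *v (\<Sum>j\<in>S. x l ^ j *\<^sub>R v j))" for l
        by (simp add: mv.sum_right mv.scaleR_right inner_sum_left inner_sum_right sum_distrib_left power_add mult_ac, subst sum.swap, simp add: mult_ac)
      then have "0 \<le> (\<Sum>l\<le>N. \<Sum>i\<in>S. \<Sum>j\<in>S. x l ^ (i + j) * (v i \<bullet> (W l *v v j)))"
        using psd_nonneg[OF W] by (simp add: sum_nonneg)
      then show ?thesis by simp
    qed
    finally show ?thesis .
  qed
  have "(\<lambda>N. - (e N * C)) \<longlonglongrightarrow> - (0 * C)"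
  proof (intro tendsto_intros)
    have "filterlim (\<lambda>N. real N - real (2 * m)) at_top sequentially"
      using filterlim_tendsto_add_at_top[OF tendsto_const[of "- real (2 * m)"] filterlim_real_sequentially]
      by (simp add: add.commute)
    then show "e \<longlonglongrightarrow> 0"
      unfolding e_def[abs_def] by (rule real_tendsto_divide_at_top[OF tendsto_const])
  qed
  moreover have "eventually (\<lambda>N. - (e N * C) \<le> Q) sequentially"
    using bound eventually_gt_at_top[of "2 * m"] by (rule eventually_mono[rotated])
  ultimately show "0 \<le> (\<Sum>i\<in>S. \<Sum>j\<in>S. v i \<bullet> (A (i + j) *v v j))"
    unfolding Q_def[symmetric] by (metis mult_zero_left neg_0_equal_iff_equal tendsto_upperbound sequentially_bot)
qed

lemma bdiff_symmetric:
  fixes A :: "nat \<Rightarrow> real^'n^'n"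
  shows "(\<And>k. transpose (A k) = A k) \<Longrightarrow> transpose (bdiff n A k) = bdiff n A k"
  by (induction n arbitrary: k) (auto simp: transpose_diff)

text \<open>In moment language \<open>bdiff n\<close> at \<open>k\<close> integrates
  \<open>x^k (1-x)^n\<close>, for even exponents the square of \<open>x^p (1-x)^q\<close>. The test
  vectors are the coefficients of this polynomial times \<open>v\<close>.\<close>

lemma hankel_psd_imp_bdiff_psd:
  assumes A: "hankel_psd A" and sym: "\<And>k. transpose (A k) = A k"
    and "even n" "even k"
  shows "psd (bdiff n A k)"
proof -
  obtain p q where n: "n = q + q" and k: "k = p + p"
    using assms(3,4) by (metis evenE mult_2)
  define c where "c i = (-1) ^ i * real (q choose i)" for i
  have eq: "bdiff n A k = (\<Sum>i\<le>q. \<Sum>j\<le>q. (c i * c j) *\<^sub>R A (k + i + j))"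
    unfolding n bdiff_bdiff[symmetric] bdiff_eq_sum[of q] c_def by (simp add: scaleR_sum_right)
  have "0 \<le> v \<bullet> (bdiff n A k *v v)" for v
  proof -
    let ?S = "(+) p ` {..q}"
    have "0 \<le> (\<Sum>i\<in>?S. \<Sum>j\<in>?S. (c (i - p) *\<^sub>R v) \<bullet> (A (i + j) *v (c (j - p) *\<^sub>R v)))"
      by (rule A[unfolded hankel_psd_def, rule_format]) simp
    also have "\<dots> = v \<bullet> (bdiff n A k *v v)"
      by (simp add: eq[unfolded k] k sum.reindex form_sum form_scaleR mv.scaleR_right mult_ac add_ac)
    finally show ?thesis .
  qed
  then show ?thesis using bdiff_symmetric[OF sym] by (simp add: psd_def)
qed

text \<open>Each Hankel hypothesis covers one parity class of order and index: \<open>h1\<close>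
  both even, \<open>h2\<close> even order and odd index, \<open>hd\<close> both odd, because there
  \<open>k + 1\<close> and \<open>n - 1\<close> are even. A difference of odd order at an even index
  is the sum of two terms already covered.\<close>

lemma cmseq_of_hankel_psd:
  assumes sym: "\<And>k. transpose (g k) = g k"
    and h1: "hankel_psd (\<lambda>k. g (Suc k))" and h2: "hankel_psd (\<lambda>k. g (Suc (Suc k)))"
    and hd: "hankel_psd (\<lambda>k. g k - g (Suc k))"
  shows "cmseq (\<lambda>k. g (Suc k))"
  unfolding cmseq_def
proof (intro allI)
  fix n k
  let ?A = "\<lambda>k. g (Suc k)"
  have even: "psd (bdiff n ?A k)" if "even n" for n k
  proof (cases "even k")
    case True
    then show ?thesis using hankel_psd_imp_bdiff_psd[OF h1] sym that by blast
  next
    case False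
    then obtain l where l: "k = Suc l" "even l" using False by (cases k) auto
    have "psd (bdiff n (\<lambda>k. g (Suc (Suc k))) l)"
      by (rule hankel_psd_imp_bdiff_psd[OF h2 _ that l(2)]) (rule sym)
    then show ?thesis using bdiff_shift[of n ?A 1 l] by (simp add: l(1))
  qed
  have odd: "psd (bdiff n ?A k)" if n: "odd n" and k: "odd k" for n k
  proof -
    obtain l where l: "n = Suc l" "even l" using n by (cases n) auto
    have "(\<lambda>k. g k - g (Suc k)) = bdiff 1 g" by auto
    then have "psd (bdiff l (bdiff 1 g) (Suc k))"
      using hankel_psd_imp_bdiff_psd[OF hd, of l "Suc k"] sym k l by (simp add: transpose_diff)
    then have "psd (bdiff n g (Suc k))" by (simp add: bdiff_bdiff l)
    then show ?thesis using bdiff_shift[of n g 1 k] by simp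
  qed
  show "psd (bdiff n ?A k)"
  proof (cases "even n \<or> odd k")
    case True
    then show ?thesis using even odd by blast
  next
    case False
    have "psd (bdiff n ?A (Suc k))" using odd[of n "Suc k"] False by simp
    moreover have "psd (bdiff (Suc n) ?A k)" using even[of "Suc n" k] False by (simp del: bdiff.simps)
    ultimately have "psd (bdiff (Suc n) ?A k + bdiff n ?A (Suc k))" by (metis psd_add)
    then show ?thesis by simp
  qed
qed

text \<open>The coefficient of \<open>x^m y^n\<close> in \<open>U(x)^T K(x,y) U(y)\<close>, where
  \<open>U\<close> generates \<open>u\<close> and \<open>K\<close> generates the Hankel array
  \<open>c (i + j)\<close>.\<close>

definition sandwich :: "(nat \<Rightarrow> real^'n^'n) \<Rightarrow> (nat \<Rightarrow> real^'n^'n) \<Rightarrow> nat \<Rightarrow> nat \<Rightarrow> real^'n^'n" where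
  "sandwich c u m n = (\<Sum>i\<le>m. \<Sum>j\<le>n. transpose (u i) ** c (m - i + (n - j)) ** u j)"

lemma transpose_sandwich:
  assumes "\<And>k. transpose (c k) = c k"
  shows "transpose (sandwich c u m n) = sandwich c u n m"
  unfolding sandwich_def
  by (subst sum.swap) (simp add: transpose_sum matrix_transpose_mul assms matrix_mul_assoc add.commute)

text \<open>A congruence: the double sum is the Hankel form of \<open>c\<close> at the vectors whose
  \<open>i\<close>-th entry sums \<open>u (p - i) *v v p\<close> over the \<open>p\<close> in
  \<open>S\<close> with \<open>i \<le> p\<close>.\<close>

lemma hankel_psd_sandwich:
  fixes c u :: "nat \<Rightarrow> real^'n^'n"
  assumes "hankel_psd c" "finite S"
  shows "0 \<le> (\<Sum>p\<in>S. \<Sum>q\<in>S. v p \<bullet> (sandwich c u p q *v v q))"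
proof -
  obtain m where m: "\<And>i. i \<in> S \<Longrightarrow> i \<le> m" using assms(2) by (meson finite_nat_set_iff_bounded_le)
  define z where "z i p = (if i \<le> p then u (p - i) *v v p else 0)" for i p
  have "v p \<bullet> (sandwich c u p q *v v q) = (\<Sum>i\<le>m. \<Sum>j\<le>m. z i p \<bullet> (c (i + j) *v z j q))"
    if "p \<in> S" "q \<in> S" for p q
  proof -
    have "v p \<bullet> (sandwich c u p q *v v q) = (\<Sum>i\<le>p. \<Sum>j\<le>q. (u i *v v p) \<bullet> (c (p - i + (q - j)) *v (u j *v v q)))"
      by (simp add: sandwich_def form_sum matrix_vector_mul_assoc[symmetric] inner_transpose_mult
          del: transpose_matrix_vector)
    also have "\<dots> = (\<Sum>i\<le>p. \<Sum>j\<le>q. (u (p - i) *v v p) \<bullet> (c (i + j) *v (u (q - j) *v v q)))"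
      by (subst sum.nat_diff_reindex[symmetric, of _ "Suc p", unfolded lessThan_Suc_atMost],
          subst sum.nat_diff_reindex[symmetric, of _ "Suc q", unfolded lessThan_Suc_atMost])
        (intro sum.cong refl, simp)
    also have "\<dots> = (\<Sum>i\<le>p. \<Sum>j\<le>q. z i p \<bullet> (c (i + j) *v z j q))"
      by (simp add: z_def)
    also have "\<dots> = (\<Sum>i\<le>p. \<Sum>j\<le>m. z i p \<bullet> (c (i + j) *v z j q))"
      by (intro sum.cong refl sum.mono_neutral_left) (use m[OF that(2)] in \<open>auto simp: z_def\<close>)
    also have "\<dots> = (\<Sum>i\<le>m. \<Sum>j\<le>m. z i p \<bullet> (c (i + j) *v z j q))"
      by (rule sum.mono_neutral_left) (use m[OF that(1)] in \<open>auto simp: z_def\<close>)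
    finally show ?thesis .
  qed
  then have "(\<Sum>p\<in>S. \<Sum>q\<in>S. v p \<bullet> (sandwich c u p q *v v q))
      = (\<Sum>p\<in>S. \<Sum>q\<in>S. \<Sum>i\<le>m. \<Sum>j\<le>m. z i p \<bullet> (c (i + j) *v z j q))"
    by simp
  also have "\<dots> = (\<Sum>p\<in>S. \<Sum>i\<le>m. \<Sum>q\<in>S. \<Sum>j\<le>m. z i p \<bullet> (c (i + j) *v z j q))"
    by (intro sum.cong refl sum.swap)
  also have "\<dots> = (\<Sum>p\<in>S. \<Sum>i\<le>m. \<Sum>j\<le>m. \<Sum>q\<in>S. z i p \<bullet> (c (i + j) *v z j q))"
    by (intro sum.cong refl sum.swap)
  also have "\<dots> = (\<Sum>i\<le>m. \<Sum>p\<in>S. \<Sum>j\<le>m. \<Sum>q\<in>S. z i p \<bullet> (c (i + j) *v z j q))"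
    by (rule sum.swap)
  also have "\<dots> = (\<Sum>i\<le>m. \<Sum>j\<le>m. \<Sum>p\<in>S. \<Sum>q\<in>S. z i p \<bullet> (c (i + j) *v z j q))"
    by (intro sum.cong refl sum.swap)
  also have "\<dots> = (\<Sum>i\<le>m. \<Sum>j\<le>m. (\<Sum>p\<in>S. z i p) \<bullet> (c (i + j) *v (\<Sum>q\<in>S. z j q)))"
    by (simp add: mv.sum_right inner_sum_left inner_sum_right, intro sum.cong refl sum.swap)
  also have "\<dots> \<ge> 0"
    using assms(1) unfolding hankel_psd_def
    by (elim allE[of _ "{..m}"] allE[of _ "\<lambda>i. \<Sum>p\<in>S. z i p"]) simp
  finally show ?thesis .
qed

text \<open>A discrete form of the energy balance of the passive system with impulse response \<open>c\<close>, driven by \<open>u\<close>.\<close>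

lemma sandwich_eq:
  fixes c u :: "nat \<Rightarrow> real^'n^'n"
  assumes sym: "\<And>k. transpose (c k) = c k" "transpose M = M"
    and out: "\<And>n. (\<Sum>j\<le>n. c (n - j) ** u j) = M ** u (Suc n)"
  shows "sandwich c u m n = transpose (u 0) ** M ** u (Suc (m + n))" (is ?main)
    and "sandwich (\<lambda>k. c (Suc k)) u m n
      = transpose (u 0) ** M ** u (Suc (Suc (m + n))) - transpose (u (Suc m)) ** M ** u (Suc n)"
proof -
  have out': "(\<Sum>i\<le>m. transpose (u i) ** c (m - i)) = transpose (u (Suc m)) ** M" for m
    using arg_cong[OF out[of m], of transpose]
    by (simp add: transpose_sum matrix_transpose_mul sym)
  \<comment> \<open>Cutting off the last column here and the last row in \<open>left\<close> leaves
    the same shifted sum and the same boundary term, which the hypothesis \<open>out\<close>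
    evaluates. Hence \<open>sandwich c u m n\<close> depends on \<open>m + n\<close> only and can be
    computed at \<open>m = 0\<close>.\<close>
  have right: "sandwich c u m (Suc n) = sandwich (\<lambda>k. c (Suc k)) u m n + transpose (u (Suc m)) ** M ** u (Suc n)" for m n
  proof -
    have "sandwich c u m (Suc n) = (\<Sum>i\<le>m. \<Sum>j\<le>n. transpose (u i) ** c (m - i + (Suc n - j)) ** u j)
        + (\<Sum>i\<le>m. transpose (u i) ** c (m - i)) ** u (Suc n)"
      by (simp add: sandwich_def sum.distrib mm.sum_left)
    also have "(\<Sum>i\<le>m. \<Sum>j\<le>n. transpose (u i) ** c (m - i + (Suc n - j)) ** u j) = sandwich (\<lambda>k. c (Suc k)) u m n"
      unfolding sandwich_def by (intro sum.cong refl) (simp add: Suc_diff_le)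
    finally show ?thesis by (simp add: out')
  qed
  have left: "sandwich c u (Suc m) n = sandwich (\<lambda>k. c (Suc k)) u m n + transpose (u (Suc m)) ** M ** u (Suc n)" for m n
  proof -
    have "sandwich c u (Suc m) n = (\<Sum>i\<le>m. \<Sum>j\<le>n. transpose (u i) ** c (Suc m - i + (n - j)) ** u j)
        + transpose (u (Suc m)) ** (\<Sum>j\<le>n. c (n - j) ** u j)"
      by (simp add: sandwich_def mm.sum_right matrix_mul_assoc)
    also have "(\<Sum>i\<le>m. \<Sum>j\<le>n. transpose (u i) ** c (Suc m - i + (n - j)) ** u j) = sandwich (\<lambda>k. c (Suc k)) u m n"
      unfolding sandwich_def by (intro sum.cong refl) (simp add: Suc_diff_le)
    finally show ?thesis by (simp add: out matrix_mul_assoc)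
  qed
  have main: "sandwich c u m n = transpose (u 0) ** M ** u (Suc (m + n))" for m n
  proof (induction m arbitrary: n)
    case 0
    have "sandwich c u 0 n = transpose (u 0) ** (\<Sum>j\<le>n. c (n - j) ** u j)"
      by (simp add: sandwich_def mm.sum_right matrix_mul_assoc)
    then show ?case by (simp add: out matrix_mul_assoc)
  next
    case (Suc m)
    have "sandwich c u (Suc m) n = sandwich c u m (Suc n)" by (simp add: left right)
    then show ?case by (simp add: Suc.IH)
  qed
  then show ?main .
  show "sandwich (\<lambda>k. c (Suc k)) u m n
      = transpose (u 0) ** M ** u (Suc (Suc (m + n))) - transpose (u (Suc m)) ** M ** u (Suc n)"
    using right[of m n] main[of m "Suc n"] by simp
qed

function recip_seq :: "(nat \<Rightarrow> real^'n^'n) \<Rightarrow> nat \<Rightarrow> real^'n^'n" where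
  "recip_seq a n = matrix_inv (a 0) ** (mat 1 - (\<Sum>j<n. a (n - j) ** recip_seq a j))"
  by auto
termination
  by (relation "Wellfounded.measure snd") auto

declare recip_seq.simps [simp del]

lemma recip_seq_conv:
  fixes a :: "nat \<Rightarrow> real^'n^'n"
  assumes "invertible (a 0)"
  shows "(\<Sum>j\<le>n. a (n - j) ** recip_seq a j) = mat 1"
  by (subst lessThan_Suc_atMost[symmetric])
    (simp add: recip_seq.simps[of a n] matrix_mul_assoc matrix_inv_right[OF assms])

text \<open>Three uses of \<open>sandwich_eq\<close>. With the differences \<open>b\<close> of
  \<open>a\<close> as kernel and \<open>g\<close> as input it expresses
  \<open>g (m + n + 1)\<close>; the shifted \<open>b\<close> gives \<open>g (m + n + 2)\<close> up
  to a positive term in \<open>a 0\<close>; with the shifted \<open>a\<close>,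
  \<open>M = - a 0\<close> and the differences of \<open>g\<close> as input it expresses
  \<open>g (m + n) - g (m + n + 1)\<close>. The front factor cancels since \<open>g 0\<close>
  inverts \<open>a 0\<close>.\<close>

lemma recip_seq_cm:
  fixes a :: "nat \<Rightarrow> real^'n^'n"
  assumes a: "cmseq a" and inv: "invertible (a 0)"
  defines "g \<equiv> recip_seq a"
  shows "cmseq (\<lambda>k. g (Suc k))" and "psd (g 0 - g (Suc 0))" and "\<And>k. psd (g k)"
proof -
  have conv: "(\<Sum>j\<le>n. a (n - j) ** g j) = mat 1" for n
    unfolding g_def by (rule recip_seq_conv[of a, OF inv])
  have asym: "transpose (a k) = a k" for k using cmseq_psd[OF a] psd_symmetric by blast
  have ag0: "a 0 ** g 0 = mat 1" using conv[of 0] by simp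
  have ga0: "transpose (g 0) ** a 0 = mat 1"
    using arg_cong[OF ag0, of transpose] by (simp add: matrix_transpose_mul asym transpose_mat)
  have g0: "transpose (g 0) = g 0"
  proof -
    have "transpose (g 0) = transpose (g 0) ** (a 0 ** g 0)" by (simp add: ag0)
    then show ?thesis by (simp add: matrix_mul_assoc ga0)
  qed
  define b where "b k = a k - a (Suc k)" for k
  have bsym: "transpose (b k) = b k" for k by (simp add: b_def transpose_diff asym)
  have b: "cmseq b" unfolding b_def[abs_def] by (rule cmseq_diff[OF a])
  have shift: "(\<Sum>j\<le>n. a (Suc (n - j)) ** g j) = mat 1 - a 0 ** g (Suc n)" for n
  proof -
    have "(\<Sum>j\<le>n. a (Suc (n - j)) ** g j) = (\<Sum>j\<le>n. a (Suc n - j) ** g j)"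
      by (intro sum.cong refl) (simp add: Suc_diff_le)
    then show ?thesis using conv[of "Suc n"] by (simp add: eq_diff_eq)
  qed
  \<comment> \<open>The discrete equation has a constant right-hand side, so subtracting two
    consecutive ones leaves only the newest term.\<close>
  have outb: "(\<Sum>j\<le>n. b (n - j) ** g j) = a 0 ** g (Suc n)" for n
    by (simp add: b_def mm.diff_left sum_subtractf conv shift)
  note sb = sandwich_eq[of b "a 0" g, OF bsym asym outb]
  have s1: "sandwich b g m n = g (Suc (m + n))" for m n
    by (simp add: sb(1) ga0)
  have s2: "sandwich (\<lambda>k. b (Suc k)) g m n = g (Suc (Suc (m + n))) - transpose (g (Suc m)) ** a 0 ** g (Suc n)" for m n
    by (simp add: sb(2) ga0)
  \<comment> \<open>The recursion does not make \<open>g k\<close> visibly symmetric. But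
    transposing a sandwich swaps \<open>m\<close> and \<open>n\<close>, and its value depends on
    \<open>m + n\<close> only.\<close>
  have gsym: "transpose (g k) = g k" for k
  proof (cases k)
    case (Suc n)
    then show ?thesis using transpose_sandwich[of b g 0 n, OF bsym] by (simp add: s1)
  qed (simp add: g0)
  have h1: "hankel_psd (\<lambda>k. g (Suc k))"
    unfolding hankel_psd_def
    using hankel_psd_sandwich[OF cmseq_imp_hankel_psd[OF b], where u = g] by (simp add: s1)
  have h2: "hankel_psd (\<lambda>k. g (Suc (Suc k)))"
    unfolding hankel_psd_def
  proof (intro allI impI)
    fix S :: "nat set" and v :: "nat \<Rightarrow> real^'n" assume S: "finite S"
    have eq: "g (Suc (Suc (m + n))) = sandwich (\<lambda>k. b (Suc k)) g m n + transpose (g (Suc m)) ** a 0 ** g (Suc n)" for m n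
      by (simp add: s2)
    let ?w = "\<Sum>i\<in>S. g (Suc i) *v v i"
    have "(\<Sum>i\<in>S. \<Sum>j\<in>S. v i \<bullet> (g (Suc (Suc (i + j))) *v v j))
      = (\<Sum>i\<in>S. \<Sum>j\<in>S. v i \<bullet> (sandwich (\<lambda>k. b (Suc k)) g i j *v v j)) + ?w \<bullet> (a 0 *v ?w)"
      unfolding eq form_add
      by (simp add: sum.distrib mv.sum_right inner_sum_left inner_sum_right inner_transpose_mult
          matrix_vector_mul_assoc[symmetric] del: transpose_matrix_vector, rule sum.swap)
    then show "0 \<le> (\<Sum>i\<in>S. \<Sum>j\<in>S. v i \<bullet> (g (Suc (Suc (i + j))) *v v j))"
      using hankel_psd_sandwich[OF cmseq_imp_hankel_psd[OF cmseq_Suc[OF b]] S, where v = v and u = g]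
        psd_nonneg[OF cmseq_psd[OF a], of ?w 0] by simp
  qed
  \<comment> \<open>Differences of \<open>g\<close> extended by 0 to negative indices; convolving
    them with \<open>a\<close> gives the identity at index 0 and 0 afterwards.\<close>
  define u where "u n = (case n of 0 \<Rightarrow> g 0 | Suc k \<Rightarrow> g (Suc k) - g k)" for n
  have u0: "u 0 = g 0" and uS: "u (Suc k) = g (Suc k) - g k" for k by (simp_all add: u_def)
  have outu: "(\<Sum>j\<le>n. a (Suc (n - j)) ** u j) = (- a 0) ** u (Suc n)" for n
  proof -
    have "(\<Sum>j\<le>Suc n. a (Suc n - j) ** u j) = (\<Sum>j\<le>Suc n. a (Suc n - j) ** g j) - (\<Sum>j\<le>n. a (n - j) ** g j)"
      unfolding sum.atMost_Suc_shift by (simp add: u0 uS mm.diff_right sum_subtractf)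
    then have "(\<Sum>j\<le>Suc n. a (Suc n - j) ** u j) = 0" by (simp only: conv) simp
    moreover have "(\<Sum>j\<le>n. a (Suc (n - j)) ** u j) = (\<Sum>j\<le>n. a (Suc n - j) ** u j)"
      by (intro sum.cong refl) (simp add: Suc_diff_le)
    ultimately have "(\<Sum>j\<le>n. a (Suc (n - j)) ** u j) + a 0 ** u (Suc n) = 0"
      by simp
    then show ?thesis by (simp add: mm.minus_left eq_neg_iff_add_eq_0)
  qed
  have "transpose (- a 0) = - a 0" using asym[of 0] by (simp add: transpose_def vec_eq_iff)
  then have "sandwich (\<lambda>k. a (Suc k)) u m n = g (m + n) - g (Suc (m + n))" for m n
    using sandwich_eq(1)[of "\<lambda>k. a (Suc k)" "- a 0" u, OF asym _ outu, of m n]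
    by (simp add: u0 uS mm.minus_left mm.minus_right ga0)
  then have hd: "hankel_psd (\<lambda>k. g k - g (Suc k))"
    unfolding hankel_psd_def
    using hankel_psd_sandwich[OF cmseq_imp_hankel_psd[OF cmseq_Suc[OF a]], where u = u] by simp
  show cm: "cmseq (\<lambda>k. g (Suc k))"
    by (rule cmseq_of_hankel_psd[OF gsym h1 h2 hd])
  show d0: "psd (g 0 - g (Suc 0))"
    using hankel_psd_imp_bdiff_psd[OF hd, of 0 0] gsym by (simp add: transpose_diff)
  show "psd (g k)" for k
    using psd_add[OF d0 cmseq_psd[OF cm, of 0]] cmseq_psd[OF cm] by (cases k) auto
qed

section \<open>Completely monotone functions and their discretizations\<close>

text \<open>\<open>W n\<close> stands for \<open>(-1)^n\<close> times the n-th derivative of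
  \<open>W 0\<close>. Carrying the whole family replaces iterated derivative operators by a relation
  between neighbours, which is easier to keep under differences and limits.\<close>

definition cm_family :: "(nat \<Rightarrow> real \<Rightarrow> real^'n^'n) \<Rightarrow> bool" where
  "cm_family W \<longleftrightarrow> (\<forall>n. \<forall>t>0. (W n has_vector_derivative - W (Suc n) t) (at t) \<and> psd (W n t))"

lemma has_vector_derivative_eq_on_pos:
  assumes "(f has_vector_derivative d) (at t)" "0 < t" "\<And>s. 0 < s \<Longrightarrow> f s = g s"
  shows "(g has_vector_derivative d) (at t)"
  by (rule has_vector_derivative_transform_within_open[OF assms(1), of "{0<..}"]) (use assms in auto)

lemma form_has_real_derivative:
  fixes F :: "real \<Rightarrow> real^'n^'m"
  assumes "(F has_vector_derivative D) (at t)"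
  shows "((\<lambda>s. u \<bullet> (F s *v v)) has_real_derivative u \<bullet> (D *v v)) (at t)"
  using bounded_linear.has_vector_derivative[OF bounded_linear_form assms, of u v]
  by (simp add: has_real_derivative_iff_has_vector_derivative)

lemma funpow_deriv_form:
  fixes F :: "real \<Rightarrow> real^'n^'m"
  assumes "V 0 = F" and VS: "\<And>n t. 0 < t \<Longrightarrow> (V n has_vector_derivative V (Suc n) t) (at t)"
    and "0 < t"
  shows "(deriv ^^ n) (\<lambda>s. u \<bullet> (F s *v v)) t = u \<bullet> (V n t *v v)"
  using \<open>0 < t\<close>
proof (induction n arbitrary: t)
  case (Suc n)
  have "eventually (\<lambda>s. s \<in> {0<..}) (nhds t)"
    using Suc.prems by (intro eventually_nhds_in_open) auto
  then have "eventually (\<lambda>s. (deriv ^^ n) (\<lambda>s. u \<bullet> (F s *v v)) s = u \<bullet> (V n s *v v)) (nhds t)"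
    by eventually_elim (simp add: Suc.IH)
  then have "deriv ((deriv ^^ n) (\<lambda>s. u \<bullet> (F s *v v))) t = deriv (\<lambda>s. u \<bullet> (V n s *v v)) t"
    by (rule deriv_cong_ev) simp
  also have "\<dots> = u \<bullet> (V (Suc n) t *v v)"
    by (rule DERIV_imp_deriv[OF form_has_real_derivative[OF VS[OF Suc.prems]]])
  finally show ?case by simp
qed (simp add: assms(1))

lemma completely_monotone_imp_cm_family:
  fixes F :: "real \<Rightarrow> real^'n^'n"
  assumes F: "completely_monotone F"
  obtains W where "cm_family W" "W 0 = F"
proof -
  define V where "V k = ((\<lambda>f s. vector_derivative f (at s)) ^^ k) F" for k
  have V0: "V 0 = F" by (simp add: V_def)
  have VS: "(V k has_vector_derivative V (Suc k) t) (at t)" if "0 < t" for k t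
    using F that vector_derivative_works[of "V k" "at t"]
    unfolding completely_monotone_def infinitely_differentiable_def by (simp add: V_def)
  \<comment> \<open>The definition only signs quadratic forms; symmetry of the derivatives follows
    by differentiating the symmetry of the previous order.\<close>
  have sym: "transpose (V k t) = V k t" if "0 < t" for k t
    using that
  proof (induction k arbitrary: t)
    case 0
    then show ?case using F by (simp add: V0 completely_monotone_def)
  next
    case (Suc k)
    have "((\<lambda>s. transpose (V k s)) has_vector_derivative transpose (V (Suc k) t)) (at t)"
      by (rule bounded_linear.has_vector_derivative[OF bounded_linear_transpose VS[OF Suc.prems]])
    then have "(V k has_vector_derivative transpose (V (Suc k) t)) (at t)"
      by (rule has_vector_derivative_eq_on_pos[OF _ Suc.prems]) (rule Suc.IH)
    then show ?case using vector_derivative_unique_at VS[OF Suc.prems] by blast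
  qed
  have d: "(deriv ^^ n) (\<lambda>s. v \<bullet> (F s *v v)) t = v \<bullet> (V n t *v v)" if "0 < t" for n v t
    by (rule funpow_deriv_form[of V F, OF V0 _ that]) (rule VS)
  define W where "W n t = (-1) ^ n *\<^sub>R V n t" for n t
  have "cm_family W"
    unfolding cm_family_def
  proof (intro allI impI conjI)
    fix n and t :: real assume t: "0 < t"
    show "(W n has_vector_derivative - W (Suc n) t) (at t)"
      unfolding W_def[abs_def] using VS[OF t, of n] by (auto intro!: derivative_eq_intros)
    show "psd (W n t)"
      using F t sym[OF t, of n]
      unfolding psd_def W_def completely_monotone_def
      by (simp add: transpose_scaleR form_scaleR d[OF t, symmetric])
  qed
  then show ?thesis using that by (simp add: W_def V0 fun_eq_iff)
qed

lemma cm_family_imp_completely_monotone: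
  assumes W: "cm_family W" and F: "\<And>t. 0 < t \<Longrightarrow> F t = W 0 t"
  shows "completely_monotone F"
proof -
  have WD: "(W n has_vector_derivative - W (Suc n) t) (at t)" if "0 < t" for n t
    using W that by (simp add: cm_family_def)
  define V where "V k = ((\<lambda>f s. vector_derivative f (at s)) ^^ k) F" for k
  have V: "V n t = (-1) ^ n *\<^sub>R W n t \<and> (V n has_vector_derivative (-1) ^ Suc n *\<^sub>R W (Suc n) t) (at t)"
    if "0 < t" for n t
    using that
  proof (induction n arbitrary: t)
    case 0
    then show ?case
      using has_vector_derivative_eq_on_pos[OF WD[OF 0, of 0] 0, of F] F by (simp add: V_def)
  next
    case (Suc n)
    have eq: "V (Suc n) t = (-1) ^ Suc n *\<^sub>R W (Suc n) t" if "0 < t" for t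
      using vector_derivative_at[OF conjunct2[OF Suc.IH[OF that]]] by (simp add: V_def)
    have "((\<lambda>t. (-1) ^ Suc n *\<^sub>R W (Suc n) t) has_vector_derivative (-1) ^ Suc (Suc n) *\<^sub>R W (Suc (Suc n)) t) (at t)"
      using WD[OF Suc.prems, of "Suc n"] by (auto intro!: derivative_eq_intros)
    then have "(V (Suc n) has_vector_derivative (-1) ^ Suc (Suc n) *\<^sub>R W (Suc (Suc n)) t) (at t)"
      by (rule has_vector_derivative_eq_on_pos[OF _ Suc.prems]) (simp only: eq)
    then show ?case using eq[OF Suc.prems] by simp
  qed
  have d: "(deriv ^^ n) (\<lambda>s. v \<bullet> (F s *v v)) t = v \<bullet> (V n t *v v)" if "0 < t" for n v t
  proof (rule funpow_deriv_form[OF _ _ that])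
    show "(V n has_vector_derivative V (Suc n) t) (at t)" if "0 < t" for n t
      using V[OF that, of n] V[OF that, of "Suc n"] by simp
  qed (simp add: V_def)
  have psdW: "psd (W n t)" if "0 < t" for n t
    using W that by (simp add: cm_family_def)
  show ?thesis
    unfolding completely_monotone_def infinitely_differentiable_def
  proof (intro conjI allI impI)
    fix t :: real assume t: "0 < t"
    show "transpose (F t) = F t" using F[OF t] psd_symmetric[OF psdW[OF t]] by simp
    show "((\<lambda>f s. vector_derivative f (at s)) ^^ k) F differentiable at t" for k
      using differentiableI_vector[OF conjunct2[OF V[OF t, of k]]] by (simp add: V_def)
    have [simp]: "(-1 :: real) ^ n * ((-1) ^ n * x) = x" for n x
      by (simp add: mult.assoc[symmetric] power_mult_distrib[symmetric])
    show "0 \<le> (-1) ^ n * (deriv ^^ n) (\<lambda>s. v \<bullet> (F s *v v)) t" for n v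
      using V[OF t, of n] psd_nonneg[OF psdW[OF t, of n], of v] by (simp add: d[OF t] form_scaleR)
  qed
qed

lemma cm_family_decreasing:
  assumes W: "cm_family W" and "0 < s" "s \<le> t"
  shows "v \<bullet> (W n t *v v) \<le> v \<bullet> (W n s *v v)"
proof (rule DERIV_nonpos_imp_nonincreasing[OF \<open>s \<le> t\<close>])
  fix x assume "s \<le> x" "x \<le> t"
  then have x: "0 < x" using assms by simp
  show "\<exists>y. ((\<lambda>t. v \<bullet> (W n t *v v)) has_real_derivative y) (at x) \<and> y \<le> 0"
    using W x form_has_real_derivative[of "W n" "- W (Suc n) x" x v v] psd_nonneg[of "W (Suc n) x" v]
    unfolding cm_family_def by (auto simp: form_minus intro!: exI[of _ "v \<bullet> (- W (Suc n) x *v v)"])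
qed

text \<open>Induction on the order of the difference, with the family replaced by
  \<open>W m s - W m (s + h)\<close>. This is again a \<open>cm_family\<close>, because the form of
  each \<open>W m\<close> decreases, and it absorbs one difference.\<close>

lemma cm_family_imp_cmseq:
  assumes W: "cm_family W" and t: "0 < t" and h: "0 \<le> h"
  shows "cmseq (\<lambda>k. W 0 (t + real k * h))"
proof -
  have "psd (bdiff n (\<lambda>k. W 0 (t + real k * h)) 0)" if "0 < t" "cm_family W" for n t and W :: "nat \<Rightarrow> real \<Rightarrow> real^'a^'a"
    using that
  proof (induction n arbitrary: W t)
    case 0
    then show ?case by (simp add: cm_family_def)
  next
    case (Suc n)
    define W' where "W' m s = W m s - W m (s + h)" for m s
    have W': "cm_family W'"
      unfolding cm_family_def
    proof (intro allI impI conjI)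
      fix m and s :: real assume s: "0 < s"
      have 1: "(W m has_vector_derivative - W (Suc m) s) (at s)"
        and 2: "(W m has_vector_derivative - W (Suc m) (s + h)) (at (s + h))"
        using Suc.prems(2) s h by (auto simp: cm_family_def)
      have "((\<lambda>s. s + h) has_vector_derivative 1) (at s)"
        by (auto intro!: derivative_eq_intros)
      then have "((\<lambda>s. W m (s + h)) has_vector_derivative - W (Suc m) (s + h)) (at s)"
        using vector_diff_chain_at[of "\<lambda>s. s + h" 1 s "W m" "- W (Suc m) (s + h)"] 2
        by (simp add: o_def)
      then show "(W' m has_vector_derivative - W' (Suc m) s) (at s)"
        unfolding W'_def[abs_def] by (auto intro!: derivative_eq_intros 1)
      show "psd (W' m s)"
        using cm_family_decreasing[OF Suc.prems(2) s, of "s + h" _ m] Suc.prems(2) s h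
        by (auto simp: psd_def cm_family_def W'_def form_diff transpose_diff)
    qed
    have "bdiff 1 (\<lambda>k. W 0 (t + real k * h)) = (\<lambda>k. W' 0 (t + real k * h))"
      by (auto simp: W'_def algebra_simps)
    then have "bdiff (Suc n) (\<lambda>k. W 0 (t + real k * h)) 0 = bdiff n (\<lambda>k. W' 0 (t + real k * h)) 0"
      using bdiff_bdiff[of n 1 "\<lambda>k. W 0 (t + real k * h)" 0] by simp
    then show ?case using Suc.IH[OF Suc.prems(1) W'] by simp
  qed
  moreover have "0 < t + real k * h" for k
    using t h by (intro add_pos_nonneg) auto
  ultimately have "psd (bdiff n (\<lambda>i. W 0 (t + real k * h + real i * h)) 0)" for n k
    using W by blast
  then show ?thesis
    unfolding cmseq_def
    using bdiff_shift[of _ "\<lambda>k. W 0 (t + real k * h)" k 0 for k]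
    by (simp add: algebra_simps)
qed

lemma completely_monotone_cmseq:
  assumes "completely_monotone F" "0 < t" "0 \<le> h"
  shows "cmseq (\<lambda>k. F (t + real k * h))"
proof -
  obtain W where "cm_family W" "W 0 = F" using completely_monotone_imp_cm_family[OF assms(1)] .
  then show ?thesis using cm_family_imp_cmseq[of W t h] assms by simp
qed

lemma completely_monotone_psd:
  assumes "completely_monotone F" "0 < t"
  shows "psd (F t)"
  using completely_monotone_cmseq[OF assms, of 0] cmseq_psd by fastforce

lemma completely_monotone_decreasing:
  assumes "completely_monotone F" "0 < s" "s \<le> t"
  shows "v \<bullet> (F t *v v) \<le> v \<bullet> (F s *v v)"
proof -
  obtain W where "cm_family W" "W 0 = F" using completely_monotone_imp_cm_family[OF assms(1)] .
  then show ?thesis using cm_family_decreasing[of W s t v 0] assms by simp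
qed

lemma completely_monotone_continuous:
  assumes "completely_monotone F"
  shows "continuous_on {0<..} F"
proof -
  obtain W where W: "cm_family W" "W 0 = F" using completely_monotone_imp_cm_family[OF assms] .
  then have "isCont F t" if "0 < t" for t
    using that W has_vector_derivative_continuous[of "W 0" "- W (Suc 0) t" t UNIV] unfolding cm_family_def by auto
  then show ?thesis by (simp add: continuous_at_imp_continuous_on)
qed

lemma completely_monotone_trace_decreasing:
  fixes F :: "real \<Rightarrow> real^'n^'n"
  assumes "completely_monotone F" "0 < s" "s \<le> t"
  shows "trace (F t) \<le> trace (F s)"
  unfolding trace_def
  using completely_monotone_decreasing[OF assms, of "axis i 1" for i]
  by (intro sum_mono) (simp add: inner_axis_mult_axis)

lemma completely_monotone_norm_le:
  fixes F :: "real \<Rightarrow> real^'n^'n"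
  assumes "completely_monotone F" "0 < s" "s \<le> t"
  shows "norm (F t) \<le> real CARD('n) ^ 2 * trace (F s)"
  using psd_norm_le_trace[OF completely_monotone_psd[OF assms(1), of t]]
    completely_monotone_trace_decreasing[OF assms] assms(2,3)
  by (meson dual_order.trans less_le_trans mult_left_mono zero_le_power2)

text \<open>Singularity without inverses: for symmetric values this says that the smallest
  eigenvalue of \<open>F t\<close> tends to infinity at 0.\<close>

definition blows_up :: "(real \<Rightarrow> real^'n^'n) \<Rightarrow> bool" where
  "blows_up F \<longleftrightarrow> (\<forall>c>0. \<exists>d>0. \<forall>t. 0 < t \<and> t \<le> d \<longrightarrow> (\<forall>v. c * (v \<bullet> v) \<le> v \<bullet> (F t *v v)))"

lemma singular_imp_blows_up:
  fixes F :: "real \<Rightarrow> real^'n^'n"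
  assumes F: "completely_monotone F"
    and inv: "\<forall>\<^sub>F t in at_right 0. invertible (F t)"
    and lim: "((\<lambda>t. matrix_inv (F t)) \<longlongrightarrow> 0) (at_right 0)"
  shows "blows_up F"
  unfolding blows_up_def
proof (intro allI impI)
  fix c :: real assume c: "0 < c"
  obtain K where K: "K > 0" "\<And>(A::real^'n^'n) (v::real^'n). norm (A *v v) \<le> norm A * norm v * K"
    using mv.pos_bounded by auto
  have "\<forall>\<^sub>F t in at_right 0. norm (matrix_inv (F t)) < 1 / (c * K)"
    using lim c K(1) by (intro order_tendstoD[OF tendsto_norm_zero]) auto
  then have "\<forall>\<^sub>F t in at_right 0. invertible (F t) \<and> norm (matrix_inv (F t)) < 1 / (c * K)"
    using inv by eventually_elim simp
  then obtain b where b: "b > 0" "\<And>t. 0 < t \<Longrightarrow> t < b \<Longrightarrow> invertible (F t) \<and> norm (matrix_inv (F t)) < 1 / (c * K)"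
    unfolding eventually_at_right_field by auto
  have "c * (v \<bullet> v) \<le> v \<bullet> (F t *v v)" if t: "0 < t" "t \<le> b / 2" for t v
  proof (rule norm_inv_le_imp_coercive[OF completely_monotone_psd[OF F t(1)] _ c])
    have *: "invertible (F t) \<and> norm (matrix_inv (F t)) < 1 / (c * K)" using b t by auto
    then show "invertible (F t)" by simp
    show "norm (matrix_inv (F t) *v v) \<le> 1 / c * norm v" for v
    proof -
      have "norm (matrix_inv (F t) *v v) \<le> norm (matrix_inv (F t)) * norm v * K" by (rule K)
      also have "\<dots> \<le> 1 / (c * K) * norm v * K"
        using * K(1) by (intro mult_right_mono) auto
      also have "\<dots> = 1 / c * norm v" using K(1) c by simp
      finally show ?thesis .
    qed
  qed
  then show "\<exists>d>0. \<forall>t. 0 < t \<and> t \<le> d \<longrightarrow> (\<forall>v. c * (v \<bullet> v) \<le> v \<bullet> (F t *v v))"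
    using b(1) by (intro exI[of _ "b / 2"]) auto
qed

lemma blows_up_imp_singular:
  fixes F :: "real \<Rightarrow> real^'n^'n"
  assumes "blows_up F"
  shows "\<forall>\<^sub>F t in at_right 0. invertible (F t)" and "((\<lambda>t. matrix_inv (F t)) \<longlongrightarrow> 0) (at_right 0)"
proof -
  have ev: "\<forall>\<^sub>F t in at_right 0. \<forall>v. c * (v \<bullet> v) \<le> v \<bullet> (F t *v v)" if c: "0 < c" for c
  proof -
    obtain d where "d > 0" "\<forall>t. 0 < t \<and> t \<le> d \<longrightarrow> (\<forall>v. c * (v \<bullet> v) \<le> v \<bullet> (F t *v v))"
      using assms c unfolding blows_up_def by blast
    then show ?thesis unfolding eventually_at_right_field by (meson less_imp_le)
  qed
  show "\<forall>\<^sub>F t in at_right 0. invertible (F t)"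
    using ev[OF zero_less_one] by eventually_elim (rule coercive_imp_invertible[OF zero_less_one], rule spec)
  show "((\<lambda>t. matrix_inv (F t)) \<longlongrightarrow> 0) (at_right 0)"
    unfolding tendsto_iff dist_norm
  proof (intro allI impI)
    fix e :: real assume e: "0 < e"
    define c where "c = 2 * real CARD('n) ^ 2 / e"
    have c: "0 < c" using e by (simp add: c_def)
    show "\<forall>\<^sub>F t in at_right 0. norm (matrix_inv (F t) - 0) < e"
      using ev[OF c]
    proof eventually_elim
      case (elim t)
      have "norm (matrix_inv (F t)) \<le> real CARD('n) ^ 2 * (1 / c)"
        by (rule coercive_imp_norm_inv_le[OF c spec[OF elim]])
      also have "\<dots> = e / 2" by (simp add: c_def)
      also have "\<dots> < e" using e by simp
      finally show ?case by simp
    qed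
  qed
qed

lemma blows_upE:
  assumes "blows_up F" "0 < c"
  obtains d where "0 < d" "\<And>t v. 0 < t \<Longrightarrow> t \<le> d \<Longrightarrow> c * (v \<bullet> v) \<le> v \<bullet> (F t *v v)"
proof -
  obtain d where "0 < d" "\<forall>t. 0 < t \<and> t \<le> d \<longrightarrow> (\<forall>v. c * (v \<bullet> v) \<le> v \<bullet> (F t *v v))"
    using assms unfolding blows_up_def by blast
  then show thesis by (intro that[of d]) auto
qed

section \<open>Cell integrals of locally integrable completely monotone functions\<close>

lemma psd_set_integral:
  fixes f :: "'a \<Rightarrow> real^'n^'n"
  assumes f: "set_integrable M A f" and psd: "\<And>x. x \<in> A \<Longrightarrow> psd (f x)"
  shows "psd (LINT x:A|M. f x)"
proof -
  have psd': "psd (indicat_real A x *\<^sub>R f x)" for x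
    using psd[of x] by (cases "x \<in> A") (auto simp: psd_0)
  have i: "integrable M (\<lambda>x. indicat_real A x *\<^sub>R f x)" using f by (simp add: set_integrable_def)
  have "transpose (LINT x:A|M. f x) = (\<integral>x. transpose (indicat_real A x *\<^sub>R f x) \<partial>M)"
    unfolding set_lebesgue_integral_def
    by (rule integral_bounded_linear[OF bounded_linear_transpose i, symmetric])
  moreover have "v \<bullet> ((LINT x:A|M. f x) *v v) = (\<integral>x. v \<bullet> ((indicat_real A x *\<^sub>R f x) *v v) \<partial>M)" for v
    unfolding set_lebesgue_integral_def
    by (rule integral_bounded_linear[OF bounded_linear_form i, symmetric])
  ultimately show ?thesis
    unfolding psd_def using psd_symmetric[OF psd'] psd_nonneg[OF psd']
    by (simp add: set_lebesgue_integral_def)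
qed

lemma set_integrable_insert_0:
  fixes f :: "real \<Rightarrow> 'a::euclidean_space"
  assumes "0 \<le> b"
  shows "set_integrable lborel {0..b} f \<longleftrightarrow> set_integrable lborel {0<..b} f"
proof
  assume "set_integrable lborel {0..b} f"
  then show "set_integrable lborel {0<..b} f" by (rule set_integrable_subset) auto
next
  assume *: "set_integrable lborel {0<..b} f"
  have "(\<lambda>x. indicat_real {0} x *\<^sub>R f x) = (\<lambda>x. indicat_real {0} x *\<^sub>R f 0)"
    by (auto simp: indicator_def)
  then have "set_integrable lborel {0} f" by (simp add: set_integrable_def)
  moreover have "{0..b} = {0} \<union> {0<..b}" using assms by auto
  ultimately show "set_integrable lborel {0..b} f"
    using set_integrable_Un[of lborel "{0}" f "{0<..b}"] * by simp
qed

lemma LICM_set_integrable: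
  assumes "LICM F"
  shows "set_integrable lborel {0<..b} F"
proof -
  have "continuous_on {1..max 1 b} F"
    by (rule continuous_on_subset[OF completely_monotone_continuous]) (use assms in \<open>auto simp: LICM_def\<close>)
  then have "set_integrable lborel {1..max 1 b} F" by (rule borel_integrable_atLeastAtMost')
  then have "set_integrable lborel ({0<..1} \<union> {1..max 1 b}) F"
    using assms unfolding LICM_def by (intro set_integrable_Un) auto
  then show ?thesis by (rule set_integrable_subset) auto
qed

lemma LICM_locally_integrable:
  assumes "LICM F"
  shows "locally_integrable F"
  unfolding locally_integrable_def
proof
  fix a :: real
  show "set_integrable lborel {0..a} F"
  proof (cases "0 \<le> a")
    case True
    then show ?thesis using set_integrable_insert_0 LICM_set_integrable[OF assms] by blast
  qed (simp add: set_integrable_def)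
qed

text \<open>The integral of \<open>F\<close> from \<open>k h\<close> to \<open>(k + 1) h\<close>,
  moved to the fixed interval \<open>{0<..h}\<close> so that differences in \<open>k\<close> pass
  under the integral. The open left end keeps the irrelevant value \<open>F 0\<close> out.\<close>

definition cell :: "(real \<Rightarrow> real^'n^'n) \<Rightarrow> real \<Rightarrow> nat \<Rightarrow> real^'n^'n" where
  "cell F h k = (LINT s:{0<..h}|lborel. F (s + real k * h))"

lemma set_integrable_shift:
  fixes F :: "real \<Rightarrow> real^'n^'n"
  assumes "set_integrable lborel {0<..h + c} F" "0 \<le> c"
  shows "set_integrable lborel {0<..h} (\<lambda>s. F (s + c))"
proof -
  have "set_integrable lborel {c<..h + c} F"
    using assms(1) by (rule set_integrable_subset) (use assms(2) in auto)
  then have "integrable lborel (\<lambda>s. indicat_real {c<..h + c} (c + 1 * s) *\<^sub>R F (c + 1 * s))"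
    unfolding set_integrable_def by (rule lborel_integrable_real_affine) simp
  moreover have "indicat_real {c<..h + c} (c + 1 * s) = indicat_real {0<..h} s" for s
    by (auto simp: indicator_def)
  ultimately show ?thesis by (simp add: set_integrable_def add.commute)
qed

lemma cmseq_cell:
  fixes F :: "real \<Rightarrow> real^'n^'n"
  assumes F: "LICM F" and h: "0 < h"
  shows "cmseq (cell F h)"
proof -
  have si: "set_integrable lborel {0<..h} (\<lambda>s. F (s + real k * h))" for k
    using h by (intro set_integrable_shift LICM_set_integrable[OF F]) auto
  have b: "set_integrable lborel {0<..h} (\<lambda>s. bdiff n (\<lambda>k. F (s + real k * h)) k)
    \<and> bdiff n (cell F h) k = (LINT s:{0<..h}|lborel. bdiff n (\<lambda>k. F (s + real k * h)) k)" for n k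
  proof (induction n arbitrary: k)
    case 0
    then show ?case using si by (simp add: cell_def)
  next
    case (Suc n)
    then show ?case by (simp add: set_integral_diff)
  qed
  show ?thesis
    unfolding cmseq_def
  proof (intro allI)
    fix n k
    have "psd (LINT s:{0<..h}|lborel. bdiff n (\<lambda>k. F (s + real k * h)) k)"
      using b completely_monotone_cmseq[of F _ h] F h
      by (intro psd_set_integral) (auto simp: LICM_def cmseq_def)
    then show "psd (bdiff n (cell F h) k)" using b by simp
  qed
qed

lemma mat_eq_scaleR: "mat x = x *\<^sub>R (mat 1 :: real^'n^'n)"
  by (simp add: mat_def vec_eq_iff)

lemma cell_lower_bound:
  fixes F :: "real \<Rightarrow> real^'n^'n"
  assumes F: "LICM F" and h: "0 < h" and T: "real (Suc k) * h \<le> T"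
    and c: "\<And>v. c * (v \<bullet> v) \<le> v \<bullet> (F T *v v)"
  shows "psd (cell F h k - mat (h * c))"
proof -
  have cm: "completely_monotone F" using F by (simp add: LICM_def)
  have si: "set_integrable lborel {0<..h} (\<lambda>s. F (s + real k * h))"
    using h by (intro set_integrable_shift LICM_set_integrable[OF F]) auto
  have sc: "set_integrable lborel {0<..h} (\<lambda>s. mat c :: real^'n^'n)"
    using h by (simp add: set_integrable_def)
  have "(LINT s:{0<..h}|lborel. mat c) = (mat (h * c) :: real^'n^'n)"
    using h by (simp add: set_lebesgue_integral_def mat_eq_scaleR[of "h * c"] mat_eq_scaleR[of c])
  then have "cell F h k - mat (h * c) = (LINT s:{0<..h}|lborel. F (s + real k * h) - mat c)"
    by (simp add: set_integral_diff(2)[OF si sc] cell_def)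
  also have "psd \<dots>"
  proof (rule psd_set_integral)
    show "set_integrable lborel {0<..h} (\<lambda>s. F (s + real k * h) - mat c)"
      by (rule set_integral_diff(1)[OF si sc])
    fix s assume s: "s \<in> {0<..h}"
    have pos: "0 < s + real k * h" using s h by (auto intro: add_pos_nonneg)
    have "c * (v \<bullet> v) \<le> v \<bullet> (F (s + real k * h) *v v)" for v
      using c[of v] completely_monotone_decreasing[OF cm pos, of T v] s T by (simp add: algebra_simps)
    then show "psd (F (s + real k * h) - mat c)"
      using psd_symmetric[OF completely_monotone_psd[OF cm pos]]
      by (simp add: psd_def transpose_diff form_diff mat_eq_scaleR[of c] scaleR_matrix_vector_assoc[symmetric])
         (simp add: mat_eq_scaleR[of c] transpose_scaleR)
  qed
  finally show ?thesis .
qed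

text \<open>All cells involved lie left of \<open>(k + 1) h\<close>, so each
  \<open>a (k - j)\<close> dominates \<open>h c I\<close>. The products with \<open>g j\<close> need
  not be symmetric, but by \<open>trace_mult_nonneg\<close> their traces are still monotone in the
  first factor; the traces add up to that of the identity.\<close>

lemma recip_cell_trace_bound:
  fixes F :: "real \<Rightarrow> real^'n^'n"
  assumes F: "LICM F" and h: "0 < h" and inv: "invertible (cell F h 0)"
    and c: "\<And>v. c * (v \<bullet> v) \<le> v \<bullet> (F (real (Suc k) * h) *v v)"
  shows "h * c * (\<Sum>j\<le>k. trace (recip_seq (cell F h) j)) \<le> real CARD('n)"
proof -
  let ?a = "cell F h" and ?g = "recip_seq (cell F h)"
  note cm = cmseq_cell[OF F h]
  have "h * c * trace (?g j) \<le> trace (?a (k - j) ** ?g j)" if "j \<le> k" for j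
  proof -
    have "psd (?a (k - j) - mat (h * c))"
    proof (rule cell_lower_bound[OF F h _ c])
      show "real (Suc (k - j)) * h \<le> real (Suc k) * h" using h by (intro mult_right_mono) auto
    qed
    then have "0 \<le> trace ((?a (k - j) - mat (h * c)) ** ?g j)"
      by (rule trace_mult_nonneg[OF _ recip_seq_cm(3)[OF cm inv]])
    moreover have "mat (h * c) ** ?g j = (h * c) *\<^sub>R ?g j"
      by (simp add: mat_eq_scaleR[of "h * c"] mm.scaleR_left)
    ultimately show ?thesis by (simp add: mm.diff_left trace_diff trace_scaleR)
  qed
  then have "(\<Sum>j\<le>k. h * c * trace (?g j)) \<le> (\<Sum>j\<le>k. trace (?a (k - j) ** ?g j))"
    by (intro sum_mono) auto
  also have "\<dots> = trace (\<Sum>j\<le>k. ?a (k - j) ** ?g j)" by (rule trace_sum[symmetric])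
  also have "\<dots> = real CARD('n)" by (simp add: recip_seq_conv[of ?a, OF inv] trace_I)
  finally show ?thesis by (simp add: sum_distrib_left)
qed

section \<open>Limits of completely monotone sequences on refining grids\<close>

lemma psd_shift_bdiff:
  assumes "cmseq (\<lambda>k. A (Suc k))" "1 \<le> k"
  shows "psd (bdiff n A k)"
proof -
  obtain j where k: "k = Suc j" using assms(2) by (cases k) auto
  have "psd (bdiff n (\<lambda>k. A (k + 1)) j)" using assms(1) by (simp add: cmseq_def)
  then show ?thesis using bdiff_shift[of n A 1 j] by (simp add: k)
qed

text \<open>A discrete mean value estimate: the increment over \<open>l\<close> steps telescopes
  into \<open>l\<close> differences of the next order, which decrease with the index.\<close>

lemma bdiff_mono_bounds:
  assumes A: "cmseq (\<lambda>k. A (Suc k))" and k: "1 \<le> k"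
  shows "real l * (v \<bullet> (bdiff (Suc n) A (k + l) *v v)) \<le> v \<bullet> (bdiff n A k *v v) - v \<bullet> (bdiff n A (k + l) *v v)"
    and "v \<bullet> (bdiff n A k *v v) - v \<bullet> (bdiff n A (k + l) *v v) \<le> real l * (v \<bullet> (bdiff (Suc n) A k *v v))"
proof -
  have dec: "v \<bullet> (bdiff m A (Suc j) *v v) \<le> v \<bullet> (bdiff m A j *v v)" if "1 \<le> j" for m j
    using psd_nonneg[OF psd_shift_bdiff[OF A that], of v "Suc m"] by (simp add: form_diff)
  have step: "v \<bullet> (bdiff (Suc n) A j *v v) = v \<bullet> (bdiff n A j *v v) - v \<bullet> (bdiff n A (Suc j) *v v)" for j
    by (simp add: form_diff)
  have decl: "v \<bullet> (bdiff (Suc n) A (k + l) *v v) \<le> v \<bullet> (bdiff (Suc n) A k *v v)" for l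
  proof (induction l)
    case (Suc l)
    have "v \<bullet> (bdiff (Suc n) A (k + Suc l) *v v) \<le> v \<bullet> (bdiff (Suc n) A (k + l) *v v)"
      using dec[of "k + l" "Suc n"] k by (simp del: bdiff.simps)
    then show ?case using Suc by (rule order_trans)
  qed simp
  show "real l * (v \<bullet> (bdiff (Suc n) A (k + l) *v v)) \<le> v \<bullet> (bdiff n A k *v v) - v \<bullet> (bdiff n A (k + l) *v v)"
  proof (induction l)
    case (Suc l)
    let ?x = "v \<bullet> (bdiff (Suc n) A (k + Suc l) *v v)"
    have x: "?x \<le> v \<bullet> (bdiff (Suc n) A (k + l) *v v)"
      using dec[of "k + l" "Suc n"] k by (simp del: bdiff.simps)
    then have "real (Suc l) * ?x \<le> real l * (v \<bullet> (bdiff (Suc n) A (k + l) *v v)) + v \<bullet> (bdiff (Suc n) A (k + l) *v v)"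
      using mult_left_mono[OF x, of "real l"] by (simp add: algebra_simps del: bdiff.simps)
    then show ?case using Suc step[of "k + l"] by (simp del: bdiff.simps)
  qed simp
  show "v \<bullet> (bdiff n A k *v v) - v \<bullet> (bdiff n A (k + l) *v v) \<le> real l * (v \<bullet> (bdiff (Suc n) A k *v v))"
  proof (induction l)
    case (Suc l)
    then show ?case using decl[of l] step[of "k + l"] by (simp add: algebra_simps del: bdiff.simps)
  qed simp
qed

lemma trace_eq_sum_form: "trace (A :: real^'n^'n) = (\<Sum>i\<in>UNIV. axis i 1 \<bullet> (A *v axis i 1))"
  by (simp add: trace_def inner_axis_mult_axis)

lemma symmetric_polarization:
  fixes A :: "real^'n^'n"
  assumes "transpose A = A"
  shows "A $ i $ j = ((axis i 1 + axis j 1) \<bullet> (A *v (axis i 1 + axis j 1))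
    - axis i 1 \<bullet> (A *v axis i 1) - axis j 1 \<bullet> (A *v axis j 1)) / 2"
  using inner_symmetric_mult[OF assms, of "axis i 1" "axis j 1"]
  by (simp add: mv.add_right inner_simps inner_axis_mult_axis)

text \<open>Difference quotients of \<open>f0\<close> lie between values of \<open>- f1\<close>, and
  \<open>f1\<close> is locally Lipschitz with a constant supplied by \<open>f2\<close>, so the
  quotients converge.\<close>

lemma has_derivative_of_chord_bounds:
  fixes f0 f1 f2 :: "real \<Rightarrow> real"
  assumes f0: "\<And>s t. 0 < s \<Longrightarrow> s < t \<Longrightarrow> (t - s) * f1 t \<le> f0 s - f0 t \<and> f0 s - f0 t \<le> (t - s) * f1 s"
    and f1: "\<And>s t. 0 < s \<Longrightarrow> s < t \<Longrightarrow> (t - s) * f2 t \<le> f1 s - f1 t \<and> f1 s - f1 t \<le> (t - s) * f2 s"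
    and f2: "\<And>s t. 0 < s \<Longrightarrow> s < t \<Longrightarrow> 0 \<le> f2 t \<and> f2 t \<le> f2 s"
    and t: "0 < t"
  shows "(f0 has_real_derivative - f1 t) (at t)"
  unfolding has_field_derivative_iff
proof (rule Lim_transform2)
  show "((\<lambda>_. - f1 t) \<longlongrightarrow> - f1 t) (at t)" by (rule tendsto_const)
  have "((\<lambda>s. \<bar>s - t\<bar> * f2 (t / 2)) \<longlongrightarrow> \<bar>t - t\<bar> * f2 (t / 2)) (at t)"
    by (intro tendsto_intros)
  then have lim: "((\<lambda>s. \<bar>s - t\<bar> * f2 (t / 2)) \<longlongrightarrow> 0) (at t)" by simp
  have "\<forall>\<^sub>F s in at t. norm (- f1 t - (f0 s - f0 t) / (s - t)) \<le> norm (\<bar>s - t\<bar> * f2 (t / 2)) * 1"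
    unfolding eventually_at
  \<comment> \<open>The radius \<open>t / 2\<close> keeps \<open>s > t / 2\<close>, so
    \<open>f2 (t / 2)\<close> is one Lipschitz constant for the whole neighbourhood.\<close>
  proof (intro exI[of _ "t / 2"] conjI ballI impI)
    fix s assume s: "s \<noteq> t \<and> dist s t < t / 2"
    then have s2: "t / 2 < s" "s \<noteq> t" by (auto simp: dist_real_def abs_if split: if_splits)
    have f1b: "\<bar>f1 s - f1 t\<bar> \<le> \<bar>s - t\<bar> * f2 (t / 2)"
    proof (cases "s < t")
      case True
      have "(t - s) * f2 s \<le> (t - s) * f2 (t / 2)"
        using f2[of "t / 2" s] s2 t True by (intro mult_left_mono) auto
      moreover have "0 \<le> (t - s) * f2 t"
        using f2[of s t] s2 t True by (intro mult_nonneg_nonneg) auto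
      ultimately have "0 \<le> f1 s - f1 t" "f1 s - f1 t \<le> (t - s) * f2 (t / 2)"
        using f1[of s t] s2 t True by linarith+
      then show ?thesis using True by simp
    next
      case False
      have "(s - t) * f2 t \<le> (s - t) * f2 (t / 2)"
        using f2[of "t / 2" t] s2 t False by (intro mult_left_mono) auto
      moreover have "0 \<le> (s - t) * f2 s"
        using f2[of t s] s2 t False by (intro mult_nonneg_nonneg) auto
      ultimately have "0 \<le> f1 t - f1 s" "f1 t - f1 s \<le> (s - t) * f2 (t / 2)"
        using f1[of t s] s2 t False by linarith+
      then show ?thesis using False by simp
    qed
    have "\<bar>- f1 t - (f0 s - f0 t) / (s - t)\<bar> \<le> \<bar>f1 s - f1 t\<bar>"
    proof (cases "s < t")
      case True
      have "f1 t \<le> (f0 s - f0 t) / (t - s)" "(f0 s - f0 t) / (t - s) \<le> f1 s"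
        using f0[of s t] s2 t True by (auto simp: field_simps)
      moreover have "(f0 s - f0 t) / (s - t) = - ((f0 s - f0 t) / (t - s))"
        by (metis minus_diff_eq minus_divide_right)
      ultimately show ?thesis by simp
    next
      case False
      have "f1 s \<le> (f0 t - f0 s) / (s - t)" "(f0 t - f0 s) / (s - t) \<le> f1 t"
        using f0[of t s] s2 t False by (auto simp: field_simps)
      moreover have "(f0 s - f0 t) / (s - t) = - ((f0 t - f0 s) / (s - t))"
        by (simp add: divide_simps)
      ultimately show ?thesis by simp
    qed
    then show "norm (- f1 t - (f0 s - f0 t) / (s - t)) \<le> norm (\<bar>s - t\<bar> * f2 (t / 2)) * 1"
      using f1b by simp
  qed (use t in auto)
  then show "((\<lambda>s. - f1 t - (f0 s - f0 t) / (s - t)) \<longlongrightarrow> 0) (at t)"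
    by (rule tendsto_0_le[OF lim])
qed

text \<open>Complete monotonicity is assumed from index 1 on, and the bounds may deteriorate as
  \<open>t\<close> approaches 0: both leave room for mass near 0, which is excluded
  separately.\<close>

locale cm_approx =
  fixes g :: "nat \<Rightarrow> nat \<Rightarrow> real^'n^'n" and h :: "nat \<Rightarrow> real"
  assumes h_pos: "0 < h m" and h_lim: "h \<longlonglongrightarrow> 0"
    and cm: "cmseq (\<lambda>k. g m (Suc k))"
    and bounded: "0 < t \<Longrightarrow> \<exists>B. \<forall>\<^sub>F m in sequentially. trace (g m (nat \<lfloor>t / h m\<rfloor>)) \<le> B"
begin

definition ix :: "nat \<Rightarrow> real \<Rightarrow> nat" where
  "ix m t = nat \<lfloor>t / h m\<rfloor>"

text \<open>An approximation of \<open>(-1)\<^sup>n\<close> times the \<open>n\<close>-th derivative of the limit function.\<close>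

definition D :: "nat \<Rightarrow> nat \<Rightarrow> real \<Rightarrow> real^'n^'n" where
  "D n m t = (1 / h m ^ n) *\<^sub>R bdiff n (g m) (ix m t)"

lemma ix_mono: "s \<le> t \<Longrightarrow> ix m s \<le> ix m t"
  unfolding ix_def using h_pos[of m] by (intro nat_mono floor_mono divide_right_mono) auto

lemma ix_bounds:
  assumes "0 \<le> t"
  shows "real (ix m t) * h m \<le> t" and "t < real (ix m t) * h m + h m"
proof -
  have "real (ix m t) = of_int \<lfloor>t / h m\<rfloor>"
    unfolding ix_def using assms h_pos[of m] by (simp add: of_nat_nat)
  then have "real (ix m t) \<le> t / h m" "t / h m < real (ix m t) + 1" by linarith+
  then show "real (ix m t) * h m \<le> t" "t < real (ix m t) * h m + h m"
    using h_pos[of m] by (auto simp: field_simps)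
qed

lemma ix_pos: "h m \<le> t \<Longrightarrow> 1 \<le> ix m t"
  unfolding ix_def using h_pos[of m] by (simp add: le_nat_iff le_floor_iff)

lemma h_small: "0 < t \<Longrightarrow> \<forall>\<^sub>F m in sequentially. h m < t"
  using h_lim by (rule order_tendstoD)

lemma D_psd: "h m \<le> t \<Longrightarrow> psd (D n m t)"
  unfolding D_def using h_pos[of m] by (intro psd_scaleR psd_shift_bdiff[OF cm ix_pos]) auto

text \<open>\<open>bdiff_mono_bounds\<close> in the time scale. The grid distance \<open>l h\<close>
  differs from \<open>t - s\<close> by at most one mesh, hence the terms \<open>h m\<close>;
  \<open>h m \<le> s\<close> guarantees an index of at least 1.\<close>

lemma D_bounds:
  assumes "h m \<le> s" "s \<le> t"
  shows "(t - s - h m) * (v \<bullet> (D (Suc n) m t *v v)) \<le> v \<bullet> (D n m s *v v) - v \<bullet> (D n m t *v v)"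
    and "v \<bullet> (D n m s *v v) - v \<bullet> (D n m t *v v) \<le> (t - s + h m) * (v \<bullet> (D (Suc n) m s *v v))"
proof -
  have h: "0 < h m" by (rule h_pos)
  have s0: "0 \<le> s" "0 \<le> t" using assms h by auto
  define l where "l = ix m t - ix m s"
  have ixt: "ix m t = ix m s + l" using ix_mono[OF assms(2)] by (simp add: l_def)
  have l: "t - s - h m \<le> real l * h m" "real l * h m \<le> t - s + h m"
    using ix_bounds[OF s0(1), of m] ix_bounds[OF s0(2), of m] by (auto simp: ixt algebra_simps)
  let ?b = "\<lambda>n k. v \<bullet> (bdiff n (g m) k *v v)"
  have D: "v \<bullet> (D n m x *v v) = ?b n (ix m x) / h m ^ n" for n x
    by (simp add: D_def form_scaleR del: bdiff.simps)
  note b = bdiff_mono_bounds[OF cm ix_pos[OF assms(1)], where l = l and v = v and n = n]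
  have "(t - s - h m) * (v \<bullet> (D (Suc n) m t *v v)) \<le> real l * h m * (v \<bullet> (D (Suc n) m t *v v))"
    using l(1) assms by (intro mult_right_mono psd_nonneg[OF D_psd]) auto
  also have "\<dots> = real l * ?b (Suc n) (ix m t) / h m ^ n"
    using h unfolding D by simp
  also have "\<dots> \<le> (?b n (ix m s) - ?b n (ix m t)) / h m ^ n"
    using b(1) h by (intro divide_right_mono) (auto simp: ixt)
  finally show "(t - s - h m) * (v \<bullet> (D (Suc n) m t *v v)) \<le> v \<bullet> (D n m s *v v) - v \<bullet> (D n m t *v v)"
    unfolding D by (simp add: diff_divide_distrib)
  have "(?b n (ix m s) - ?b n (ix m t)) / h m ^ n \<le> real l * ?b (Suc n) (ix m s) / h m ^ n"
    using b(2) h by (intro divide_right_mono) (auto simp: ixt)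
  also have "\<dots> = real l * h m * (v \<bullet> (D (Suc n) m s *v v))"
    using h unfolding D by simp
  also have "\<dots> \<le> (t - s + h m) * (v \<bullet> (D (Suc n) m s *v v))"
    using l(2) assms by (intro mult_right_mono psd_nonneg[OF D_psd]) auto
  finally show "v \<bullet> (D n m s *v v) - v \<bullet> (D n m t *v v) \<le> (t - s + h m) * (v \<bullet> (D (Suc n) m s *v v))"
    unfolding D by (simp add: diff_divide_distrib)
qed

lemma D_form_decreasing:
  assumes "h m \<le> s" "s \<le> t"
  shows "v \<bullet> (D n m t *v v) \<le> v \<bullet> (D n m s *v v)"
proof -
  define l where "l = ix m t - ix m s"
  have ixt: "ix m t = ix m s + l" using ix_mono[OF assms(2)] by (simp add: l_def)
  have "0 \<le> real l * (v \<bullet> (bdiff (Suc n) (g m) (ix m t) *v v))"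
    using assms by (intro mult_nonneg_nonneg psd_nonneg psd_shift_bdiff[OF cm] ix_pos) auto
  also have "\<dots> \<le> v \<bullet> (bdiff n (g m) (ix m s) *v v) - v \<bullet> (bdiff n (g m) (ix m t) *v v)"
    unfolding ixt by (rule bdiff_mono_bounds(1)[OF cm ix_pos[OF assms(1)]])
  finally have "0 \<le> v \<bullet> (bdiff n (g m) (ix m s) *v v) - v \<bullet> (bdiff n (g m) (ix m t) *v v)" .
  then show ?thesis
    using h_pos[of m] by (simp add: D_def form_scaleR divide_right_mono)
qed

lemma D_trace_bounds:
  assumes "h m \<le> s" "s \<le> t"
  shows "(t - s - h m) * trace (D (Suc n) m t) \<le> trace (D n m s) - trace (D n m t)"
    and "trace (D n m s) - trace (D n m t) \<le> (t - s + h m) * trace (D (Suc n) m s)"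
    and "trace (D n m t) \<le> trace (D n m s)"
  unfolding trace_eq_sum_form sum_distrib_left sum_subtractf[symmetric]
  by (intro sum_mono D_bounds[OF assms] D_form_decreasing[OF assms])+

text \<open>By induction on the order: as the traces decrease, the next order at \<open>t\<close> is
  at most the increment of the previous one over \<open>[t / 2, t]\<close> divided by the length. A
  mesh below \<open>t / 4\<close> leaves a usable length of \<open>t / 4\<close>, hence the factor
  \<open>4 / t\<close>.\<close>

lemma D_eventually_bounded:
  assumes "0 < t"
  shows "\<exists>B. \<forall>\<^sub>F m in sequentially. trace (D n m t) \<le> B"
  using assms
proof (induction n arbitrary: t)
  case 0
  then show ?case using bounded[OF 0] by (simp add: D_def ix_def)
next
  case (Suc n)
  then obtain B where B: "\<forall>\<^sub>F m in sequentially. trace (D n m (t / 2)) \<le> B" by fastforce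
  have "\<forall>\<^sub>F m in sequentially. trace (D (Suc n) m t) \<le> B * 4 / t"
    using B h_small[of "t / 4", OF divide_pos_pos[OF Suc.prems zero_less_numeral]]
  proof eventually_elim
    case (elim m)
    have h: "0 < h m" "h m < t / 4" using h_pos elim by auto
    have p: "0 \<le> trace (D k m t)" for k using h by (intro psd_trace_nonneg D_psd) auto
    have "t / 4 * trace (D (Suc n) m t) \<le> (t - t / 2 - h m) * trace (D (Suc n) m t)"
      using h p by (intro mult_right_mono) auto
    also have "\<dots> \<le> trace (D n m (t / 2)) - trace (D n m t)"
      using h by (intro D_trace_bounds) auto
    also have "\<dots> \<le> B" using p[of n] elim by simp
    finally show ?case using Suc.prems by (simp add: field_simps)
  qed
  then show ?case by blast
qed

text \<open>Step functions jump, so a Lipschitz bound can hold only up to one mesh. The constant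
  comes from the eventual bound on the next order at \<open>a\<close>, where its trace is
  largest.\<close>

lemma D_lipschitz:
  assumes "0 < a"
  obtains B where "0 < B"
    "\<forall>\<^sub>F m in sequentially. \<forall>s\<ge>a. \<forall>t\<ge>a. norm (D n m s - D n m t) \<le> B * (\<bar>t - s\<bar> + h m)"
proof -
  obtain B where B: "\<forall>\<^sub>F m in sequentially. trace (D (Suc n) m a) \<le> B"
    using D_eventually_bounded[OF assms] by blast
  define C where "C = real CARD('n) ^ 2 * max B 1"
  have "0 < C" by (simp add: C_def)
  moreover have "\<forall>\<^sub>F m in sequentially. \<forall>s\<ge>a. \<forall>t\<ge>a. norm (D n m s - D n m t) \<le> C * (\<bar>t - s\<bar> + h m)"
    using B h_small[OF assms]
  proof eventually_elim
    case (elim m)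
    have ord: "norm (D n m s - D n m t) \<le> C * (t - s + h m)" if st: "a \<le> s" "s \<le> t" for s t
    proof -
      have h: "h m \<le> s" using elim st by simp
      have "psd (D n m s - D n m t)"
        using D_form_decreasing[OF h st(2), of _ n] psd_symmetric[OF D_psd] h st
        by (simp add: psd_def transpose_diff form_diff)
      then have "norm (D n m s - D n m t) \<le> real CARD('n) ^ 2 * (trace (D n m s) - trace (D n m t))"
        using psd_norm_le_trace by (metis trace_diff)
      also have "trace (D n m s) - trace (D n m t) \<le> (t - s + h m) * trace (D (Suc n) m s)"
        by (rule D_trace_bounds[OF h st(2)])
      also have "\<dots> \<le> (t - s + h m) * max B 1"
        using D_trace_bounds(3)[of m a s "Suc n"] elim st h_pos[of m]
        by (intro mult_left_mono) auto
      finally show ?thesis by (simp add: C_def mult_ac)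
    qed
    show ?case
    proof (intro allI impI)
      fix s t assume "a \<le> s" "a \<le> t"
      then show "norm (D n m s - D n m t) \<le> C * (\<bar>t - s\<bar> + h m)"
        using ord[of s t] ord[of t s] by (cases "s \<le> t") (auto simp: norm_minus_commute)
    qed
  qed
  ultimately show thesis by (rule that)
qed

lemma D_Bseq:
  assumes "0 < t"
  shows "Bseq (\<lambda>m. D n m t)"
proof -
  obtain B where B: "\<forall>\<^sub>F m in sequentially. trace (D n m t) \<le> B"
    using D_eventually_bounded[OF assms] by blast
  have "\<forall>\<^sub>F m in sequentially. norm (D n m t) \<le> real CARD('n) ^ 2 * B"
    using B h_small[OF assms]
  proof eventually_elim
    case (elim m)
    have "norm (D n m t) \<le> real CARD('n) ^ 2 * trace (D n m t)"
      using elim by (intro psd_norm_le_trace D_psd) auto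
    also have "\<dots> \<le> real CARD('n) ^ 2 * B" using elim by (intro mult_left_mono) auto
    finally show ?case .
  qed
  then show ?thesis by (rule BfunI)
qed

text \<open>Diagonal selection over all orders and all positive rationals;
  \<open>D_lipschitz\<close> carries convergence over to every positive real.\<close>

lemma convergent_subsequence:
  obtains r :: "nat \<Rightarrow> nat" where "strict_mono r"
    "\<And>n t. 0 < t \<Longrightarrow> convergent (\<lambda>i. D n (r i) t)"
proof -
  have "\<exists>M>0. \<forall>m. norm (D n m t) \<le> M" if "0 < t" for n t
    using D_Bseq[OF that, of n] unfolding Bseq_def by blast
  then have "\<forall>n t. \<exists>M. 0 < t \<longrightarrow> 0 < M \<and> (\<forall>m. norm (D n m t) \<le> M)" by blast
  then obtain M where "\<forall>n t. 0 < t \<longrightarrow> 0 < M n t \<and> (\<forall>m. norm (D n m t) \<le> M n t)"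
    by metis
  then have M: "\<And>n t. 0 < t \<Longrightarrow> 0 < M n t" "\<And>n t m. 0 < t \<Longrightarrow> norm (D n m t) \<le> M n t"
    by auto
  define S :: "(nat \<times> real) set" where "S = UNIV \<times> {q \<in> \<rat>. (0::real) < q}"
  have S: "countable S"
    unfolding S_def by (intro countable_SIGMA countable_subset[OF _ countable_rat]) auto
  \<comment> \<open>Dividing by \<open>M n q\<close> makes the family uniformly bounded by 1 on
    \<open>S\<close>, as the selection principle requires.\<close>
  define f where "f m x = (case x of (n, q) \<Rightarrow> (1 / M n q) *\<^sub>R D n m q)" for m and x :: "nat \<times> real"
  have f: "norm (f m x) \<le> 1" if "x \<in> S" for m x
    using that M(1)[of "snd x" "fst x"] M(2)[of "snd x" "fst x" m]
    by (auto simp: f_def S_def split: prod.splits)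
  obtain r where r: "strict_mono (r :: nat \<Rightarrow> nat)" "\<And>x. x \<in> S \<Longrightarrow> \<exists>l. (\<lambda>i. f (r i) x) \<longlonglongrightarrow> l"
    using function_convergent_subsequence[OF S, of f 1] f by metis
  have rat: "convergent (\<lambda>i. D n (r i) q)" if "q \<in> \<rat>" "0 < q" for n q
  proof -
    obtain l where "(\<lambda>i. f (r i) (n, q)) \<longlonglongrightarrow> l" using r(2)[of "(n, q)"] \<open>q \<in> \<rat>\<close> \<open>0 < q\<close> by (auto simp: S_def)
    then have "(\<lambda>i. M n q *\<^sub>R f (r i) (n, q)) \<longlonglongrightarrow> M n q *\<^sub>R l" by (intro tendsto_intros)
    moreover have "M n q *\<^sub>R f m (n, q) = D n m q" for m using M(1)[OF that(2), of n] by (simp add: f_def)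
    ultimately show ?thesis by (auto simp: convergent_def)
  qed
  have "convergent (\<lambda>i. D n (r i) t)" if t: "0 < t" for n t
  proof (rule Cauchy_convergent)
    show "Cauchy (\<lambda>i. D n (r i) t)"
      unfolding Cauchy_def dist_norm
    proof (intro allI impI)
      fix e :: real assume e: "0 < e"
      obtain B where B: "0 < B" "\<forall>\<^sub>F m in sequentially. \<forall>s\<ge>t. \<forall>t'\<ge>t. norm (D n m s - D n m t') \<le> B * (\<bar>t' - s\<bar> + h m)"
        using D_lipschitz[OF t] by blast
      \<comment> \<open>Both \<open>q - t\<close> and eventually \<open>h m\<close> stay below
        \<open>d\<close>, so the Lipschitz bound becomes \<open>2 B d = e / 4\<close>.\<close>
      define d where "d = e / (8 * B)"
      have d: "0 < d" using e B by (simp add: d_def)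
      obtain q where q: "q \<in> \<rat>" "t < q" "q < t + d" using Rats_dense_in_real[of t "t + d"] d by auto
      have "\<forall>\<^sub>F m in sequentially. norm (D n m t - D n m q) \<le> e / 4"
        using B(2) h_small[OF d]
      proof eventually_elim
        case (elim m)
        have "norm (D n m t - D n m q) \<le> B * (\<bar>q - t\<bar> + h m)" using elim q by auto
        also have "\<dots> \<le> B * (2 * d)" using B(1) q elim by (intro mult_left_mono) auto
        also have "\<dots> = e / 4" using B(1) by (simp add: d_def)
        finally show ?case .
      qed
      then have "\<forall>\<^sub>F i in sequentially. norm (D n (r i) t - D n (r i) q) \<le> e / 4"
        using eventually_subseq[OF r(1)] by blast
      then obtain N1 where N1: "\<And>i. i \<ge> N1 \<Longrightarrow> norm (D n (r i) t - D n (r i) q) \<le> e / 4"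
        unfolding eventually_sequentially by blast
      have "Cauchy (\<lambda>i. D n (r i) q)" using rat[OF q(1)] q(2) t by (intro convergent_Cauchy) auto
      then obtain N2 where N2: "\<And>i j. i \<ge> N2 \<Longrightarrow> j \<ge> N2 \<Longrightarrow> norm (D n (r i) q - D n (r j) q) < e / 4"
        using e unfolding Cauchy_def dist_norm by (meson divide_pos_pos zero_less_numeral)
      have "norm (D n (r i) t - D n (r j) t) < e" if "i \<ge> max N1 N2" "j \<ge> max N1 N2" for i j
      proof -
        have "norm (D n (r i) t - D n (r j) t) \<le> norm (D n (r i) t - D n (r i) q)
            + norm (D n (r i) q - D n (r j) q) + norm (D n (r j) q - D n (r j) t)"
          using norm_triangle_ineq[of "D n (r i) t - D n (r i) q" "D n (r i) q - D n (r j) t"]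
            norm_triangle_ineq[of "D n (r i) q - D n (r j) q" "D n (r j) q - D n (r j) t"] by simp
        then show ?thesis
          using N1[of i] N1[of j] N2[of i j] that e by (simp add: norm_minus_commute)
      qed
      then show "\<exists>M. \<forall>i\<ge>M. \<forall>j\<ge>M. norm (D n (r i) t - D n (r j) t) < e" by blast
    qed
  qed
  with r(1) show thesis by (rule that)
qed

text \<open>The evaluation points may move with the grid, because the discrete equation is exact
  only at grid points near a given time.\<close>

lemma cm_limit:
  obtains r :: "nat \<Rightarrow> nat" and G where "strict_mono r" "completely_monotone G"
    "\<And>t s. 0 < t \<Longrightarrow> s \<longlonglongrightarrow> t \<Longrightarrow> (\<lambda>i. g (r i) (nat \<lfloor>s i / h (r i)\<rfloor>)) \<longlonglongrightarrow> G t"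
proof -
  obtain r where r: "strict_mono r" and conv: "\<And>n t. 0 < t \<Longrightarrow> convergent (\<lambda>i. D n (r i) t)"
    using convergent_subsequence by blast
  define W where "W n t = lim (\<lambda>i. D n (r i) t)" for n t
  have W: "(\<lambda>i. D n (r i) t) \<longlonglongrightarrow> W n t" if "0 < t" for n t
    using conv[OF that] by (simp add: W_def convergent_LIMSEQ_iff)
  have hr: "(\<lambda>i. h (r i)) \<longlonglongrightarrow> 0" using LIMSEQ_subseq_LIMSEQ[OF h_lim r] by (simp add: o_def)
  have ev: "\<forall>\<^sub>F i in sequentially. h (r i) \<le> t" if "0 < t" for t
    using order_tendstoD(2)[OF hr that] by eventually_elim simp
  have form: "(\<lambda>i. v \<bullet> (D n (r i) t *v v)) \<longlonglongrightarrow> v \<bullet> (W n t *v v)" if "0 < t" for n t v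
    by (rule bounded_linear.tendsto[OF bounded_linear_form W[OF that]])
  have psd: "psd (W n t)" if t: "0 < t" for n t
  proof -
    have "(\<lambda>i. transpose (D n (r i) t)) \<longlonglongrightarrow> transpose (W n t)"
      by (rule bounded_linear.tendsto[OF bounded_linear_transpose W[OF t]])
    moreover have "\<forall>\<^sub>F i in sequentially. transpose (D n (r i) t) = D n (r i) t"
      using ev[OF t] by eventually_elim (rule psd_symmetric[OF D_psd])
    ultimately have "(\<lambda>i. D n (r i) t) \<longlonglongrightarrow> transpose (W n t)" by (rule Lim_transform_eventually)
    then have "transpose (W n t) = W n t" using W[OF t] LIMSEQ_unique by blast
    moreover have "0 \<le> v \<bullet> (W n t *v v)" for v
    proof (rule tendsto_lowerbound[OF form[OF t]])
      show "\<forall>\<^sub>F i in sequentially. 0 \<le> v \<bullet> (D n (r i) t *v v)"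
        using ev[OF t] by eventually_elim (rule psd_nonneg[OF D_psd])
    qed simp
    ultimately show ?thesis by (simp add: psd_def)
  qed
  have chord: "(t - s) * (v \<bullet> (W (Suc n) t *v v)) \<le> v \<bullet> (W n s *v v) - v \<bullet> (W n t *v v) \<and>
      v \<bullet> (W n s *v v) - v \<bullet> (W n t *v v) \<le> (t - s) * (v \<bullet> (W (Suc n) s *v v))"
    and dec: "v \<bullet> (W n t *v v) \<le> v \<bullet> (W n s *v v)"
    if s: "0 < s" and st: "s < t" for s t n v
  proof -
    have t: "0 < t" using s st by simp
    have l1: "(\<lambda>i. (t - s - h (r i)) * (v \<bullet> (D (Suc n) (r i) t *v v))) \<longlonglongrightarrow> (t - s - 0) * (v \<bullet> (W (Suc n) t *v v))"
      by (intro tendsto_intros form[OF t] hr)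
    have l2: "(\<lambda>i. (t - s + h (r i)) * (v \<bullet> (D (Suc n) (r i) s *v v))) \<longlonglongrightarrow> (t - s + 0) * (v \<bullet> (W (Suc n) s *v v))"
      by (intro tendsto_intros form[OF s] hr)
    have l3: "(\<lambda>i. v \<bullet> (D n (r i) s *v v) - v \<bullet> (D n (r i) t *v v)) \<longlonglongrightarrow> v \<bullet> (W n s *v v) - v \<bullet> (W n t *v v)"
      by (intro tendsto_diff form s t)
    have "\<forall>\<^sub>F i in sequentially. (t - s - h (r i)) * (v \<bullet> (D (Suc n) (r i) t *v v)) \<le> v \<bullet> (D n (r i) s *v v) - v \<bullet> (D n (r i) t *v v)"
      using ev[OF s] by eventually_elim (use st in \<open>intro D_bounds; simp\<close>)
    moreover have "\<forall>\<^sub>F i in sequentially. v \<bullet> (D n (r i) s *v v) - v \<bullet> (D n (r i) t *v v) \<le> (t - s + h (r i)) * (v \<bullet> (D (Suc n) (r i) s *v v))"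
      using ev[OF s] by eventually_elim (use st in \<open>intro D_bounds; simp\<close>)
    ultimately show "(t - s) * (v \<bullet> (W (Suc n) t *v v)) \<le> v \<bullet> (W n s *v v) - v \<bullet> (W n t *v v) \<and>
      v \<bullet> (W n s *v v) - v \<bullet> (W n t *v v) \<le> (t - s) * (v \<bullet> (W (Suc n) s *v v))"
      using tendsto_le[OF _ l3 l1] tendsto_le[OF _ l2 l3] by simp
    then show "v \<bullet> (W n t *v v) \<le> v \<bullet> (W n s *v v)"
      using psd_nonneg[OF psd[OF t], of v "Suc n"] st
      by (smt (verit) mult_nonneg_nonneg)
  qed
  have form_deriv: "((\<lambda>t. v \<bullet> (W n t *v v)) has_real_derivative - (v \<bullet> (W (Suc n) t *v v))) (at t)"
    if "0 < t" for n t v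
  proof (rule has_derivative_of_chord_bounds[OF chord chord _ that])
    fix s t :: real assume "0 < s" "s < t"
    then show "0 \<le> v \<bullet> (W (Suc (Suc n)) t *v v) \<and> v \<bullet> (W (Suc (Suc n)) t *v v) \<le> v \<bullet> (W (Suc (Suc n)) s *v v)"
      using psd_nonneg[OF psd] dec by auto
  qed
  have deriv: "(W n has_vector_derivative - W (Suc n) t) (at t)" if t: "0 < t" for n t
  proof -
    \<comment> \<open>Derivatives are known for quadratic forms only; polarization of the symmetric
      \<open>W n\<close> transfers them to the entries.\<close>
    have entry: "((\<lambda>s. W n s $ i $ j) has_real_derivative - W (Suc n) t $ i $ j) (at t)" for i j
    proof -
      let ?q = "\<lambda>n s. ((axis i 1 + axis j 1) \<bullet> (W n s *v (axis i 1 + axis j 1))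
        - axis i 1 \<bullet> (W n s *v axis i 1) - axis j 1 \<bullet> (W n s *v axis j 1)) / 2"
      have neg: "(- a - - b - - c) / 2 = - ((a - b - c) / 2)" for a b c :: real by (simp add: field_simps)
      have "(?q n has_real_derivative - ?q (Suc n) t) (at t)"
        by (rule DERIV_cong[OF DERIV_cdivide[OF DERIV_diff[OF DERIV_diff[OF form_deriv[OF t] form_deriv[OF t]] form_deriv[OF t]]]])
          (rule neg)
      then have "(?q n has_vector_derivative - ?q (Suc n) t) (at t)"
        by (simp add: has_real_derivative_iff_has_vector_derivative)
      then have "((\<lambda>s. W n s $ i $ j) has_vector_derivative - ?q (Suc n) t) (at t)"
        by (rule has_vector_derivative_eq_on_pos[OF _ t])
          (simp add: symmetric_polarization[OF psd_symmetric[OF psd], of _ n i j])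
      then show ?thesis
        by (simp add: has_real_derivative_iff_has_vector_derivative
            symmetric_polarization[OF psd_symmetric[OF psd[OF t]], of "Suc n" i j])
    qed
    have if_sum: "(\<Sum>j\<in>UNIV. if P then f j else 0) = (if P then (\<Sum>j\<in>UNIV. f j) else 0)"
      for P and f :: "'n \<Rightarrow> real"
      by simp
    have sum: "A = (\<Sum>i\<in>UNIV. \<Sum>j\<in>UNIV. (A $ i $ j) *\<^sub>R axis i (axis j 1))" for A :: "real^'n^'n"
      by (simp add: if_sum vec_eq_iff axis_def if_distrib[of "\<lambda>x. x $ _"] if_distrib[of "\<lambda>x. _ * x"] cong: if_cong)
    have "((\<lambda>s. \<Sum>i\<in>UNIV. \<Sum>j\<in>UNIV. (W n s $ i $ j) *\<^sub>R axis i (axis j 1) :: real^'n^'n) has_vector_derivative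
        (\<Sum>i\<in>UNIV. \<Sum>j\<in>UNIV. (- W (Suc n) t $ i $ j) *\<^sub>R axis i (axis j 1))) (at t)"
      by (rule derivative_eq_intros entry refl)+ simp
    then show ?thesis by (simp only: sum[symmetric] vector_uminus_component[symmetric])
  qed
  have "completely_monotone (W 0)"
    by (rule cm_family_imp_completely_monotone[of W]) (use deriv psd in \<open>auto simp: cm_family_def\<close>)
  moreover have "(\<lambda>i. g (r i) (nat \<lfloor>s i / h (r i)\<rfloor>)) \<longlonglongrightarrow> W 0 t" if t: "0 < t" and s: "s \<longlonglongrightarrow> t" for t s
  proof -
    obtain B where B: "0 < B" "\<forall>\<^sub>F m in sequentially. \<forall>x\<ge>t / 2. \<forall>y\<ge>t / 2. norm (D 0 m x - D 0 m y) \<le> B * (\<bar>y - x\<bar> + h m)"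
      using D_lipschitz[of "t / 2" 0] t by auto
    have "\<forall>\<^sub>F i in sequentially. \<forall>x\<ge>t / 2. \<forall>y\<ge>t / 2. norm (D 0 (r i) x - D 0 (r i) y) \<le> B * (\<bar>y - x\<bar> + h (r i))"
      using eventually_subseq[OF r B(2)] .
    moreover have "\<forall>\<^sub>F i in sequentially. t / 2 < s i" using t by (intro order_tendstoD[OF s]) auto
    ultimately have le: "\<forall>\<^sub>F i in sequentially. norm (D 0 (r i) (s i) - D 0 (r i) t) \<le> B * (\<bar>t - s i\<bar> + h (r i))"
      by eventually_elim (use t in auto)
    have "(\<lambda>i. B * (\<bar>t - s i\<bar> + h (r i))) \<longlonglongrightarrow> B * (\<bar>t - t\<bar> + 0)"
      by (intro tendsto_intros s hr)
    then have "(\<lambda>i. D 0 (r i) (s i) - D 0 (r i) t) \<longlonglongrightarrow> 0"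
      by (intro Lim_null_comparison[OF le]) simp
    from tendsto_add[OF this W[OF t, of 0]] have "(\<lambda>i. D 0 (r i) (s i)) \<longlonglongrightarrow> W 0 t" by simp
    then show ?thesis by (simp add: D_def ix_def)
  qed
  ultimately show thesis using r that by blast
qed

end

section \<open>Integrals of matrix products and of step functions\<close>

lemma borel_measurable_matrix_mult [measurable (raw)]:
  fixes p q :: "'a \<Rightarrow> real^'n^'n"
  assumes "p \<in> borel_measurable M" "q \<in> borel_measurable M"
  shows "(\<lambda>x. p x ** q x) \<in> borel_measurable M"
  by (rule borel_measurable_continuous_Pair[OF assms])
    (intro continuous_on_compose2[OF mm.continuous_on] continuous_intros mm.continuous_on)

text \<open>The norm is the Frobenius norm; Cauchy-Schwarz is applied to each row of
  \<open>A\<close> against each column of \<open>B\<close>.\<close>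

lemma norm_matrix_mult_le:
  fixes A B :: "real^'n^'n"
  shows "norm (A ** B) \<le> norm A * norm B"
proof -
  have e: "(norm X)\<^sup>2 = (\<Sum>i\<in>UNIV. X $ i \<bullet> X $ i)" for X :: "real^'n^'n"
    by (simp add: power2_norm_eq_inner inner_vec_def)
  have "(norm (A ** B))\<^sup>2 = (\<Sum>i\<in>UNIV. \<Sum>j\<in>UNIV. (A $ i \<bullet> transpose B $ j)\<^sup>2)"
    unfolding e by (simp add: inner_vec_def matrix_matrix_mult_def transpose_def power2_eq_square)
  also have "\<dots> \<le> (\<Sum>i\<in>UNIV. \<Sum>j\<in>UNIV. (A $ i \<bullet> A $ i) * (transpose B $ j \<bullet> transpose B $ j))"
    by (intro sum_mono Cauchy_Schwarz_ineq)
  also have "\<dots> = (norm A)\<^sup>2 * (norm (transpose B))\<^sup>2"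
    by (simp add: e sum_product)
  also have "(norm (transpose B))\<^sup>2 = (norm B)\<^sup>2"
    unfolding e by (simp add: inner_vec_def transpose_def, rule sum.swap)
  finally have "(norm (A ** B))\<^sup>2 \<le> (norm A * norm B)\<^sup>2"
    by (simp add: power_mult_distrib)
  then show ?thesis
    by (rule power2_le_imp_le) simp
qed

lemma integrable_mult_bounded_right:
  fixes P Q :: "'a \<Rightarrow> real^'n^'n"
  assumes P: "integrable M P" and Q: "Q \<in> borel_measurable M" and b: "\<And>x. norm (Q x) \<le> b"
  shows "integrable M (\<lambda>x. P x ** Q x)"
proof (rule Bochner_Integration.integrable_bound)
  show "integrable M (\<lambda>x. b * norm (P x))" using P by simp
  show "(\<lambda>x. P x ** Q x) \<in> borel_measurable M" using P Q by measurable
  have "norm (P x ** Q x) \<le> norm (b * norm (P x))" for x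
  proof -
    have "norm (P x) * norm (Q x) \<le> norm (P x) * \<bar>b\<bar>"
      using b[of x] by (intro mult_left_mono) auto
    then show ?thesis using norm_matrix_mult_le[of "P x" "Q x"] by (simp add: abs_mult mult.commute)
  qed
  then show "AE x in M. norm (P x ** Q x) \<le> norm (b * norm (P x))" by simp
qed

lemma integrable_mult_bounded_left:
  fixes P Q :: "'a \<Rightarrow> real^'n^'n"
  assumes P: "P \<in> borel_measurable M" and Q: "integrable M Q" and b: "\<And>x. norm (P x) \<le> b"
  shows "integrable M (\<lambda>x. P x ** Q x)"
proof (rule Bochner_Integration.integrable_bound)
  show "integrable M (\<lambda>x. b * norm (Q x))" using Q by simp
  show "(\<lambda>x. P x ** Q x) \<in> borel_measurable M" using P Q by measurable
  have "norm (P x ** Q x) \<le> norm (b * norm (Q x))" for x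
  proof -
    have "norm (P x) * norm (Q x) \<le> \<bar>b\<bar> * norm (Q x)"
      using b[of x] by (intro mult_right_mono) auto
    then show ?thesis using norm_matrix_mult_le[of "P x" "Q x"] by (simp add: abs_mult mult.commute)
  qed
  then show "AE x in M. norm (P x ** Q x) \<le> norm (b * norm (Q x))" by simp
qed

text \<open>In \<open>F u ** G (t - u)\<close> the singularities sit at opposite ends. Away from
  \<open>u = t\<close> the second factor is bounded and this lemma applies; near
  \<open>u = t\<close> its mirror image \<open>set_integrable_mult_bounded_left\<close>
  does.\<close>

lemma set_integrable_mult_bounded_right:
  fixes P Q :: "'a \<Rightarrow> real^'n^'n"
  assumes P: "set_integrable M A P" and Q: "set_borel_measurable M A Q" and b: "\<And>x. x \<in> A \<Longrightarrow> norm (Q x) \<le> b"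
  shows "set_integrable M A (\<lambda>x. P x ** Q x)"
proof -
  have "integrable M (\<lambda>x. (indicat_real A x *\<^sub>R P x) ** (indicat_real A x *\<^sub>R Q x))"
    using P Q unfolding set_integrable_def set_borel_measurable_def
    by (rule integrable_mult_bounded_right[where b = "max b 0"]) (use b in \<open>auto simp: indicator_def le_max_iff_disj\<close>)
  then show ?thesis
    unfolding set_integrable_def
    by (rule Bochner_Integration.integrable_cong[THEN iffD1, rotated -1]) (auto simp: indicator_def mm.zero_left)
qed

lemma set_integrable_mult_bounded_left:
  fixes P Q :: "'a \<Rightarrow> real^'n^'n"
  assumes P: "set_borel_measurable M A P" and Q: "set_integrable M A Q" and b: "\<And>x. x \<in> A \<Longrightarrow> norm (P x) \<le> b"
  shows "set_integrable M A (\<lambda>x. P x ** Q x)"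
proof -
  have "integrable M (\<lambda>x. (indicat_real A x *\<^sub>R P x) ** (indicat_real A x *\<^sub>R Q x))"
    using P Q unfolding set_integrable_def set_borel_measurable_def
    by (rule integrable_mult_bounded_left[where b = "max b 0"]) (use b in \<open>auto simp: indicator_def le_max_iff_disj\<close>)
  then show ?thesis
    unfolding set_integrable_def
    by (rule Bochner_Integration.integrable_cong[THEN iffD1, rotated -1]) (auto simp: indicator_def mm.zero_left)
qed

text \<open>For the part of a convolution integral near the singularity of \<open>Q\<close>, where
  only the integrated trace of \<open>Q\<close> is under control.\<close>

lemma norm_set_integral_mult_psd_le:
  fixes P Q :: "'a \<Rightarrow> real^'n^'n"
  assumes P: "set_borel_measurable M A P" and Q: "set_integrable M A Q"
    and b: "\<And>x. x \<in> A \<Longrightarrow> norm (P x) \<le> b" and psd: "\<And>x. x \<in> A \<Longrightarrow> psd (Q x)" and "0 \<le> b"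
  shows "norm (LINT x:A|M. P x ** Q x) \<le> b * real CARD('n) ^ 2 * (LINT x:A|M. trace (Q x))"
proof -
  have i: "set_integrable M A (\<lambda>x. P x ** Q x)"
    by (rule set_integrable_mult_bounded_left[OF P Q b])
  have t: "set_integrable M A (\<lambda>x. trace (Q x))"
    using integrable_bounded_linear[OF bounded_linear_trace Q[unfolded set_integrable_def]]
    by (simp add: set_integrable_def trace_scaleR)
  have "norm (LINT x:A|M. P x ** Q x) \<le> (LINT x:A|M. norm (P x ** Q x))"
    by (rule set_integral_norm_bound[OF i])
  also have "\<dots> \<le> (LINT x:A|M. b * real CARD('n) ^ 2 * trace (Q x))"
  proof (rule set_integral_mono)
    show "set_integrable M A (\<lambda>x. norm (P x ** Q x))" by (rule set_integrable_norm[OF i])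
    show "set_integrable M A (\<lambda>x. b * real CARD('n) ^ 2 * trace (Q x))"
      using t by (rule set_integrable_mult_right)
    fix x assume x: "x \<in> A"
    have "norm (P x ** Q x) \<le> norm (P x) * norm (Q x)" by (rule norm_matrix_mult_le)
    also have "\<dots> \<le> b * (real CARD('n) ^ 2 * trace (Q x))"
      using b[OF x] psd_norm_le_trace[OF psd[OF x]] \<open>0 \<le> b\<close>
      by (intro mult_right_mono mult_mono) auto
    finally show "norm (P x ** Q x) \<le> b * real CARD('n) ^ 2 * trace (Q x)"
      by (simp add: mult_ac)
  qed
  finally show ?thesis by simp
qed

lemma set_integral_reflect:
  fixes f :: "real \<Rightarrow> 'a::euclidean_space"
  shows "(LINT x:{a..<b}|lborel. f x) = (LINT u:{T - b<..T - a}|lborel. f (T - u))"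
    and "set_integrable lborel {a..<b} f \<longleftrightarrow> set_integrable lborel {T - b<..T - a} (\<lambda>u. f (T - u))"
proof -
  have ind: "indicat_real {a..<b} (T - u) = indicat_real {T - b<..T - a} u" for u
    by (auto simp: indicator_def)
  show "(LINT x:{a..<b}|lborel. f x) = (LINT u:{T - b<..T - a}|lborel. f (T - u))"
    unfolding set_lebesgue_integral_def
    using lborel_integral_real_affine[of "-1" "\<lambda>x. indicat_real {a..<b} x *\<^sub>R f x" T] by (simp add: ind)
  show "set_integrable lborel {a..<b} f \<longleftrightarrow> set_integrable lborel {T - b<..T - a} (\<lambda>u. f (T - u))"
    unfolding set_integrable_def
    using lborel_integrable_real_affine_iff[of "-1" "\<lambda>x. indicat_real {a..<b} x *\<^sub>R f x" T] by (simp add: ind)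
qed

lemma nat_floor_grid:
  assumes "0 < h" "real k * h \<le> s" "s < real (Suc k) * h"
  shows "nat \<lfloor>s / h\<rfloor> = k"
proof -
  have "\<lfloor>s / h\<rfloor> = int k"
    by (rule floor_unique) (use assms in \<open>auto simp: field_simps\<close>)
  then show ?thesis by simp
qed

lemma step_integral:
  fixes b :: "nat \<Rightarrow> real^'n^'n"
  assumes h: "0 < h"
  shows "set_integrable lborel {0..<real n * h} (\<lambda>s. b (nat \<lfloor>s / h\<rfloor>)) \<and>
    (LINT s:{0..<real n * h}|lborel. b (nat \<lfloor>s / h\<rfloor>)) = h *\<^sub>R (\<Sum>j<n. b j)"
proof (induction n)
  case 0
  then show ?case by (simp add: set_integrable_def set_lebesgue_integral_def)
next
  case (Suc n)
  let ?I = "{real n * h..<real (Suc n) * h}" and ?f = "\<lambda>s. b (nat \<lfloor>s / h\<rfloor>)"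
  have nh: "0 \<le> real n * h" "real n * h \<le> real (Suc n) * h"
    using h by (simp_all add: mult_right_mono)
  have un: "{0..<real (Suc n) * h} = {0..<real n * h} \<union> ?I" and dis: "{0..<real n * h} \<inter> ?I = {}"
    using nh by auto
  have c: "indicat_real ?I s *\<^sub>R ?f s = indicat_real ?I s *\<^sub>R b n" for s
    using nat_floor_grid[OF h, of n s] by (auto simp: indicator_def)
  have i: "set_integrable lborel ?I ?f" unfolding set_integrable_def c using h by simp
  have v: "(LINT s:?I|lborel. ?f s) = h *\<^sub>R b n"
    unfolding set_lebesgue_integral_def c using h by (simp add: algebra_simps)
  show ?case
    unfolding un using Suc i v set_integral_Un[OF dis conjunct1[OF Suc] i]
    by (simp add: set_integrable_Un scaleR_add_right del: of_nat_Suc)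
qed

text \<open>For \<open>u\<close> in \<open>{i h<..(i + 1) h}\<close> the argument
  \<open>n h - u\<close> lies in \<open>{(n - i - 1) h..<(n - i) h}\<close>, so the step function
  has index \<open>n - Suc i\<close> there. The half-open ends match, hence an exact
  equality.\<close>

lemma cell_step_integral:
  fixes F :: "real \<Rightarrow> real^'n^'n" and b :: "nat \<Rightarrow> real^'n^'n"
  assumes h: "0 < h" and F: "\<And>x. set_integrable lborel {0<..x} F" and "i \<le> n"
  shows "set_integrable lborel {0<..real i * h} (\<lambda>u. F u ** b (nat \<lfloor>(real n * h - u) / h\<rfloor>)) \<and>
    (LINT u:{0<..real i * h}|lborel. F u ** b (nat \<lfloor>(real n * h - u) / h\<rfloor>)) = (\<Sum>j<i. cell F h j ** b (n - Suc j))"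
  using \<open>i \<le> n\<close>
proof (induction i)
  case 0
  then show ?case by (simp add: set_integrable_def set_lebesgue_integral_def)
next
  case (Suc i)
  let ?I = "{real i * h<..real (Suc i) * h}" and ?f = "\<lambda>u. F u ** b (nat \<lfloor>(real n * h - u) / h\<rfloor>)"
  have nh: "0 \<le> real i * h" "real i * h \<le> real (Suc i) * h"
    using h by (simp_all add: mult_right_mono)
  have un: "{0<..real (Suc i) * h} = {0<..real i * h} \<union> ?I" and dis: "{0<..real i * h} \<inter> ?I = {}"
    using nh by auto
  have c: "indicat_real ?I u *\<^sub>R ?f u = (indicat_real ?I u *\<^sub>R F u) ** b (n - Suc i)" for u
  proof (cases "u \<in> ?I")
    case True
    have "nat \<lfloor>(real n * h - u) / h\<rfloor> = n - Suc i"
      by (rule nat_floor_grid[OF h]) (use True Suc.prems in \<open>auto simp: of_nat_diff algebra_simps\<close>)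
    then show ?thesis by (simp add: mm.scaleR_left)
  qed (simp add: mm.zero_left)
  have Fi: "integrable lborel (\<lambda>u. indicat_real ?I u *\<^sub>R F u)"
    unfolding set_integrable_def[symmetric]
    by (rule set_integrable_subset[OF F[of "real (Suc i) * h"]]) (use nh in auto)
  have i: "set_integrable lborel ?I ?f" unfolding set_integrable_def c
    by (rule integrable_bounded_linear[OF mm.bounded_linear_left Fi])
  have v: "(LINT s:?I|lborel. ?f s) = cell F h i ** b (n - Suc i)"
  proof -
    have "(LINT s:?I|lborel. ?f s) = (\<integral>u. indicat_real ?I u *\<^sub>R F u \<partial>lborel) ** b (n - Suc i)"
      unfolding set_lebesgue_integral_def c
      by (rule integral_bounded_linear[OF mm.bounded_linear_left Fi])
    also have "(\<integral>u. indicat_real ?I u *\<^sub>R F u \<partial>lborel) = (\<integral>s. indicat_real ?I (real i * h + s) *\<^sub>R F (real i * h + s) \<partial>lborel)"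
      using lborel_integral_real_affine[of 1 "\<lambda>u. indicat_real ?I u *\<^sub>R F u" "real i * h"] by simp
    also have "\<dots> = cell F h i"
      unfolding cell_def set_lebesgue_integral_def
      by (intro Bochner_Integration.integral_cong refl) (auto simp: indicator_def algebra_simps)
    finally show ?thesis .
  qed
  have ih: "set_integrable lborel {0<..real i * h} ?f \<and> (LINT u:{0<..real i * h}|lborel. ?f u) = (\<Sum>j<i. cell F h j ** b (n - Suc j))"
    using Suc by simp
  show ?case
    unfolding un using ih i v set_integral_Un[OF dis conjunct1[OF ih] i]
    by (simp add: set_integrable_Un del: of_nat_Suc)
qed

section \<open>Existence of the reciprocal kernel\<close>

lemma set_integral_mono_set_nonneg:
  fixes f :: "'a \<Rightarrow> real"
  assumes f: "set_integrable M B f" and A: "A \<in> sets M" "A \<subseteq> B" and nn: "\<And>x. x \<in> B \<Longrightarrow> 0 \<le> f x"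
  shows "(LINT x:A|M. f x) \<le> (LINT x:B|M. f x)"
  unfolding set_lebesgue_integral_def
proof (rule integral_mono)
  show "integrable M (\<lambda>x. indicat_real A x *\<^sub>R f x)"
    using set_integrable_subset[OF f A] by (simp add: set_integrable_def)
  show "integrable M (\<lambda>x. indicat_real B x *\<^sub>R f x)" using f by (simp add: set_integrable_def)
  show "indicat_real A x *\<^sub>R f x \<le> indicat_real B x *\<^sub>R f x" for x
    using A(2) nn[of x] by (auto simp: indicator_def)
qed

lemma set_integrable_trace:
  fixes Q :: "'a \<Rightarrow> real^'n^'n"
  assumes "set_integrable M A Q"
  shows "set_integrable M A (\<lambda>x. trace (Q x))"
  using integrable_bounded_linear[OF bounded_linear_trace assms[unfolded set_integrable_def]]
  by (simp add: set_integrable_def trace_scaleR)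

lemma set_borel_measurable_continuous:
  fixes f :: "real \<Rightarrow> 'a::euclidean_space"
  assumes "continuous_on A f" "A \<in> sets borel"
  shows "set_borel_measurable lborel A f"
  using borel_measurable_continuous_on_indicator[OF assms(2,1)] by (simp add: set_borel_measurable_def)

text \<open>\<open>d1\<close> comes from the blow-up with constant 1; it makes the first cell
  invertible and supplies the coarse mass bound \<open>CARD('n)\<close> used away from 0.\<close>

locale singular_kernel =
  fixes F :: "real \<Rightarrow> real^'n^'n" and d1 :: real
  assumes F: "LICM F" and bu: "blows_up F" and d1: "0 < d1"
    and coercive: "\<And>t v. 0 < t \<Longrightarrow> t \<le> d1 \<Longrightarrow> 1 * (v \<bullet> v) \<le> v \<bullet> (F t *v v)"
begin

text \<open>The offset 2 gives \<open>h m \<le> d1 / 2\<close>, so the first cell lies in the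
  coercive range and a spare mesh fits beside times up to \<open>d1 / 2\<close>.\<close>

definition h :: "nat \<Rightarrow> real" where "h m = d1 / (real m + 2)"

definition g :: "nat \<Rightarrow> nat \<Rightarrow> real^'n^'n" where "g m = recip_seq (cell F (h m))"

lemma F_cm: "completely_monotone F"
  using F by (simp add: LICM_def)

lemma h_pos: "0 < h m"
  using d1 by (simp add: h_def)

lemma h_le: "h m \<le> d1 / 2"
  unfolding h_def using d1 by (intro divide_left_mono) auto

lemma h_lim: "h \<longlonglongrightarrow> 0"
proof -
  have "filterlim (\<lambda>m. 2 + real m) at_top sequentially"
    by (rule filterlim_tendsto_add_at_top[OF tendsto_const filterlim_real_sequentially])
  then show ?thesis
    unfolding h_def[abs_def] add.commute[of "real _" 2] by (rule real_tendsto_divide_at_top[OF tendsto_const])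
qed

lemma cell_invertible: "invertible (cell F (h m) 0)"
proof (rule coercive_imp_invertible[OF h_pos])
  fix v
  have "psd (cell F (h m) 0 - mat (h m * 1))"
    using h_le[of m] h_pos[of m] by (intro cell_lower_bound[OF F h_pos, of 0 m "h m"] coercive) auto
  then show "h m * (v \<bullet> v) \<le> v \<bullet> (cell F (h m) 0 *v v)"
    using psd_nonneg[of "cell F (h m) 0 - mat (h m * 1)" v]
    by (simp add: form_diff mat_eq_scaleR[of "h m"] form_scaleR)
qed

lemma g_cmseq: "cmseq (\<lambda>k. g m (Suc k))" and g_psd: "psd (g m k)"
  unfolding g_def using recip_seq_cm[OF cmseq_cell[OF F h_pos] cell_invertible] by blast+

lemma g_trace_decreasing: "i \<le> j \<Longrightarrow> trace (g m j) \<le> trace (g m i)"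
proof (induction rule: dec_induct)
  case (step k)
  have "psd (g m k - g m (Suc k))"
  proof (cases k)
    case 0
    then show ?thesis unfolding g_def using recip_seq_cm(2)[OF cmseq_cell[OF F h_pos] cell_invertible] by simp
  next
    case (Suc l)
    then show ?thesis using cmseq_psd[OF cmseq_diff[OF g_cmseq], of m l] by simp
  qed
  then show ?case using psd_trace_nonneg step.IH by (fastforce simp: trace_diff)
qed simp

lemma g_conv: "(\<Sum>j<Suc k. cell F (h m) j ** g m (Suc k - Suc j)) = mat 1"
proof -
  have "(\<Sum>j<Suc k. cell F (h m) j ** g m (Suc k - Suc j)) = (\<Sum>j<Suc k. cell F (h m) (Suc k - Suc j) ** g m (Suc k - Suc (Suc k - Suc j)))"
    by (rule sum.nat_diff_reindex[symmetric])
  also have "\<dots> = (\<Sum>j\<le>k. cell F (h m) (k - j) ** g m j)"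
    by (rule sum.cong) auto
  also have "\<dots> = mat 1"
    unfolding g_def by (rule recip_seq_conv[of "cell F (h m)", OF cell_invertible])
  finally show ?thesis .
qed

lemma g_sum_le:
  assumes c: "0 < c" and co: "\<And>t v. 0 < t \<Longrightarrow> t \<le> d \<Longrightarrow> c * (v \<bullet> v) \<le> v \<bullet> (F t *v v)"
    and k: "real (Suc k) * h m \<le> d"
  shows "h m * (\<Sum>j\<le>k. trace (g m j)) \<le> real CARD('n) / c"
proof -
  have "h m * c * (\<Sum>j\<le>k. trace (recip_seq (cell F (h m)) j)) \<le> real CARD('n)"
    by (rule recip_cell_trace_bound[OF F h_pos cell_invertible co[OF _ k]]) (simp add: h_pos)
  then show ?thesis using c unfolding g_def by (simp add: field_simps)
qed

text \<open>Rounding \<open>x\<close> up to a grid point costs at most one mesh, which is why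
  \<open>x + h m\<close> must not exceed \<open>d\<close>.\<close>

lemma step_trace_le:
  assumes c: "0 < c" and co: "\<And>t v. 0 < t \<Longrightarrow> t \<le> d \<Longrightarrow> c * (v \<bullet> v) \<le> v \<bullet> (F t *v v)"
    and x: "0 \<le> x" "x + h m \<le> d"
  shows "set_integrable lborel {0..<x} (\<lambda>s. g m (nat \<lfloor>s / h m\<rfloor>))"
    and "(LINT s:{0..<x}|lborel. trace (g m (nat \<lfloor>s / h m\<rfloor>))) \<le> real CARD('n) / c"
proof -
  define k where "k = nat \<lfloor>x / h m\<rfloor>"
  have k: "real k \<le> x / h m" "x / h m < real k + 1"
    unfolding k_def using x h_pos[of m] by (auto simp: of_nat_nat)
  then have k': "x \<le> real (Suc k) * h m" "real (Suc k) * h m \<le> d"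
    using h_pos[of m] x by (auto simp: field_simps)
  have sub: "{0..<x} \<subseteq> {0..<real (Suc k) * h m}" using k' by auto
  have s: "set_integrable lborel {0..<real (Suc k) * h m} (\<lambda>s. g m (nat \<lfloor>s / h m\<rfloor>))"
    and v: "(LINT s:{0..<real (Suc k) * h m}|lborel. g m (nat \<lfloor>s / h m\<rfloor>)) = h m *\<^sub>R (\<Sum>j<Suc k. g m j)"
    using step_integral[OF h_pos, where n = "Suc k" and b = "g m"] by blast+
  show "set_integrable lborel {0..<x} (\<lambda>s. g m (nat \<lfloor>s / h m\<rfloor>))"
    by (rule set_integrable_subset[OF s _ sub]) simp
  have "(LINT s:{0..<x}|lborel. trace (g m (nat \<lfloor>s / h m\<rfloor>))) \<le> (LINT s:{0..<real (Suc k) * h m}|lborel. trace (g m (nat \<lfloor>s / h m\<rfloor>)))"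
    by (rule set_integral_mono_set_nonneg[OF set_integrable_trace[OF s] _ sub]) (auto intro: psd_trace_nonneg g_psd)
  also have "\<dots> = trace (LINT s:{0..<real (Suc k) * h m}|lborel. g m (nat \<lfloor>s / h m\<rfloor>))"
    using integral_bounded_linear[OF bounded_linear_trace s[unfolded set_integrable_def]]
    by (simp add: set_lebesgue_integral_def trace_scaleR)
  also have "\<dots> = h m * (\<Sum>j\<le>k. trace (g m j))"
    unfolding v lessThan_Suc_atMost by (simp add: trace_scaleR trace_sum)
  also have "\<dots> \<le> real CARD('n) / c"
    by (rule g_sum_le[OF c co k'(2)])
  finally show "(LINT s:{0..<x}|lborel. trace (g m (nat \<lfloor>s / h m\<rfloor>))) \<le> real CARD('n) / c" .
qed

text \<open>The traces decrease along the grid, so \<open>s\<close> times the trace at time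
  \<open>s\<close> is at most the mass accumulated up to the end of that cell, hence at most the
  dimension. The cap \<open>d1 / 2\<close> leaves room for one more mesh in the coercive
  range.\<close>

lemma g_bounded:
  assumes "0 < t"
  shows "trace (g m (nat \<lfloor>t / h m\<rfloor>)) \<le> real CARD('n) / min t (d1 / 2)"
proof -
  define s where "s = min t (d1 / 2)"
  have s: "0 < s" using assms d1 by (simp add: s_def)
  define k where "k = nat \<lfloor>s / h m\<rfloor>"
  have k: "real k \<le> s / h m" "s / h m < real k + 1"
    unfolding k_def using s h_pos[of m] by (auto simp: of_nat_nat)
  have k': "s \<le> real (Suc k) * h m" "real (Suc k) * h m \<le> d1"
    using k h_pos[of m] h_le[of m] s_def by (auto simp: field_simps)
  have "trace (g m (nat \<lfloor>t / h m\<rfloor>)) \<le> trace (g m k)"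
    unfolding k_def using h_pos[of m]
    by (intro g_trace_decreasing nat_mono floor_mono divide_right_mono) (auto simp: s_def)
  moreover have "s * trace (g m k) \<le> real (Suc k) * h m * trace (g m k)"
    using k' psd_trace_nonneg[OF g_psd] by (intro mult_right_mono) auto
  moreover have "\<dots> = h m * (\<Sum>j\<le>k. trace (g m k))" by simp
  moreover have "\<dots> \<le> h m * (\<Sum>j\<le>k. trace (g m j))"
    using h_pos[of m] by (intro mult_left_mono sum_mono g_trace_decreasing) auto
  moreover have "\<dots> \<le> real CARD('n) / 1"
    by (rule g_sum_le[OF zero_less_one coercive k'(2)])
  ultimately have "trace (g m (nat \<lfloor>t / h m\<rfloor>)) \<le> trace (g m k)" "s * trace (g m k) \<le> real CARD('n)"
    by linarith+
  moreover have "trace (g m k) \<le> real CARD('n) / s"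
    using calculation(2) s by (simp add: field_simps)
  ultimately show ?thesis unfolding s_def by linarith
qed

sublocale cm_approx g h
proof
  show "\<exists>B. \<forall>\<^sub>F m in sequentially. trace (g m (nat \<lfloor>t / h m\<rfloor>)) \<le> B" if "0 < t" for t
    using g_bounded[OF that] by (intro exI[of _ "real CARD('n) / min t (d1 / 2)"] always_eventually allI)
qed (fact h_pos h_lim g_cmseq)+

lemma g_norm_bounded:
  assumes "0 < a" "a \<le> s"
  shows "norm (g m (nat \<lfloor>s / h m\<rfloor>)) \<le> real CARD('n) ^ 2 * (real CARD('n) / min a (d1 / 2))"
proof -
  have "norm (g m (nat \<lfloor>s / h m\<rfloor>)) \<le> real CARD('n) ^ 2 * trace (g m (nat \<lfloor>s / h m\<rfloor>))"
    by (rule psd_norm_le_trace[OF g_psd])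
  also have "trace (g m (nat \<lfloor>s / h m\<rfloor>)) \<le> trace (g m (nat \<lfloor>a / h m\<rfloor>))"
    using assms h_pos[of m] by (intro g_trace_decreasing nat_mono floor_mono divide_right_mono) auto
  also have "\<dots> \<le> real CARD('n) / min a (d1 / 2)" by (rule g_bounded[OF assms(1)])
  finally show ?thesis by simp
qed

context
  fixes r :: "nat \<Rightarrow> nat" and G :: "real \<Rightarrow> real^'n^'n"
  assumes r: "strict_mono r" and G: "completely_monotone G"
    and lim: "\<And>t s. 0 < t \<Longrightarrow> s \<longlonglongrightarrow> t \<Longrightarrow> (\<lambda>i. g (r i) (nat \<lfloor>s i / h (r i)\<rfloor>)) \<longlonglongrightarrow> G t"
begin

lemma hr_lim: "(\<lambda>i. h (r i)) \<longlonglongrightarrow> 0"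
  using LIMSEQ_subseq_LIMSEQ[OF h_lim r] by (simp add: o_def)

text \<open>Fatou's lemma for the traces of the step functions; integrability of \<open>G\<close>
  itself follows since the trace dominates the norm.\<close>

lemma G_trace_tail:
  assumes c: "0 < c" and d: "0 < d" and co: "\<And>t v. 0 < t \<Longrightarrow> t \<le> d \<Longrightarrow> c * (v \<bullet> v) \<le> v \<bullet> (F t *v v)"
  shows "set_integrable lborel {0<..d / 2} G"
    and "(LINT s:{0<..d / 2}|lborel. trace (G s)) \<le> real CARD('n) / c"
proof -
  let ?A = "{0<..d / 2}"
  have cont: "continuous_on ?A G"
    by (rule continuous_on_subset[OF completely_monotone_continuous[OF G]]) auto
  have Gm: "(\<lambda>s. indicat_real ?A s *\<^sub>R G s) \<in> borel_measurable borel"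
    by (rule borel_measurable_continuous_on_indicator[OF _ cont]) simp
  have "(\<lambda>s. trace (indicat_real ?A s *\<^sub>R G s)) \<in> borel_measurable borel"
    by (rule measurable_compose[OF Gm borel_measurable_continuous_onI[OF bounded_linear.continuous_on[OF bounded_linear_trace continuous_on_id]]])
  then have tm: "(\<lambda>s. indicat_real ?A s * trace (G s)) \<in> borel_measurable lborel"
    by (simp add: trace_scaleR)
  define u where "u i s = indicat_real ?A s * trace (g (r i) (nat \<lfloor>s / h (r i)\<rfloor>))" for i s
  have u0: "0 \<le> u i s" for i s using psd_trace_nonneg[OF g_psd] by (simp add: u_def)
  have um: "u i \<in> borel_measurable lborel" for i
  proof -
    have "(\<lambda>s. trace (g (r i) (nat \<lfloor>s / h (r i)\<rfloor>))) \<in> borel_measurable borel"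
      by measurable
    then show ?thesis unfolding u_def[abs_def] by measurable
  qed
  have "\<forall>\<^sub>F i in sequentially. (\<integral>\<^sup>+ s. ennreal (u i s) \<partial>lborel) \<le> ennreal (real CARD('n) / c)"
    using order_tendstoD(2)[OF hr_lim, of "d / 4", OF divide_pos_pos[OF d zero_less_numeral]]
  proof eventually_elim
    case (elim i)
    \<comment> \<open>The interval up to \<open>3 / 4 * d\<close> contains
      \<open>{0<..d / 2}\<close> and leaves \<open>d / 4\<close> for the spare mesh.\<close>
    have x: "0 \<le> 3 / 4 * d" "3 / 4 * d + h (r i) \<le> d" using elim d by auto
    note si = set_integrable_trace[OF step_trace_le(1)[OF c co x]]
    have "(\<integral>\<^sup>+ s. ennreal (u i s) \<partial>lborel) \<le>
        (\<integral>\<^sup>+ s. ennreal (indicat_real {0..<3 / 4 * d} s *\<^sub>R trace (g (r i) (nat \<lfloor>s / h (r i)\<rfloor>))) \<partial>lborel)"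
      using psd_trace_nonneg[OF g_psd] d
      by (intro nn_integral_mono ennreal_leI) (auto simp: u_def indicator_def)
    also have "\<dots> = ennreal (LINT s:{0..<3 / 4 * d}|lborel. trace (g (r i) (nat \<lfloor>s / h (r i)\<rfloor>)))"
      unfolding set_lebesgue_integral_def
      by (rule nn_integral_eq_integral[OF si[unfolded set_integrable_def]])
        (auto intro!: AE_I2 mult_nonneg_nonneg psd_trace_nonneg g_psd)
    also have "\<dots> \<le> ennreal (real CARD('n) / c)"
      by (rule ennreal_leI[OF step_trace_le(2)[OF c co x]])
    finally show ?case .
  qed
  then have le: "liminf (\<lambda>i. \<integral>\<^sup>+ s. ennreal (u i s) \<partial>lborel) \<le> ennreal (real CARD('n) / c)"
    by (intro order_trans[OF Liminf_le_Limsup Limsup_bounded]) auto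
  have ul: "(\<lambda>i. ennreal (u i s)) \<longlonglongrightarrow> ennreal (indicat_real ?A s * trace (G s))" for s
  proof (cases "s \<in> ?A")
    case True
    then have "(\<lambda>i. g (r i) (nat \<lfloor>s / h (r i)\<rfloor>)) \<longlonglongrightarrow> G s" by (intro lim[of s "\<lambda>_. s"]) auto
    then have "(\<lambda>i. trace (g (r i) (nat \<lfloor>s / h (r i)\<rfloor>))) \<longlonglongrightarrow> trace (G s)"
      by (rule bounded_linear.tendsto[OF bounded_linear_trace])
    then show ?thesis using True by (simp add: u_def)
  qed (simp add: u_def)
  have "(\<integral>\<^sup>+ s. ennreal (indicat_real ?A s * trace (G s)) \<partial>lborel) = (\<integral>\<^sup>+ s. liminf (\<lambda>i. ennreal (u i s)) \<partial>lborel)"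
    using lim_imp_Liminf[OF _ ul] by simp
  also have "\<dots> \<le> liminf (\<lambda>i. \<integral>\<^sup>+ s. ennreal (u i s) \<partial>lborel)"
    by (rule nn_integral_liminf) (use um in measurable)
  finally have nn: "(\<integral>\<^sup>+ s. ennreal (indicat_real ?A s * trace (G s)) \<partial>lborel) \<le> ennreal (real CARD('n) / c)"
    using le by simp
  have pos: "0 \<le> indicat_real ?A s * trace (G s)" for s
    using psd_trace_nonneg[OF completely_monotone_psd[OF G]] by (auto simp: indicator_def)
  have ti: "integrable lborel (\<lambda>s. indicat_real ?A s * trace (G s))"
    by (rule integrableI_nonneg[OF tm]) (use pos nn in \<open>auto simp: order_le_less_trans\<close>)
  show "set_integrable lborel ?A G"
    unfolding set_integrable_def
  proof (rule Bochner_Integration.integrable_bound)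
    show "integrable lborel (\<lambda>s. real CARD('n) ^ 2 * (indicat_real ?A s * trace (G s)))"
      using ti by (rule integrable_mult_right)
    show "(\<lambda>s. indicat_real ?A s *\<^sub>R G s) \<in> borel_measurable lborel" using Gm by simp
    show "AE s in lborel. norm (indicat_real ?A s *\<^sub>R G s) \<le> norm (real CARD('n) ^ 2 * (indicat_real ?A s * trace (G s)))"
      using psd_norm_le_trace[OF completely_monotone_psd[OF G]] psd_trace_nonneg[OF completely_monotone_psd[OF G]]
      by (intro AE_I2) (auto simp: indicator_def)
  qed
  have "ennreal (LINT s:?A|lborel. trace (G s)) \<le> ennreal (real CARD('n) / c)"
    using nn nn_integral_eq_integral[OF ti] pos by (simp add: set_lebesgue_integral_def)
  then show "(LINT s:?A|lborel. trace (G s)) \<le> real CARD('n) / c"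
    using c by (simp add: ennreal_le_iff)
qed

lemma G_LICM: "LICM G"
proof -
  have "continuous_on {d1 / 2..max 1 (d1 / 2)} G"
    by (rule continuous_on_subset[OF completely_monotone_continuous[OF G]]) (use d1 in auto)
  then have "set_integrable lborel {d1 / 2..max 1 (d1 / 2)} G" by (rule borel_integrable_atLeastAtMost')
  then have "set_integrable lborel ({0<..d1 / 2} \<union> {d1 / 2..max 1 (d1 / 2)}) G"
    using G_trace_tail(1)[OF zero_less_one d1 coercive] by (intro set_integrable_Un) auto
  then have "set_integrable lborel {0<..1} G" by (rule set_integrable_subset) auto
  then show ?thesis using G by (simp add: LICM_def)
qed

text \<open>The interval is cut at \<open>t - e\<close>. To the left the products converge by
  dominated convergence, since the step functions are bounded there. To the right \<open>F\<close>
  is bounded by \<open>b\<close>, and both \<open>G\<close> and the step functions have trace mass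
  at most \<open>CARD('n) / c\<close>: one error for each, hence the factor 2.\<close>

lemma conv_estimate:
  assumes t: "0 < t" and c: "0 < c" and d: "0 < d" "d \<le> t"
    and co: "\<And>t v. 0 < t \<Longrightarrow> t \<le> d \<Longrightarrow> c * (v \<bullet> v) \<le> v \<bullet> (F t *v v)"
  shows "norm (mat 1 - (LINT u:{0<..<t}|lborel. F u ** G (t - u)))
      \<le> 2 * (real CARD('n) ^ 2 * trace (F (t / 2)) * real CARD('n) ^ 2 * real CARD('n)) / c"
proof -
  define e where "e = d / 2"
  define b where "b = real CARD('n) ^ 2 * trace (F (t / 2))"
  have e: "0 < e" "e \<le> t / 2" using d by (auto simp: e_def)
  have b: "norm (F u) \<le> b" if "t / 2 \<le> u" for u
    unfolding b_def using t that by (intro completely_monotone_norm_le[OF F_cm]) auto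
  have b0: "0 \<le> b" using b[of t] t norm_ge_zero[of "F t"] by linarith
  let ?A = "{0<..t - e}" and ?B = "{t - e<..<t}"
  have split: "{0<..<t} = ?A \<union> ?B" "?A \<inter> ?B = {}" using e t by auto
  have Fcont: "continuous_on S F" if "S \<subseteq> {0<..}" for S
    by (rule continuous_on_subset[OF completely_monotone_continuous[OF F_cm] that])
  have Gcont: "continuous_on S (\<lambda>u. G (t - u))" if "S \<subseteq> {..<t}" for S
    by (rule continuous_on_compose2[OF completely_monotone_continuous[OF G]])
      (use that in \<open>auto intro!: continuous_intros\<close>)
  have iA: "set_integrable lborel ?A (\<lambda>u. F u ** G (t - u))"
  proof (rule set_integrable_mult_bounded_right[OF LICM_set_integrable[OF F]])
    show "set_borel_measurable lborel ?A (\<lambda>u. G (t - u))"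
      using e by (intro set_borel_measurable_continuous Gcont) auto
    show "norm (G (t - u)) \<le> real CARD('n) ^ 2 * trace (G e)" if "u \<in> ?A" for u
      using that e by (intro completely_monotone_norm_le[OF G]) auto
  qed
  have refl: "indicat_real ?B (t + - 1 * s) = indicat_real {0<..<e} s" for s by (auto simp: indicator_def)
  have Gi: "set_integrable lborel {0<..<e} G"
    by (rule set_integrable_subset[OF G_trace_tail(1)[OF c d(1) co]]) (auto simp: e_def)
  have GB: "set_integrable lborel ?B (\<lambda>u. G (t - u))"
    using lborel_integrable_real_affine_iff[of "-1" "\<lambda>u. indicat_real ?B u *\<^sub>R G (t - u)" t] Gi
    unfolding set_integrable_def refl by simp
  have FB: "set_borel_measurable lborel ?B F"
    using e t by (intro set_borel_measurable_continuous Fcont) auto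
  have iB: "set_integrable lborel ?B (\<lambda>u. F u ** G (t - u))"
    by (rule set_integrable_mult_bounded_left[OF FB GB b]) (use e in auto)
  have nB: "norm (LINT u:?B|lborel. F u ** G (t - u)) \<le> b * real CARD('n) ^ 2 * (real CARD('n) / c)"
  proof -
    have "norm (LINT u:?B|lborel. F u ** G (t - u)) \<le> b * real CARD('n) ^ 2 * (LINT u:?B|lborel. trace (G (t - u)))"
      by (rule norm_set_integral_mult_psd_le[OF FB GB b _ b0]) (use e completely_monotone_psd[OF G] in auto)
    also have "(LINT u:?B|lborel. trace (G (t - u))) = (LINT s:{0<..<e}|lborel. trace (G s))"
      using lborel_integral_real_affine[of "-1" "\<lambda>u. indicat_real ?B u *\<^sub>R trace (G (t - u))" t]
      unfolding set_lebesgue_integral_def refl by simp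
    also have "\<dots> \<le> (LINT s:{0<..e}|lborel. trace (G s))"
      by (rule set_integral_mono_set_nonneg[OF set_integrable_trace])
        (use G_trace_tail(1)[OF c d(1) co] psd_trace_nonneg[OF completely_monotone_psd[OF G]] in \<open>auto simp: e_def\<close>)
    also have "\<dots> \<le> real CARD('n) / c"
      using G_trace_tail(2)[OF c d(1) co] by (simp add: e_def)
    finally show ?thesis using b0 by (simp add: mult_left_mono)
  qed
  \<comment> \<open>The grid point following \<open>t\<close>: there the discrete equation holds
    exactly, and it tends to \<open>t\<close>.\<close>
  define T where "T i = real (Suc (ix (r i) t)) * h (r i)" for i
  have T: "t \<le> T i" "T i \<le> t + h (r i)" for i
    using ix_bounds[of t "r i"] t by (auto simp: T_def algebra_simps)
  have Tlim: "T \<longlonglongrightarrow> t"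
    by (rule tendsto_sandwich[OF _ _ tendsto_const tendsto_add[OF tendsto_const hr_lim, of t, simplified]])
      (use T in auto)
  let ?q = "\<lambda>i u. g (r i) (nat \<lfloor>(T i - u) / h (r i)\<rfloor>)"
  have full: "set_integrable lborel {0<..T i} (\<lambda>u. F u ** ?q i u)"
    "(LINT u:{0<..T i}|lborel. F u ** ?q i u) = mat 1" for i
    using cell_step_integral[OF h_pos LICM_set_integrable[OF F], of "Suc (ix (r i) t)" "Suc (ix (r i) t)" "r i" "g (r i)"]
    unfolding T_def[symmetric] g_conv by auto
  have qm: "?q i \<in> borel_measurable borel" for i by measurable
  have PA: "(\<lambda>i. LINT u:?A|lborel. F u ** ?q i u) \<longlonglongrightarrow> (LINT u:?A|lborel. F u ** G (t - u))"
    unfolding set_lebesgue_integral_def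
  proof (rule integral_dominated_convergence)
    let ?b = "real CARD('n) ^ 2 * (real CARD('n) / min e (d1 / 2))"
    have FA: "integrable lborel (\<lambda>u. indicat_real ?A u *\<^sub>R F u)"
      using LICM_set_integrable[OF F] by (simp add: set_integrable_def)
    then have Fm: "(\<lambda>u. indicat_real ?A u *\<^sub>R F u) \<in> borel_measurable lborel" by auto
    show "integrable lborel (\<lambda>u. norm (indicat_real ?A u *\<^sub>R F u) * ?b)"
      by (rule integrable_mult_left[OF integrable_norm[OF FA]])
    show "(\<lambda>u. indicat_real ?A u *\<^sub>R (F u ** G (t - u))) \<in> borel_measurable lborel"
      using iA by (auto simp: set_integrable_def)
    show "(\<lambda>u. indicat_real ?A u *\<^sub>R (F u ** ?q i u)) \<in> borel_measurable lborel" for i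
    proof -
      have "(\<lambda>u. (indicat_real ?A u *\<^sub>R F u) ** ?q i u) \<in> borel_measurable lborel"
        using Fm qm[of i] by (intro borel_measurable_matrix_mult) auto
      then show ?thesis by (simp add: mm.scaleR_left)
    qed
    show "AE u in lborel. (\<lambda>i. indicat_real ?A u *\<^sub>R (F u ** ?q i u)) \<longlonglongrightarrow> indicat_real ?A u *\<^sub>R (F u ** G (t - u))"
    proof (rule AE_I2)
      fix u
      show "(\<lambda>i. indicat_real ?A u *\<^sub>R (F u ** ?q i u)) \<longlonglongrightarrow> indicat_real ?A u *\<^sub>R (F u ** G (t - u))"
      proof (cases "u \<in> ?A")
        case True
        then have "(\<lambda>i. ?q i u) \<longlonglongrightarrow> G (t - u)"
          using e by (intro lim tendsto_diff Tlim tendsto_const) auto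
        then show ?thesis by (intro tendsto_intros mm.tendsto)
      qed simp
    qed
    show "AE u in lborel. norm (indicat_real ?A u *\<^sub>R (F u ** ?q i u)) \<le> norm (indicat_real ?A u *\<^sub>R F u) * ?b" for i
    proof (rule AE_I2)
      fix u
      show "norm (indicat_real ?A u *\<^sub>R (F u ** ?q i u)) \<le> norm (indicat_real ?A u *\<^sub>R F u) * ?b"
      proof (cases "u \<in> ?A")
        case True
        have "norm (F u ** ?q i u) \<le> norm (F u) * norm (?q i u)" by (rule norm_matrix_mult_le)
        also have "\<dots> \<le> norm (F u) * ?b"
          using True T[of i] e by (intro mult_left_mono g_norm_bounded) auto
        finally show ?thesis using True by simp
      qed simp
    qed
  qed
  have "\<forall>\<^sub>F i in sequentially. norm (mat 1 - (LINT u:?A|lborel. F u ** ?q i u)) \<le> b * real CARD('n) ^ 2 * (real CARD('n) / c)"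
    using order_tendstoD(2)[OF hr_lim, of "d / 4", OF divide_pos_pos[OF d(1) zero_less_numeral]]
  proof eventually_elim
    case (elim i)
    let ?C = "{t - e<..T i}"
    have sp: "{0<..T i} = ?A \<union> ?C" "?A \<inter> ?C = {}" using e T[of i] by auto
    \<comment> \<open>\<open>T i - t\<close> and \<open>h (r i)\<close> are below
      \<open>d / 4\<close>, and \<open>e = d / 2\<close>; the sum is at most
      \<open>d\<close>.\<close>
    have x: "0 \<le> T i - t + e" "T i - t + e + h (r i) \<le> d"
      using T[of i] e elim by (auto simp: e_def)
    note st = step_trace_le[OF c co x]
    have qC: "set_integrable lborel ?C (\<lambda>u. ?q i u)"
      using st(1) set_integral_reflect(2)[of 0 "T i - t + e" "\<lambda>s. g (r i) (nat \<lfloor>s / h (r i)\<rfloor>)" "T i"] by simp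
    have FC: "set_borel_measurable lborel ?C F"
      using e t by (intro set_borel_measurable_continuous Fcont) auto
    have "mat 1 = (LINT u:?A|lborel. F u ** ?q i u) + (LINT u:?C|lborel. F u ** ?q i u)"
      unfolding full(2)[of i, symmetric] sp(1)
      by (rule set_integral_Un[OF sp(2)]) (rule set_integrable_subset[OF full(1)[of i]]; use e T[of i] in auto)+
    then have "norm (mat 1 - (LINT u:?A|lborel. F u ** ?q i u)) = norm (LINT u:?C|lborel. F u ** ?q i u)" by simp
    also have "\<dots> \<le> b * real CARD('n) ^ 2 * (LINT u:?C|lborel. trace (?q i u))"
      by (rule norm_set_integral_mult_psd_le[OF FC qC b g_psd b0]) (use e in auto)
    also have "(LINT u:?C|lborel. trace (?q i u)) = (LINT s:{0..<T i - t + e}|lborel. trace (g (r i) (nat \<lfloor>s / h (r i)\<rfloor>)))"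
      using set_integral_reflect(1)[of 0 "T i - t + e" "\<lambda>s. trace (g (r i) (nat \<lfloor>s / h (r i)\<rfloor>))" "T i"] by simp
    also have "\<dots> \<le> real CARD('n) / c" by (rule st(2))
    finally show ?case using b0 by (simp add: mult_left_mono)
  qed
  then have nA: "norm (mat 1 - (LINT u:?A|lborel. F u ** G (t - u))) \<le> b * real CARD('n) ^ 2 * (real CARD('n) / c)"
    by (intro tendsto_upperbound[OF tendsto_norm[OF tendsto_diff[OF tendsto_const PA]]]) auto
  have "(LINT u:{0<..<t}|lborel. F u ** G (t - u)) = (LINT u:?A|lborel. F u ** G (t - u)) + (LINT u:?B|lborel. F u ** G (t - u))"
    unfolding split(1) by (rule set_integral_Un[OF split(2) iA iB])
  then have "norm (mat 1 - (LINT u:{0<..<t}|lborel. F u ** G (t - u)))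
      \<le> norm (mat 1 - (LINT u:?A|lborel. F u ** G (t - u))) + norm (LINT u:?B|lborel. F u ** G (t - u))"
    using norm_triangle_ineq4[of "mat 1 - (LINT u:?A|lborel. F u ** G (t - u))" "LINT u:?B|lborel. F u ** G (t - u)"]
    by (simp add: diff_diff_eq)
  also have "\<dots> \<le> b * real CARD('n) ^ 2 * (real CARD('n) / c) + b * real CARD('n) ^ 2 * (real CARD('n) / c)"
    by (rule add_mono[OF nA nB])
  also have "\<dots> = 2 * (b * real CARD('n) ^ 2 * real CARD('n)) / c"
    by (simp add: field_simps)
  finally show "norm (mat 1 - (LINT u:{0<..<t}|lborel. F u ** G (t - u)))
      \<le> 2 * (real CARD('n) ^ 2 * trace (F (t / 2)) * real CARD('n) ^ 2 * real CARD('n)) / c"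
    unfolding b_def .
qed

text \<open>The numerator in \<open>conv_estimate\<close> does not depend on \<open>c\<close>, and
  the blow-up provides a range \<open>d\<close> for each \<open>c\<close>; letting \<open>c\<close>
  grow removes the error.\<close>

lemma conv_eq_mat_1:
  assumes t: "0 < t"
  shows "(LINT u:{0<..<t}|lborel. F u ** G (t - u)) = mat 1"
proof -
  define C where "C = 2 * (real CARD('n) ^ 2 * trace (F (t / 2)) * real CARD('n) ^ 2 * real CARD('n))"
  have C: "0 \<le> C"
    unfolding C_def using psd_trace_nonneg[OF completely_monotone_psd[OF F_cm, of "t / 2"]] t by simp
  have est: "norm (mat 1 - (LINT u:{0<..<t}|lborel. F u ** G (t - u))) \<le> C / c" if c: "0 < c" for c
  proof -
    obtain d where d: "0 < d" "\<And>t v. 0 < t \<Longrightarrow> t \<le> d \<Longrightarrow> c * (v \<bullet> v) \<le> v \<bullet> (F t *v v)"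
      using blows_upE[OF bu c] by blast
    have m: "0 < min d t" "min d t \<le> t" using d(1) t by simp_all
    have co: "c * (v \<bullet> v) \<le> v \<bullet> (F s *v v)" if "0 < s" "s \<le> min d t" for s v
      using d(2)[of s v] that by simp
    show "norm (mat 1 - (LINT u:{0<..<t}|lborel. F u ** G (t - u))) \<le> C / c"
      unfolding C_def by (rule conv_estimate[OF t c m co])
  qed
  have "norm (mat 1 - (LINT u:{0<..<t}|lborel. F u ** G (t - u))) \<le> 0"
  proof (rule field_le_epsilon)
    fix e :: real assume e: "0 < e"
    \<comment> \<open>The summand 1 keeps this value of \<open>c\<close> positive even if
      \<open>C = 0\<close>.\<close>
    have "norm (mat 1 - (LINT u:{0<..<t}|lborel. F u ** G (t - u))) \<le> C / ((C + 1) / e)"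
      using e C by (intro est) auto
    also have "\<dots> \<le> 0 + e" using e C by (simp add: field_simps)
    finally show "norm (mat 1 - (LINT u:{0<..<t}|lborel. F u ** G (t - u))) \<le> 0 + e" .
  qed
  then show "(LINT u:{0<..<t}|lborel. F u ** G (t - u)) = mat 1" by simp
qed

end

end

theorem LICM_reciprocal_exists:
  fixes F :: "real \<Rightarrow> real^'n^'n"
  assumes F: "LICM F" and bu: "blows_up F"
  obtains G where "LICM G"
    "\<And>t. 0 < t \<Longrightarrow> (LINT u:{0<..<t}|lborel. F u ** G (t - u)) = mat 1"
proof -
  obtain d1 where "0 < d1" "\<And>t v. 0 < t \<Longrightarrow> t \<le> d1 \<Longrightarrow> 1 * (v \<bullet> v) \<le> v \<bullet> (F t *v v)"
    using blows_upE[OF bu zero_less_one] by blast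
  then interpret singular_kernel F d1
    by unfold_locales (use F bu in auto)
  obtain r G where rG: "strict_mono r" "completely_monotone G"
    "\<And>t s. 0 < t \<Longrightarrow> s \<longlonglongrightarrow> t \<Longrightarrow> (\<lambda>i. g (r i) (nat \<lfloor>s i / h (r i)\<rfloor>)) \<longlonglongrightarrow> G t"
    using cm_limit by blast
  show thesis
    by (rule that[OF G_LICM[OF rG] conv_eq_mat_1[OF rG]])
qed

section \<open>Singularity of the reciprocal kernel\<close>

text \<open>Fubini and the substitution \<open>t = a + s\<close>. The weight
  \<open>p = mat 1\<close> gives the product rule for Laplace transforms;
  \<open>p t = Y (T - t)\<close>, cut to \<open>[0, T]\<close>, gives associativity of convolution
  in the uniqueness proof.\<close>

lemma integral_convolution:
  fixes f k p :: "real \<Rightarrow> real^'n^'n"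
  assumes f: "integrable lborel f" and k: "integrable lborel k"
    and p: "p \<in> borel_measurable borel" "\<And>t. norm (p t) \<le> c"
  shows "(\<integral>t. p t ** (\<integral>s. f (t - s) ** k s \<partial>lborel) \<partial>lborel) =
    (\<integral>s. (\<integral>a. p (a + s) ** f a \<partial>lborel) ** k s \<partial>lborel)"
proof -
  have [measurable]: "f \<in> borel_measurable borel" "k \<in> borel_measurable borel" "p \<in> borel_measurable borel"
    using f k p by auto
  define q where "q s t = f (t - s) ** k s" for s t
  have fs: "integrable lborel (\<lambda>t. f (t - s))" for s
    using lborel_integrable_real_affine[OF f, of 1 "-s"] by simp
  have qt: "integrable lborel (\<lambda>t. q s t)" for s
    unfolding q_def by (rule integrable_bounded_linear[OF mm.bounded_linear_left fs])
  have qmeas: "(\<lambda>(s, t). q s t) \<in> borel_measurable (lborel \<Otimes>\<^sub>M lborel)"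
    unfolding q_def split_beta by measurable
  have qi: "integrable (lborel \<Otimes>\<^sub>M lborel) (\<lambda>(s, t). q s t)"
  proof (rule lborel_pair.Fubini_integrable[OF qmeas])
    let ?I = "\<integral>t. norm (f t) \<partial>lborel"
    have bd: "(\<integral>t. norm (q s t) \<partial>lborel) \<le> ?I * norm (k s)" for s
    proof -
      have "(\<integral>t. norm (q s t) \<partial>lborel) \<le> (\<integral>t. norm (f (t - s)) * norm (k s) \<partial>lborel)"
        using qt[of s] fs[of s] norm_matrix_mult_le
        by (intro integral_mono) (auto simp: q_def)
      also have "\<dots> = ?I * norm (k s)"
        using lborel_integral_real_affine[of 1 "\<lambda>t. norm (f t)" "-s"] by simp
      finally show ?thesis .
    qed
    have [measurable]: "(\<lambda>s. \<integral>t. norm (q s t) \<partial>lborel) \<in> borel_measurable lborel"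
      using qmeas by (intro lborel.borel_measurable_lebesgue_integral) (simp add: split_beta)
    show "integrable lborel (\<lambda>s. \<integral>t. norm (case (s, t) of (s, t) \<Rightarrow> q s t) \<partial>lborel)"
    proof (rule Bochner_Integration.integrable_bound[of lborel "\<lambda>s. ?I * norm (k s)"])
      show "AE s in lborel. norm (\<integral>t. norm (case (s, t) of (s, t) \<Rightarrow> q s t) \<partial>lborel) \<le> norm (?I * norm (k s))"
        using order_trans[OF bd abs_ge_self] by (intro AE_I2) simp
    qed (use k in simp_all)
  qed (use qt in auto)
  have pqi: "integrable (lborel \<Otimes>\<^sub>M lborel) (\<lambda>x. p (snd x) ** (case x of (s, t) \<Rightarrow> q s t))"
    by (rule integrable_mult_bounded_left[OF _ qi p(2)]) measurable
  then have pqi': "integrable (lborel \<Otimes>\<^sub>M lborel) (\<lambda>(s, t). p t ** q s t)"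
    by (simp add: case_prod_unfold)
  have "(\<integral>t. p t ** (\<integral>s. f (t - s) ** k s \<partial>lborel) \<partial>lborel) = (\<integral>t. (\<integral>s. p t ** q s t \<partial>lborel) \<partial>lborel)"
  \<comment> \<open>The inner integrand is integrable for almost every \<open>t\<close> only, so
    \<open>p t\<close> moves inside only up to a null set.\<close>
  proof (rule integral_cong_AE)
    have "integrable (lborel \<Otimes>\<^sub>M lborel) (\<lambda>(t, s). q s t)"
      using lborel_pair.integrable_product_swap[OF qi] by (simp add: split_beta)
    then have "AE t in lborel. integrable lborel (\<lambda>s. q s t)"
      using lborel_pair.AE_integrable_fst' by fastforce
    then show "AE t in lborel. p t ** (\<integral>s. f (t - s) ** k s \<partial>lborel) = (\<integral>s. p t ** q s t \<partial>lborel)"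
      by eventually_elim (simp add: q_def integral_bounded_linear[OF mm.bounded_linear_right])
    show "(\<lambda>t. p t ** (\<integral>s. f (t - s) ** k s \<partial>lborel)) \<in> borel_measurable lborel"
      by measurable
    show "(\<lambda>t. \<integral>s. p t ** q s t \<partial>lborel) \<in> borel_measurable lborel"
      unfolding q_def by measurable
  qed
  also have "\<dots> = (\<integral>s. (\<integral>t. p t ** q s t \<partial>lborel) \<partial>lborel)"
    by (rule lborel_pair.Fubini_integral[OF pqi'])
  also have "\<dots> = (\<integral>s. (\<integral>a. p (a + s) ** f a \<partial>lborel) ** k s \<partial>lborel)"
  proof (rule Bochner_Integration.integral_cong[OF refl])
    fix s
    have "integrable lborel (\<lambda>t. p t ** f (t - s))"
      by (rule integrable_mult_bounded_left[OF _ fs p(2)]) measurable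
    then have "(\<integral>t. p t ** q s t \<partial>lborel) = (\<integral>t. p t ** f (t - s) \<partial>lborel) ** k s"
      unfolding q_def by (simp add: matrix_mul_assoc integral_bounded_linear[OF mm.bounded_linear_left])
    also have "(\<integral>t. p t ** f (t - s) \<partial>lborel) = (\<integral>a. p (a + s) ** f a \<partial>lborel)"
      using lborel_integral_real_affine[of 1 "\<lambda>t. p t ** f (t - s)" s] by (simp add: add.commute)
    finally show "(\<integral>t. p t ** q s t \<partial>lborel) = (\<integral>a. p (a + s) ** f a \<partial>lborel) ** k s" .
  qed
  finally show ?thesis .
qed

lemma exp_set_integral:
  fixes p :: real
  assumes p: "0 < p"
  shows "set_integrable lborel {0<..} (\<lambda>t. exp (- p * t))" and "(LINT t:{0<..}|lborel. exp (- p * t)) = 1 / p"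
proof -
  have lim: "((\<lambda>t. - exp (- p * t) / p) \<longlongrightarrow> 0) at_top"
  proof -
    have "filterlim (\<lambda>t. - p * t) at_bot at_top"
      using p by (intro filterlim_tendsto_neg_mult_at_bot[OF tendsto_const _ filterlim_ident]) auto
    then have "((\<lambda>t. exp (- p * t)) \<longlongrightarrow> 0) at_top"
      by (rule filterlim_compose[OF exp_at_bot])
    then have "((\<lambda>t. - exp (- p * t) / p) \<longlongrightarrow> - 0 / p) at_top" using p by (intro tendsto_intros) auto
    then show ?thesis by simp
  qed
  have "(\<integral>\<^sup>+ t. ennreal (exp (- p * t)) * indicator {0..} t \<partial>lborel) = ennreal (0 - (- exp (- p * 0) / p))"
    by (rule nn_integral_FTC_atLeast[OF _ _ _ lim]) (use p in \<open>auto intro!: derivative_eq_intros\<close>)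
  moreover have "(\<integral>\<^sup>+ t. ennreal (exp (- p * t)) * indicator {0..} t \<partial>lborel) = (\<integral>\<^sup>+ t. ennreal (indicat_real {0<..} t * exp (- p * t)) \<partial>lborel)"
    by (rule nn_integral_cong_AE, rule AE_mp[OF AE_lborel_singleton[of 0]])
      (auto simp: indicator_def)
  ultimately have nn: "(\<integral>\<^sup>+ t. ennreal (indicat_real {0<..} t * exp (- p * t)) \<partial>lborel) = ennreal (1 / p)" by simp
  then have i: "integrable lborel (\<lambda>t. indicat_real {0<..} t * exp (- p * t))"
    by (intro integrableI_nonneg) auto
  then show "set_integrable lborel {0<..} (\<lambda>t. exp (- p * t))" by (simp add: set_integrable_def)
  show "(LINT t:{0<..}|lborel. exp (- p * t)) = 1 / p"
    using nn_integral_eq_integral[OF i] nn p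
    by (simp add: set_lebesgue_integral_def ennreal_inj)
qed

text \<open>On \<open>{0<..1}\<close> the function is integrable by assumption; beyond 1 its norm is
  bounded in terms of \<open>trace (F 1)\<close>, so the exponential suffices.\<close>

lemma LICM_laplace:
  fixes F :: "real \<Rightarrow> real^'n^'n"
  assumes F: "LICM F" and p: "0 < p"
  shows "set_integrable lborel {0<..} (\<lambda>t. exp (- p * t) *\<^sub>R F t)"
proof -
  have cm: "completely_monotone F" using F by (simp add: LICM_def)
  define C where "C = real CARD('n) ^ 2 * trace (F 1)"
  have C: "0 \<le> C" unfolding C_def using psd_trace_nonneg[OF completely_monotone_psd[OF cm]] by simp
  show ?thesis
    unfolding set_integrable_def
  proof (rule Bochner_Integration.integrable_bound)
    have "integrable lborel (\<lambda>t. norm (indicat_real {0<..1} t *\<^sub>R F t))"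
      using F by (intro integrable_norm) (simp add: LICM_def set_integrable_def)
    moreover have "integrable lborel (\<lambda>t. C * (indicat_real {0<..} t *\<^sub>R exp (- p * t)))"
      using exp_set_integral(1)[OF p] by (intro integrable_mult_right) (simp only: set_integrable_def)
    ultimately show "integrable lborel (\<lambda>t. norm (indicat_real {0<..1} t *\<^sub>R F t) + C * (indicat_real {0<..} t *\<^sub>R exp (- p * t)))"
      by (rule Bochner_Integration.integrable_add)
    have "continuous_on {0<..} (\<lambda>t. exp (- p * t) *\<^sub>R F t)"
      using completely_monotone_continuous[OF cm] by (intro continuous_intros)
    from set_borel_measurable_continuous[OF this]
    show "(\<lambda>t. indicat_real {0<..} t *\<^sub>R (exp (- p * t) *\<^sub>R F t)) \<in> borel_measurable lborel"
      unfolding set_borel_measurable_def by (rule meta_mp) measurable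
    show "AE t in lborel. norm (indicat_real {0<..} t *\<^sub>R (exp (- p * t) *\<^sub>R F t))
        \<le> norm (norm (indicat_real {0<..1} t *\<^sub>R F t) + C * (indicat_real {0<..} t *\<^sub>R exp (- p * t)))"
    proof (rule AE_I2)
      fix t
      show "norm (indicat_real {0<..} t *\<^sub>R (exp (- p * t) *\<^sub>R F t))
        \<le> norm (norm (indicat_real {0<..1} t *\<^sub>R F t) + C * (indicat_real {0<..} t *\<^sub>R exp (- p * t)))"
      proof (cases "0 < t")
        case t: True
        show ?thesis
        proof (cases "t \<le> 1")
          case True
          have "exp (- p * t) * norm (F t) \<le> 1 * norm (F t)"
            using p t by (intro mult_right_mono) auto
          moreover have "0 \<le> C * exp (- p * t)" using C by simp
          ultimately have "exp (- p * t) * norm (F t) \<le> norm (F t) + C * exp (- p * t)" by linarith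
          then show ?thesis using t True C by (simp add: indicator_def)
        next
          case False
          then have "norm (F t) \<le> C" unfolding C_def by (intro completely_monotone_norm_le[OF cm]) auto
          then have "exp (- p * t) * norm (F t) \<le> C * exp (- p * t)" by (simp add: mult.commute)
          then show ?thesis using t False C by (simp add: indicator_def)
        qed
      qed simp
    qed
  qed
qed

lemma LICM_laplace_transformable:
  assumes "LICM F"
  shows "laplace_transformable F"
  unfolding laplace_transformable_def
proof (intro allI impI)
  fix p :: real assume p: "0 < p"
  have "set_integrable lborel {0..1} (\<lambda>t. exp (- p * t) *\<^sub>R F t)"
    unfolding set_integrable_insert_0[OF zero_le_one]
    by (rule set_integrable_subset[OF LICM_laplace[OF assms p]]) auto
  then have "set_integrable lborel ({0..1} \<union> {0<..}) (\<lambda>t. exp (- p * t) *\<^sub>R F t)"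
    using LICM_laplace[OF assms p] by (rule set_integrable_Un) auto
  then show "set_integrable lborel {0..} (\<lambda>t. exp (- p * t) *\<^sub>R F t)" by (rule set_integrable_subset) auto
qed

lemma conv_reflect:
  fixes F G :: "real \<Rightarrow> real^'n^'n"
  shows "(LINT s:{0<..<t}|lborel. F (t - s) ** G s) = (LINT u:{0<..<t}|lborel. F u ** G (t - u))"
proof -
  have ind: "indicat_real {0<..<t} (t - u) = indicat_real {0<..<t} u" for u by (auto simp: indicator_def)
  show ?thesis
    unfolding set_lebesgue_integral_def
    using lborel_integral_real_affine[of "-1" "\<lambda>u. indicat_real {0<..<t} u *\<^sub>R (F (t - u) ** G u)" t]
    by (simp add: ind)
qed

text \<open>The exponential at \<open>t\<close> is the product of those at \<open>t - s\<close> and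
  \<open>s\<close>, so it can be absorbed into both factors of the convolution.\<close>

lemma laplace_reciprocal:
  fixes F G :: "real \<Rightarrow> real^'n^'n"
  assumes F: "LICM F" and G: "LICM G" and p: "0 < p"
    and conv: "\<And>t. 0 < t \<Longrightarrow> (LINT u:{0<..<t}|lborel. F u ** G (t - u)) = mat 1"
  shows "(LINT t:{0<..}|lborel. exp (- p * t) *\<^sub>R F t) ** (LINT t:{0<..}|lborel. exp (- p * t) *\<^sub>R G t) = mat (1 / p)"
proof -
  let ?f = "\<lambda>t. indicat_real {0<..} t *\<^sub>R (exp (- p * t) *\<^sub>R F t)"
  let ?g = "\<lambda>t. indicat_real {0<..} t *\<^sub>R (exp (- p * t) *\<^sub>R G t)"
  have f: "integrable lborel ?f" and g: "integrable lborel ?g"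
    using LICM_laplace[OF F p] LICM_laplace[OF G p] by (simp_all only: set_integrable_def)
  have inner: "(\<integral>s. ?f (t - s) ** ?g s \<partial>lborel) = (indicat_real {0<..} t *\<^sub>R exp (- p * t)) *\<^sub>R mat 1" for t
  proof -
    have eq: "?f (t - s) ** ?g s = exp (- p * t) *\<^sub>R (indicat_real {0<..<t} s *\<^sub>R (F (t - s) ** G s))" for s
    proof (cases "s \<in> {0<..<t}")
      case True
      then show ?thesis
        by (simp add: mm.scaleR_left mm.scaleR_right exp_add[symmetric] algebra_simps)
    qed (auto simp: indicator_def mm.zero_left mm.zero_right)
    have "(\<integral>s. ?f (t - s) ** ?g s \<partial>lborel) = exp (- p * t) *\<^sub>R (LINT s:{0<..<t}|lborel. F (t - s) ** G s)"
      unfolding eq set_lebesgue_integral_def by (rule integral_scaleR_right)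
    also have "\<dots> = (indicat_real {0<..} t *\<^sub>R exp (- p * t)) *\<^sub>R mat 1"
    proof (cases "0 < t")
      case True
      then show ?thesis using conv[OF True] by (simp add: conv_reflect)
    next
      case False
      then have "{0<..<t} = {}" by auto
      then show ?thesis using False by (simp add: set_lebesgue_integral_def)
    qed
    finally show ?thesis .
  qed
  have "(\<integral>t. mat 1 ** (\<integral>s. ?f (t - s) ** ?g s \<partial>lborel) \<partial>lborel) = (\<integral>s. (\<integral>a. mat 1 ** ?f a \<partial>lborel) ** ?g s \<partial>lborel)"
    by (rule integral_convolution[OF f g, of "\<lambda>_. mat 1"]) auto
  moreover have "(\<integral>t. mat 1 ** (\<integral>s. ?f (t - s) ** ?g s \<partial>lborel) \<partial>lborel) = mat (1 / p)"
    unfolding inner matrix_mul_lid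
    using exp_set_integral[OF p] by (simp add: set_integrable_def set_lebesgue_integral_def mat_eq_scaleR[of "1 / p"])
  moreover have "(\<integral>s. (\<integral>a. mat 1 ** ?f a \<partial>lborel) ** ?g s \<partial>lborel) = (\<integral>a. ?f a \<partial>lborel) ** (\<integral>s. ?g s \<partial>lborel)"
    unfolding matrix_mul_lid by (rule integral_bounded_linear[OF mm.bounded_linear_right g])
  ultimately show ?thesis unfolding set_lebesgue_integral_def by metis
qed

lemma laplace_form_tendsto_0:
  fixes F :: "real \<Rightarrow> real^'n^'n"
  assumes F: "LICM F"
  shows "(\<lambda>m. v \<bullet> ((LINT t:{0<..}|lborel. exp (- real (Suc m) * t) *\<^sub>R F t) *v v)) \<longlonglongrightarrow> 0"
proof -
  have i: "integrable lborel (\<lambda>t. indicat_real {0<..} t *\<^sub>R (exp (- p * t) *\<^sub>R F t))" if "0 < p" for p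
    using LICM_laplace[OF F that] by (simp only: set_integrable_def)
  have "(\<lambda>m. \<integral>t. indicat_real {0<..} t *\<^sub>R (exp (- real (Suc m) * t) *\<^sub>R F t) \<partial>lborel) \<longlonglongrightarrow> (\<integral>t. 0 \<partial>(lborel :: real measure))"
  proof (rule integral_dominated_convergence)
    show "integrable lborel (\<lambda>t. norm (indicat_real {0<..} t *\<^sub>R (exp (- 1 * t) *\<^sub>R F t)))"
      using i[of 1] by (intro integrable_norm) auto
    show "(\<lambda>t. indicat_real {0<..} t *\<^sub>R (exp (- real (Suc m) * t) *\<^sub>R F t)) \<in> borel_measurable lborel" for m
      using i[of "real (Suc m)"] by auto
    show "AE t in lborel. norm (indicat_real {0<..} t *\<^sub>R (exp (- real (Suc m) * t) *\<^sub>R F t))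
        \<le> norm (indicat_real {0<..} t *\<^sub>R (exp (- 1 * t) *\<^sub>R F t))" for m
    proof (rule AE_I2)
      fix t :: real
      show "norm (indicat_real {0<..} t *\<^sub>R (exp (- real (Suc m) * t) *\<^sub>R F t))
        \<le> norm (indicat_real {0<..} t *\<^sub>R (exp (- 1 * t) *\<^sub>R F t))"
      proof (cases "0 < t")
        case True
        then have "exp (- real (Suc m) * t) \<le> exp (- 1 * t)" by (simp add: algebra_simps)
        then show ?thesis using True by (simp add: mult_right_mono)
      qed simp
    qed
    show "AE t in lborel. (\<lambda>m. indicat_real {0<..} t *\<^sub>R (exp (- real (Suc m) * t) *\<^sub>R F t)) \<longlonglongrightarrow> 0"
    proof (rule AE_I2)
      fix t :: real
      show "(\<lambda>m. indicat_real {0<..} t *\<^sub>R (exp (- real (Suc m) * t) *\<^sub>R F t)) \<longlonglongrightarrow> 0"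
      proof (cases "0 < t")
        case True
        have "(\<lambda>m. exp (- t) ^ Suc m) \<longlonglongrightarrow> 0"
          using True by (intro LIMSEQ_Suc LIMSEQ_power_zero) auto
        moreover have "exp (- t) ^ Suc m = exp (- real (Suc m) * t)" for m
          using exp_of_nat_mult[of "Suc m" "- t"] by (simp only: mult_minus_left mult_minus_right)
        ultimately have "(\<lambda>m. exp (- real (Suc m) * t)) \<longlonglongrightarrow> 0" by (simp only:)
        then have "(\<lambda>m. exp (- real (Suc m) * t) *\<^sub>R F t) \<longlonglongrightarrow> 0 *\<^sub>R F t"
          by (rule tendsto_scaleR[OF _ tendsto_const])
        then show ?thesis using True by simp
      qed simp
    qed
  qed auto
  then have "(\<lambda>m. LINT t:{0<..}|lborel. exp (- real (Suc m) * t) *\<^sub>R F t) \<longlonglongrightarrow> 0"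
    by (simp add: set_lebesgue_integral_def)
  from bounded_linear.tendsto[OF bounded_linear_form this] show ?thesis by (simp add: form_zero)
qed

text \<open>If \<open>v \<bullet> (G t *v v)\<close> stayed below \<open>c\<close>, then \<open>w = p \<integral> e\<^sup>-\<^sup>p\<^sup>t G(t) v dt\<close> would satisfy
  \<open>v \<bullet> w \<le> c\<close>, while the Cauchy-Schwarz inequality for the Laplace transform of \<open>F\<close>, which maps
  \<open>w\<close> to \<open>v\<close>, bounds \<open>v \<bullet> w\<close> from below by a quantity tending to infinity with \<open>p\<close>.\<close>

lemma reciprocal_form_unbounded:
  fixes F G :: "real \<Rightarrow> real^'n^'n"
  assumes F: "LICM F" and G: "LICM G"
    and conv: "\<And>t. 0 < t \<Longrightarrow> (LINT u:{0<..<t}|lborel. F u ** G (t - u)) = mat 1"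
    and c: "\<And>t. 0 < t \<Longrightarrow> v \<bullet> (G t *v v) \<le> c"
  shows "v = 0"
proof -
  have Fcm: "completely_monotone F" and Gcm: "completely_monotone G" using F G by (auto simp: LICM_def)
  have le: "(v \<bullet> v)\<^sup>2 \<le> c * (v \<bullet> ((LINT t:{0<..}|lborel. exp (- p * t) *\<^sub>R F t) *v v))" if p: "0 < p" for p
  proof -
    let ?F = "LINT t:{0<..}|lborel. exp (- p * t) *\<^sub>R F t"
    let ?G = "LINT t:{0<..}|lborel. exp (- p * t) *\<^sub>R G t"
    define w where "w = (p *\<^sub>R ?G) *v v"
    have Fpsd: "psd ?F"
      using completely_monotone_psd[OF Fcm] by (intro psd_set_integral[OF LICM_laplace[OF F p]] psd_scaleR) auto
    have "?F ** (p *\<^sub>R ?G) = mat 1"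
      using laplace_reciprocal[OF F G p conv] p by (simp add: mm.scaleR_right mat_eq_scaleR[of "1 / p"])
    then have Fw: "?F *v w = v" by (simp add: w_def matrix_vector_mul_assoc)
    have gi: "integrable lborel (\<lambda>t. indicat_real {0<..} t *\<^sub>R (exp (- p * t) *\<^sub>R G t))"
      using LICM_laplace[OF G p] by (simp only: set_integrable_def)
    have ei: "integrable lborel (\<lambda>t. indicat_real {0<..} t *\<^sub>R exp (- p * t))"
      using exp_set_integral(1)[OF p] by (simp only: set_integrable_def)
    have "v \<bullet> (?G *v v) = (\<integral>t. v \<bullet> ((indicat_real {0<..} t *\<^sub>R (exp (- p * t) *\<^sub>R G t)) *v v) \<partial>lborel)"
      unfolding set_lebesgue_integral_def by (rule integral_bounded_linear[OF bounded_linear_form gi, symmetric])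
    also have "\<dots> \<le> (\<integral>t. c * (indicat_real {0<..} t *\<^sub>R exp (- p * t)) \<partial>lborel)"
    proof (rule integral_mono)
      show "integrable lborel (\<lambda>t. v \<bullet> ((indicat_real {0<..} t *\<^sub>R (exp (- p * t) *\<^sub>R G t)) *v v))"
        by (rule integrable_bounded_linear[OF bounded_linear_form gi])
      show "integrable lborel (\<lambda>t. c * (indicat_real {0<..} t *\<^sub>R exp (- p * t)))"
        using ei by (rule integrable_mult_right)
      show "v \<bullet> ((indicat_real {0<..} t *\<^sub>R (exp (- p * t) *\<^sub>R G t)) *v v) \<le> c * (indicat_real {0<..} t *\<^sub>R exp (- p * t))" for t
        using c[of t] by (auto simp: indicator_def form_scaleR mult.commute)
    qed
    also have "\<dots> = c / p"
      using exp_set_integral(2)[OF p] by (simp add: set_lebesgue_integral_def)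
    finally have vw: "v \<bullet> w \<le> c" using p by (simp add: w_def form_scaleR field_simps)
    have "(v \<bullet> v)\<^sup>2 \<le> (v \<bullet> (?F *v v)) * (w \<bullet> v)"
      using psd_cauchy_schwarz[OF Fpsd, of v w] unfolding Fw .
    also have "\<dots> \<le> (v \<bullet> (?F *v v)) * c"
      using vw psd_nonneg[OF Fpsd] by (intro mult_left_mono) (auto simp: inner_commute)
    finally show ?thesis by (simp add: mult.commute)
  qed
  have "(v \<bullet> v)\<^sup>2 \<le> c * 0"
  proof (rule LIMSEQ_le_const[OF tendsto_mult[OF tendsto_const laplace_form_tendsto_0[OF F]]])
    show "\<exists>N. \<forall>m\<ge>N. (v \<bullet> v)\<^sup>2 \<le> c * (v \<bullet> ((LINT t:{0<..}|lborel. exp (- real (Suc m) * t) *\<^sub>R F t) *v v))"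
      using le[of "real (Suc m)" for m] by (intro exI allI impI) (simp del: of_nat_Suc)
  qed
  then show ?thesis by simp
qed

text \<open>\<open>reciprocal_form_unbounded\<close> excludes boundedness in one direction at a
  time. Compactness of the unit sphere makes this uniform: if blow-up failed, the nonempty compact
  sets \<open>S k\<close> would decrease and share a unit vector \<open>v\<close> along which the
  form of \<open>G\<close> stays below \<open>c\<close>.\<close>

lemma reciprocal_blows_up:
  fixes F G :: "real \<Rightarrow> real^'n^'n"
  assumes F: "LICM F" and G: "LICM G"
    and conv: "\<And>t. 0 < t \<Longrightarrow> (LINT u:{0<..<t}|lborel. F u ** G (t - u)) = mat 1"
  shows "blows_up G"
  unfolding blows_up_def
proof (intro allI impI, rule ccontr)
  fix c :: real assume c: "0 < c"
    and no: "\<not> (\<exists>d>0. \<forall>t. 0 < t \<and> t \<le> d \<longrightarrow> (\<forall>v. c * (v \<bullet> v) \<le> v \<bullet> (G t *v v)))"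
  have Gcm: "completely_monotone G" using G by (simp add: LICM_def)
  define S where "S k = sphere 0 1 \<inter> {v. v \<bullet> (G (1 / real (Suc k)) *v v) \<le> c}" for k
  have "\<Inter>(range S) \<noteq> {}"
  proof (rule compact_nest)
    fix k
    have "closed {v. v \<bullet> (G (1 / real (Suc k)) *v v) \<le> c}"
      by (intro closed_Collect_le continuous_intros mv.continuous_on)
    then show "compact (S k)" unfolding S_def by (intro compact_Int_closed compact_sphere)
    have k0: "0 < 1 / real (Suc k)" by simp
    then obtain t v where t: "0 < t" "t \<le> 1 / real (Suc k)" and v: "v \<bullet> (G t *v v) < c * (v \<bullet> v)"
      using no by (meson not_le)
    have v0: "v \<noteq> 0" using v by auto
    \<comment> \<open>The failure occurs at an unknown \<open>t \<le> 1 / Suc k\<close>;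
      monotonicity moves it to \<open>1 / Suc k\<close> itself, and scaling moves \<open>v\<close>
      to the sphere.\<close>
    have "v \<bullet> (G (1 / real (Suc k)) *v v) \<le> v \<bullet> (G t *v v)"
      by (rule completely_monotone_decreasing[OF Gcm t])
    then have "v \<bullet> (G (1 / real (Suc k)) *v v) \<le> c * (norm v)\<^sup>2"
      using v by (simp add: power2_norm_eq_inner)
    then have "(v /\<^sub>R norm v) \<in> S k"
      using v0 by (simp add: S_def mv.scaleR_right field_simps power2_eq_square)
    then show "S k \<noteq> {}" by blast
  next
    fix i j :: nat assume ij: "i \<le> j"
    then have "1 / real (Suc j) \<le> 1 / real (Suc i)" by (simp add: field_simps)
    then have "v \<bullet> (G (1 / real (Suc i)) *v v) \<le> v \<bullet> (G (1 / real (Suc j)) *v v)" for v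
      by (intro completely_monotone_decreasing[OF Gcm]) simp_all
    then show "S j \<subseteq> S i"
      unfolding S_def using order_trans by blast
  qed
  then obtain v where v: "\<And>k. v \<in> S k" by blast
  have "v \<bullet> (G t *v v) \<le> c" if t: "0 < t" for t
  proof -
    obtain k where k: "1 / real (Suc k) < t" using nat_approx_posE[OF t] by metis
    have "v \<bullet> (G t *v v) \<le> v \<bullet> (G (1 / real (Suc k)) *v v)"
      using k by (intro completely_monotone_decreasing[OF Gcm]) auto
    then show ?thesis using v[of k] by (simp add: S_def)
  qed
  from reciprocal_form_unbounded[OF F G conv this] have "v = 0" .
  then show False using v[of 0] by (simp add: S_def)
qed

section \<open>Uniqueness\<close>

text \<open>Dynkin's argument on the intersection-stable generator of half-lines; complements use
  the hypothesis at \<open>x = b\<close>.\<close>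

lemma set_integral_0_of_initial_intervals:
  fixes f :: "real \<Rightarrow> 'a::euclidean_space"
  assumes f: "set_integrable lborel {0..b} f" and z: "\<And>x. 0 \<le> x \<Longrightarrow> x \<le> b \<Longrightarrow> (LINT s:{0..x}|lborel. f s) = 0"
    and A: "A \<in> sets borel" and b: "0 \<le> b"
  shows "(LINT s:A \<inter> {0..b}|lborel. f s) = 0"
proof -
  have si: "set_integrable lborel (A \<inter> {0..b}) f" if "A \<in> sets borel" for A
    by (rule set_integrable_subset[OF f]) (use that in auto)
  have sb: "sets (borel :: real measure) = sigma_sets UNIV (range (\<lambda>a. {..a}))"
    unfolding borel_eq_atMost by simp
  have "Int_stable (range (\<lambda>a::real. {..a}))"
    by (auto simp: Int_stable_def)
  moreover have "range (\<lambda>a::real. {..a}) \<subseteq> Pow UNIV" by simp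
  moreover have "A \<in> sigma_sets UNIV (range (\<lambda>a. {..a}))"
    using A by (simp add: sb)
  ultimately show ?thesis
  proof (induction rule: sigma_sets_induct_disjoint)
    case (basic A)
    then obtain a where A: "A = {..a}" by auto
    show ?case
    proof (cases "0 \<le> a")
      case True
      then have "A \<inter> {0..b} = {0..min a b}" using A by auto
      then show ?thesis using z[of "min a b"] True b by simp
    next
      case False
      then have "A \<inter> {0..b} = {}" using A by auto
      then show ?thesis by (simp add: set_lebesgue_integral_def)
    qed
  next
    case empty
    then show ?case by (simp add: set_lebesgue_integral_def)
  next
    case (compl A)
    then have A: "A \<in> sets borel" by (simp add: sb)
    have "{0..b} = (A \<inter> {0..b}) \<union> ((UNIV - A) \<inter> {0..b})" by auto
    then have "(LINT s:{0..b}|lborel. f s) = (LINT s:(A \<inter> {0..b}) \<union> ((UNIV - A) \<inter> {0..b})|lborel. f s)" by simp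
    also have "\<dots> = (LINT s:A \<inter> {0..b}|lborel. f s) + (LINT s:(UNIV - A) \<inter> {0..b}|lborel. f s)"
      by (rule set_integral_Un[OF _ si si]) (use A in auto)
    finally show ?case using z[of b] compl b by simp
  next
    case (union A)
    then have A: "A i \<in> sets borel" for i by (auto simp: sb)
    have U: "(\<Union>i. A i) \<inter> {0..b} = (\<Union>i. A i \<inter> {0..b})" by auto
    have "(LINT s:(\<Union>i. A i \<inter> {0..b})|lborel. f s) = (\<Sum>i. (LINT s:A i \<inter> {0..b}|lborel. f s))"
    proof (rule lebesgue_integral_countable_add)
      show "set_integrable lborel (\<Union>i. A i \<inter> {0..b}) f"
        using si[of "\<Union>i. A i"] A unfolding U by auto
      show "A i \<inter> {0..b} \<in> sets lborel" for i using A by simp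
      show "A i \<inter> {0..b} \<inter> (A j \<inter> {0..b}) = {}" if "i \<noteq> j" for i j
        using union(1) that by (auto simp: disjoint_family_on_def)
    qed
    then show ?case using union unfolding U by simp
  qed
qed

lemma atom_density_eqI:
  fixes C C' :: "real^'n^'n"
  assumes H: "locally_integrable H" "locally_integrable H'"
    and eq: "\<And>x. 0 \<le> x \<Longrightarrow> atom_density C H {0..x} = atom_density C' H' {0..x}"
  shows "atom_density C H = atom_density C' H'"
proof
  fix B
  have bb: "{0..x} \<in> bounded_borel" for x :: real by (auto simp: bounded_borel_def)
  \<comment> \<open>At \<open>x = 0\<close> the density integrates over a null set, so only the
    atoms remain.\<close>
  have CC: "C = C'"
  proof -
    have "(LINT t:{0::real}|lborel. K t) = 0" for K :: "real \<Rightarrow> real^'n^'n"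
    proof -
      have "(\<lambda>x. indicat_real {0} x *\<^sub>R K x) = (\<lambda>x. indicat_real {0} x *\<^sub>R K 0)" by (auto simp: indicator_def)
      then show ?thesis by (simp add: set_lebesgue_integral_def)
    qed
    then show ?thesis using eq[of 0] bb[of 0] by (simp add: atom_density_def)
  qed
  show "atom_density C H B = atom_density C' H' B"
  proof (cases "B \<in> bounded_borel")
    case True
    then obtain b where b: "\<And>x. x \<in> B \<Longrightarrow> \<bar>x\<bar> \<le> b" and B: "B \<in> sets borel" "B \<subseteq> {0..}"
      by (auto simp: bounded_borel_def bounded_iff)
    have sub: "B \<inter> {0..\<bar>b\<bar>} = B" using b B(2) by force
    have si: "set_integrable lborel {0..x} H" "set_integrable lborel {0..x} H'" for x
      using H by (auto simp: locally_integrable_def)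
    have "(LINT s:{0..x}|lborel. H s - H' s) = 0" if "0 \<le> x" for x
      using eq[OF that] bb[of x] CC by (simp add: set_integral_diff[OF si] atom_density_def)
    then have "(LINT s:B \<inter> {0..\<bar>b\<bar>}|lborel. H s - H' s) = 0"
      by (intro set_integral_0_of_initial_intervals set_integral_diff si B) auto
    then have 0: "(LINT s:B|lborel. H s - H' s) = 0" by (simp only: sub)
    have "set_integrable lborel B H" "set_integrable lborel B H'"
      using set_integrable_subset[OF si(1)[of "\<bar>b\<bar>"], of B] set_integrable_subset[OF si(2)[of "\<bar>b\<bar>"], of B] sub B(1) by auto
    then show ?thesis using 0 CC by (simp add: atom_density_def set_integral_diff)
  qed (simp add: atom_density_def)
qed

text \<open>The atom sits at 0, which belongs to every \<open>{0..x}\<close>, so the distribution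
  function has no jump on \<open>[0, b]\<close>.\<close>

lemma atom_density_continuous:
  fixes C :: "real^'n^'n"
  assumes H: "locally_integrable H"
  shows "continuous_on {0..b} (\<lambda>x. atom_density C H {0..x})"
proof -
  have bb: "{0..x} \<in> bounded_borel" for x :: real by (auto simp: bounded_borel_def)
  have si: "set_integrable lborel {0..x} H" for x using H by (simp add: locally_integrable_def)
  have "continuous_on {0..b} (\<lambda>x. C + integral {0..x} H)"
    by (intro continuous_intros indefinite_integral_continuous_1 set_borel_integral_eq_integral(1)[OF si])
  moreover have "C + integral {0..x} H = atom_density C H {0..x}" if "x \<in> {0..b}" for x
    using that bb[of x] by (simp add: atom_density_def set_borel_integral_eq_integral(2)[OF si])
  ultimately show ?thesis by (rule continuous_on_eq)
qed

text \<open>Turns the equation between measures into an integral equation for the distribution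
  function, which is continuous on \<open>[0, b]\<close> even in the presence of an atom.\<close>

lemma conv_measure_initial:
  fixes F :: "real \<Rightarrow> real^'n^'n"
  assumes "0 \<le> t"
  shows "(F \<star> atom_density C H) {0..t} = (LINT s:{0..t}|lborel. F s ** atom_density C H {0..t - s})"
proof -
  have bb: "{0..t} \<in> bounded_borel" by (auto simp: bounded_borel_def)
  have "indicat_real {0..} s *\<^sub>R (F s ** atom_density C H {u. 0 \<le> u \<and> s + u \<in> {0..t}})
      = indicat_real {0..t} s *\<^sub>R (F s ** atom_density C H {0..t - s})" for s
  proof (cases "0 \<le> s")
    case s: True
    then have set: "{u. 0 \<le> u \<and> s + u \<in> {0..t}} = {0..t - s}" by auto
    show ?thesis
    proof (cases "s \<le> t")
      case False
      then have "{0..t - s} = {}" by auto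
      then have "atom_density C H {0..t - s} = 0" by (simp add: atom_density_def set_lebesgue_integral_def)
      then show ?thesis unfolding set by (simp add: mm.zero_right)
    qed (use s in \<open>simp only: set, simp\<close>)
  qed simp
  then show ?thesis
    using bb by (simp add: conv_measure_def set_lebesgue_integral_def)
qed

lemma convolution_solution_initial:
  fixes F :: "real \<Rightarrow> real^'n^'n"
  assumes "F \<star> atom_density C H = density_measure (\<lambda>_. mat 1)" "0 \<le> t"
  shows "(LINT s:{0..t}|lborel. F s ** atom_density C H {0..t - s}) = mat t"
proof -
  have bb: "{0..t} \<in> bounded_borel" by (auto simp: bounded_borel_def)
  have "(LINT s:{0..t}|lborel. F s ** atom_density C H {0..t - s}) = density_measure (\<lambda>_. mat 1) {0..t}"
    using conv_measure_initial[OF assms(2), of F C H] assms(1) by simp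
  also have "\<dots> = mat t"
    using bb assms(2) by (simp add: atom_density_def set_lebesgue_integral_def mat_eq_scaleR[of t])
  finally show ?thesis .
qed

text \<open>The integral in the hypothesis is the twice iterated primitive of \<open>f\<close>. Two
  differentiations settle positive arguments, and continuity settles 0.\<close>

lemma continuous_eq_0_of_second_primitive:
  fixes f :: "real \<Rightarrow> 'a::euclidean_space"
  assumes cont: "\<And>b. continuous_on {0..b} f"
    and z: "\<And>t. 0 < t \<Longrightarrow> integral {0..t} (\<lambda>s. (t - s) *\<^sub>R f s) = 0"
    and x: "0 \<le> x"
  shows "f x = 0"
proof -
  have sc: "continuous_on {0..b} (\<lambda>s. s *\<^sub>R f s)" for b by (intro continuous_intros cont)
  have A: "((\<lambda>u. integral {0..u} f) has_vector_derivative f t) (at t)" if "0 < t" for t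
    using integral_has_vector_derivative[OF cont[of "t + 1"], of t] that
    by (simp add: at_within_Icc_at)
  have B: "((\<lambda>u. integral {0..u} (\<lambda>s. s *\<^sub>R f s)) has_vector_derivative t *\<^sub>R f t) (at t)" if "0 < t" for t
    using integral_has_vector_derivative[OF sc[of "t + 1"], of t] that
    by (simp add: at_within_Icc_at)
  have eq: "t *\<^sub>R integral {0..t} f - integral {0..t} (\<lambda>s. s *\<^sub>R f s) = 0" if "0 < t" for t
  proof -
    have "f integrable_on {0..t}" "(\<lambda>s. s *\<^sub>R f s) integrable_on {0..t}"
      by (intro integrable_continuous_real cont sc)+
    then have "integral {0..t} (\<lambda>s. t *\<^sub>R f s - s *\<^sub>R f s) = t *\<^sub>R integral {0..t} f - integral {0..t} (\<lambda>s. s *\<^sub>R f s)"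
      by (simp add: integral_diff integrable_cmul)
    then show ?thesis using z[OF that] by (simp add: scaleR_left_diff_distrib)
  qed
  have A0: "integral {0..t} f = 0" if t: "0 < t" for t
  proof -
    have "((\<lambda>u. u *\<^sub>R integral {0..u} f - integral {0..u} (\<lambda>s. s *\<^sub>R f s)) has_vector_derivative
        (t *\<^sub>R f t + 1 *\<^sub>R integral {0..t} f) - t *\<^sub>R f t) (at t)"
      by (intro has_vector_derivative_diff has_vector_derivative_scaleR A[OF t] B[OF t] DERIV_ident)
    moreover have "((\<lambda>u. u *\<^sub>R integral {0..u} f - integral {0..u} (\<lambda>s. s *\<^sub>R f s)) has_vector_derivative 0) (at t)"
      by (rule has_vector_derivative_transform_within_open[OF has_vector_derivative_const, of "{0<..}"])
        (use t eq in auto)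
    ultimately show ?thesis using vector_derivative_unique_at by fastforce
  qed
  have f0: "f t = 0" if t: "0 < t" for t
  proof -
    have "((\<lambda>u. integral {0..u} f) has_vector_derivative 0) (at t)"
      by (rule has_vector_derivative_transform_within_open[OF has_vector_derivative_const, of "{0<..}"])
        (use t A0 in auto)
    then show ?thesis using A[OF t] vector_derivative_unique_at by blast
  qed
  show ?thesis
  proof (cases "x = 0")
    case True
    have "(f \<longlongrightarrow> f 0) (at 0 within {0..1})"
      using cont[of 1] by (auto simp: continuous_on_def)
    then have "(f \<longlongrightarrow> f 0) (at_right 0)" by (simp add: at_within_Icc_at_right)
    moreover have "(f \<longlongrightarrow> 0) (at_right 0)"
      by (rule tendsto_eventually) (use f0 in \<open>auto simp: eventually_at_filter\<close>)
    ultimately show ?thesis using True tendsto_unique[of "at_right (0::real)"] by auto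
  qed (use f0 x in auto)
qed

lemma transpose_set_integral_mult:
  fixes P Q :: "real \<Rightarrow> real^'n^'n"
  assumes "set_integrable lborel A (\<lambda>x. P x ** Q x)"
    and "\<And>x. x \<in> A \<Longrightarrow> transpose (P x) = P x" "\<And>x. x \<in> A \<Longrightarrow> transpose (Q x) = Q x"
  shows "transpose (LINT x:A|lborel. P x ** Q x) = (LINT x:A|lborel. Q x ** P x)"
proof -
  have "transpose (LINT x:A|lborel. P x ** Q x) = (\<integral>x. transpose (indicat_real A x *\<^sub>R (P x ** Q x)) \<partial>lborel)"
    unfolding set_lebesgue_integral_def
    by (rule integral_bounded_linear[OF bounded_linear_transpose, symmetric])
      (use assms(1) in \<open>simp add: set_integrable_def\<close>)
  also have "\<dots> = (LINT x:A|lborel. Q x ** P x)"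
    unfolding set_lebesgue_integral_def
    by (rule Bochner_Integration.integral_cong) (auto simp: indicator_def transpose_scaleR matrix_transpose_mul assms(2,3) transpose_zero)
  finally show ?thesis .
qed

lemma set_integral_drop_endpoints:
  fixes f :: "real \<Rightarrow> 'a::euclidean_space"
  shows "(LINT s:{0..t}|lborel. f s) = (LINT s:{0<..t}|lborel. f s)"
    and "(LINT s:{0..t}|lborel. f s) = (LINT s:{0<..<t}|lborel. f s)"
  by (rule set_integral_discrete_difference[of "{0, t}"]; auto)+

lemma reciprocal_is_solution:
  fixes F G :: "real \<Rightarrow> real^'n^'n"
  assumes F: "LICM F" and G: "LICM G"
    and conv: "\<And>t. 0 < t \<Longrightarrow> (LINT u:{0<..<t}|lborel. F u ** G (t - u)) = mat 1"
  shows "convolution_solution F (density_measure G)"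
proof -
  have K: "F t ** 0 + conv_fun F G t = mat 1" if "0 < t" for t
    using conv[OF that]
    by (simp add: conv_fun_def mm.zero_right set_integral_drop_endpoints(2) conv_reflect)
  have "F \<star> density_measure G = density_measure (\<lambda>t. F t ** 0 + conv_fun F G t)"
    by (rule conv_measure_atom_density[OF LICM_locally_integrable[OF F] LICM_locally_integrable[OF G]])
  also have "\<dots> = density_measure (\<lambda>_. mat 1)"
  proof
    fix B
    show "density_measure (\<lambda>t. F t ** 0 + conv_fun F G t) B = density_measure (\<lambda>_. mat 1) B"
    proof (cases "B \<in> bounded_borel")
      case True
      then have B: "B \<subseteq> {0..}" by (simp add: bounded_borel_def)
      have "(LINT t:B|lborel. F t ** 0 + conv_fun F G t) = (LINT t:B|lborel. mat 1)"
        unfolding set_lebesgue_integral_def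
      \<comment> \<open>The identity of the densities is available for positive arguments only; the
        point 0 is null.\<close>
      proof (rule integral_discrete_difference[of "{0}"])
        fix x :: real assume "x \<notin> {0}"
        then show "indicat_real B x *\<^sub>R (F x ** 0 + conv_fun F G x) = indicat_real B x *\<^sub>R mat 1"
          using B K[of x] by (cases "x \<in> B") force+
      qed auto
      then show ?thesis by (simp add: atom_density_def)
    qed (simp add: atom_density_def)
  qed
  finally have "F \<star> density_measure G = density_measure (\<lambda>_. mat 1)" .
  moreover have "density_measure G \<in> solution_class"
    unfolding solution_class_def using LICM_locally_integrable[OF G] LICM_laplace_transformable[OF G] by blast
  ultimately show ?thesis by (simp add: convolution_solution_def)
qed

lemma set_integrable_conv_continuous:
  fixes F K :: "real \<Rightarrow> real^'n^'n"
  assumes F: "set_integrable lborel {0..t} F" and K: "continuous_on {0..t} K"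
  shows "set_integrable lborel {0..t} (\<lambda>s. F s ** K (t - s))"
proof -
  have c: "continuous_on {0..t} (\<lambda>s. K (t - s))"
    by (rule continuous_on_compose2[OF K]) (auto intro!: continuous_intros)
  then have "bounded ((\<lambda>s. K (t - s)) ` {0..t})"
    by (intro compact_imp_bounded compact_continuous_image) auto
  then obtain b where "\<forall>s\<in>{0..t}. norm (K (t - s)) \<le> b"
    unfolding bounded_iff by auto
  then show ?thesis
    by (intro set_integrable_mult_bounded_right[OF F set_borel_measurable_continuous[OF c]]) auto
qed

text \<open>\<open>X\<close> and \<open>Y\<close> are distribution functions of the two solutions,
  and \<open>F\<close> convolved with \<open>D = X - Y\<close> is 0. Convolving with
  \<open>Y\<close> from the left, and using that \<open>Y\<close> convolved with \<open>F\<close> is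
  \<open>t I\<close>, shows that \<open>t I\<close> convolved with \<open>D\<close> is 0. That
  convolution is the second primitive of \<open>D\<close>.\<close>

lemma solution_unique:
  fixes F G :: "real \<Rightarrow> real^'n^'n"
  assumes F: "LICM F" and G: "LICM G"
    and conv: "\<And>t. 0 < t \<Longrightarrow> (LINT u:{0<..<t}|lborel. F u ** G (t - u)) = mat 1"
    and H: "locally_integrable H" and sol: "F \<star> atom_density C H = density_measure (\<lambda>_. mat 1)"
  shows "atom_density C H = density_measure G"
proof -
  have Gl: "locally_integrable G" by (rule LICM_locally_integrable[OF G])
  have Fi: "set_integrable lborel {0..t} F" for t
    using LICM_locally_integrable[OF F] by (simp add: locally_integrable_def)
  have Gsol: "F \<star> density_measure G = density_measure (\<lambda>_. mat 1)"
    using reciprocal_is_solution[OF F G conv] by (simp add: convolution_solution_def)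
  define X where "X x = atom_density C H {0..x}" for x
  define Y where "Y x = density_measure G {0..x}" for x
  define D where "D x = X x - Y x" for x
  have Xc: "continuous_on {0..b} X" and Yc: "continuous_on {0..b} Y" for b
    unfolding X_def Y_def by (rule atom_density_continuous[OF H], rule atom_density_continuous[OF Gl])
  have Dc: "continuous_on {0..b} D" for b unfolding D_def by (intro continuous_intros Xc Yc)
  have FX: "(LINT s:{0..t}|lborel. F s ** X (t - s)) = mat t"
    and FY: "(LINT s:{0..t}|lborel. F s ** Y (t - s)) = mat t" if "0 \<le> t" for t
    unfolding X_def Y_def by (rule convolution_solution_initial[OF sol that], rule convolution_solution_initial[OF Gsol that])
  have FD: "(LINT s:{0<..t}|lborel. F s ** D (t - s)) = 0" if "0 \<le> t" for t
    using FX[OF that] FY[OF that]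
      set_integral_diff(2)[OF set_integrable_conv_continuous[OF Fi Xc] set_integrable_conv_continuous[OF Fi Yc]]
    by (simp add: D_def mm.diff_right set_integral_drop_endpoints(1)[symmetric])
  have Ysym: "transpose (Y x) = Y x" if "0 \<le> x" for x
  proof -
    have "{0..x} \<in> bounded_borel" by (auto simp: bounded_borel_def)
    then have "Y x = (LINT s:{0<..x}|lborel. G s)"
      by (simp add: Y_def atom_density_def set_integral_drop_endpoints(1))
    moreover have "psd (LINT s:{0<..x}|lborel. G s)"
      by (rule psd_set_integral[OF LICM_set_integrable[OF G]])
        (use G completely_monotone_psd in \<open>auto simp: LICM_def\<close>)
    ultimately show ?thesis by (simp add: psd_symmetric)
  qed
  \<comment> \<open>The known identity has \<open>F\<close> on the left. Transposing exchanges the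
    factors, since the values of \<open>F\<close> and \<open>Y\<close> are symmetric at the
    arguments that occur.\<close>
  have YF: "(LINT s:{0<..t}|lborel. Y (t - s) ** F s) = mat t" if t: "0 \<le> t" for t
  proof -
    have i: "set_integrable lborel {0<..t} (\<lambda>s. F s ** Y (t - s))"
      by (rule set_integrable_subset[OF set_integrable_conv_continuous[OF Fi Yc]]) auto
    have "transpose (LINT s:{0<..t}|lborel. F s ** Y (t - s)) = (LINT s:{0<..t}|lborel. Y (t - s) ** F s)"
      by (rule transpose_set_integral_mult[OF i])
        (use F completely_monotone_psd psd_symmetric Ysym in \<open>auto simp: LICM_def\<close>)
    then show ?thesis using FY[OF t] by (simp add: set_integral_drop_endpoints(1)[symmetric] transpose_mat)
  qed
  have D2: "integral {0..T} (\<lambda>s. (T - s) *\<^sub>R D s) = 0" if T: "0 < T" for T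
  proof -
    let ?f = "\<lambda>s. indicat_real {0<..T} s *\<^sub>R F s"
    let ?k = "\<lambda>s. indicat_real {0..T} s *\<^sub>R D s"
    let ?p = "\<lambda>s. indicat_real {0..T} s *\<^sub>R Y (T - s)"
    have f: "integrable lborel ?f" using LICM_set_integrable[OF F, of T] by (simp add: set_integrable_def)
    have k: "integrable lborel ?k" using borel_integrable_atLeastAtMost'[OF Dc] by (simp add: set_integrable_def)
    have pc: "continuous_on {0..T} (\<lambda>s. Y (T - s))"
      by (rule continuous_on_compose2[OF Yc[of T]]) (auto intro!: continuous_intros)
    then have "bounded ((\<lambda>s. Y (T - s)) ` {0..T})"
      by (intro compact_imp_bounded compact_continuous_image) auto
    then obtain b where b: "\<forall>s\<in>{0..T}. norm (Y (T - s)) \<le> b"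
      unfolding bounded_iff by auto
    have pm: "?p \<in> borel_measurable borel"
      by (rule borel_measurable_continuous_on_indicator[OF _ pc]) simp
    have pb: "norm (?p s) \<le> max b 0" for s using b by (auto simp: indicator_def le_max_iff_disj)
    have zero: "?p t ** (\<integral>s. ?f (t - s) ** ?k s \<partial>lborel) = 0" for t
    proof (cases "t \<in> {0..T}")
      case True
      have "(\<integral>s. ?f (t - s) ** ?k s \<partial>lborel) = (LINT s:{0..<t}|lborel. F (t - s) ** D s)"
        unfolding set_lebesgue_integral_def
        by (rule Bochner_Integration.integral_cong)
          (use True in \<open>auto simp: indicator_def mm.zero_left mm.zero_right\<close>)
      also have "\<dots> = (LINT u:{0<..t}|lborel. F u ** D (t - u))"
        using set_integral_reflect(1)[of 0 t "\<lambda>s. F (t - s) ** D s" t] by simp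
      also have "\<dots> = 0" using FD[of t] True by simp
      finally show ?thesis by (simp only: mm.zero_right)
    qed (simp add: mm.zero_left)
    have inner: "(\<integral>a. ?p (a + s) ** ?f a \<partial>lborel) ** ?k s = indicat_real {0..T} s *\<^sub>R ((T - s) *\<^sub>R D s)" for s
    proof (cases "s \<in> {0..T}")
      case True
      have "(\<integral>a. ?p (a + s) ** ?f a \<partial>lborel) = (LINT a:{0<..T - s}|lborel. Y (T - s - a) ** F a)"
        unfolding set_lebesgue_integral_def
        by (rule Bochner_Integration.integral_cong)
          (use True in \<open>auto simp: indicator_def mm.zero_left mm.zero_right algebra_simps\<close>)
      also have "\<dots> = (T - s) *\<^sub>R mat 1" using YF[of "T - s"] True by (simp add: mat_eq_scaleR[of "T - s"])
      finally show ?thesis using True by (simp add: mm.scaleR_left)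
    qed (simp add: mm.zero_right)
    have "(\<integral>t. ?p t ** (\<integral>s. ?f (t - s) ** ?k s \<partial>lborel) \<partial>lborel) = (\<integral>s. (\<integral>a. ?p (a + s) ** ?f a \<partial>lborel) ** ?k s \<partial>lborel)"
      by (rule integral_convolution[OF f k pm pb])
    then have "(LINT s:{0..T}|lborel. (T - s) *\<^sub>R D s) = 0"
      unfolding zero inner by (simp add: set_lebesgue_integral_def)
    moreover have "set_integrable lborel {0..T} (\<lambda>s. (T - s) *\<^sub>R D s)"
      by (intro borel_integrable_atLeastAtMost' continuous_intros Dc)
    ultimately show ?thesis using set_borel_integral_eq_integral(2) by metis
  qed
  have "D x = 0" if "0 \<le> x" for x
    by (rule continuous_eq_0_of_second_primitive[OF Dc D2 that])
  then show ?thesis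
    by (intro atom_density_eqI[OF H Gl]) (simp add: D_def X_def Y_def)
qed

theorem theorem3p2:
  fixes F :: "real \<Rightarrow> real^'n^'n"
  assumes "singular_LICM F"
  shows "(\<exists>!X. convolution_solution F X) \<and>
         (\<forall>X. convolution_solution F X \<longrightarrow> (\<exists>G. singular_LICM G \<and> X = density_measure G))"
proof -
  have F: "LICM F" using assms by (simp add: singular_LICM_def)
  have bu: "blows_up F"
    using assms singular_imp_blows_up unfolding singular_LICM_def LICM_def by blast
  obtain G where G: "LICM G" and conv: "\<And>t. 0 < t \<Longrightarrow> (LINT u:{0<..<t}|lborel. F u ** G (t - u)) = mat 1"
    by (rule LICM_reciprocal_exists[OF F bu]) (rule that)
  have sG: "singular_LICM G"
    using G blows_up_imp_singular[OF reciprocal_blows_up[OF F G conv]] by (simp add: singular_LICM_def)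
  have sol: "convolution_solution F (density_measure G)"
    by (rule reciprocal_is_solution[OF F G conv])
  have uniq: "X = density_measure G" if X: "convolution_solution F X" for X
  proof -
    obtain C H where XH: "X = atom_density C H" "locally_integrable H"
      using X unfolding convolution_solution_def solution_class_def by blast
    then show ?thesis using X solution_unique[OF F G conv XH(2), of C] by (simp add: convolution_solution_def)
  qed
  show ?thesis using sol uniq sG by blast
qed

end
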